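(* Let $\mu>0$ be a constant, $P(\rho)=A\rho^\gamma$ and $\lambda(\rho)=c\rho^\beta$ with $1<\beta\le\gamma$ and $A,c>0$. Suppose that $(\rho,u)\in C^1([0,T];H^k)$, $k>3$, is a spherically symmetric solution to the Cauchy problem on $\mathbb{R}^2$ $$\rho_t+\mathrm{div}(\rho u)=0,\qquad(\rho u)_t+\mathrm{div}(\rho u\otimes u)+\nabla P(\rho)=\mu\Delta u+\nabla((\mu+\lambda(\rho))\mathrm{div}\,u),\qquad(\rho,u)|_{t=0}=(\rho_0,u_0).$$ If the support of the initial density $\rho_0$ is compact and $\rho_0\not\equiv0$, then $T$ must be finite (i.e. such a solution cannot exist for all time).
   Context: Here $H^k=H^k(\mathbb{R}^2)$, $\rho\ge0$ is the fluid density and $u$ the velocity. Spherically symmetric means $\rho(x,t)=\varrho(r,t)$ and $u(x,t)=v(r,t)\frac xr$ with $r=|x|$. *)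

theory Defs
  imports "HOL-Analysis.Analysis"
begin

definition pd :: "'n::finite \<Rightarrow> (real^'n \<Rightarrow> 'b::real_normed_vector) \<Rightarrow> real^'n \<Rightarrow> 'b" where
  "pd i f x = frechet_derivative f (at x) (axis i 1)"

definition grad :: "(real^'n::finite \<Rightarrow> real) \<Rightarrow> real^'n \<Rightarrow> real^'n" where
  "grad f x = (\<chi> i. pd i f x)"

definition divergence :: "(real^'n::finite \<Rightarrow> real^'n) \<Rightarrow> real^'n \<Rightarrow> real" where
  "divergence w x = (\<Sum>i\<in>UNIV. pd i (\<lambda>y. w y $ i) x)"

definition div_matrix :: "(real^'n::finite \<Rightarrow> real^'n^'n) \<Rightarrow> real^'n \<Rightarrow> real^'n" where
  "div_matrix M x = (\<chi> j. \<Sum>i\<in>UNIV. pd i (\<lambda>y. M y $ i $ j) x)"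

definition laplacian ::
    "(real^'n::finite \<Rightarrow> 'b::real_normed_vector) \<Rightarrow> real^'n \<Rightarrow> 'b" where
  "laplacian f x = (\<Sum>i\<in>UNIV. pd i (pd i f) x)"

definition tensor :: "real^'n::finite \<Rightarrow> real^'n \<Rightarrow> real^'n^'n" where
  "tensor a b = (\<chi> i j. a $ i * b $ j)"

fun C_diff :: "nat \<Rightarrow> (real^'n::finite \<Rightarrow> 'b::real_normed_vector) \<Rightarrow> bool" where
  "C_diff 0 f \<longleftrightarrow> continuous_on UNIV f"
| "C_diff (Suc m) f \<longleftrightarrow> (\<forall>x. f differentiable (at x)) \<and> (\<forall>i. C_diff m (pd i f))"

definition test_function :: "(real^'n::finite \<Rightarrow> real) \<Rightarrow> bool" where
  "test_function \<phi> \<longleftrightarrow> (\<forall>m. C_diff m \<phi>) \<and> compact (closure {x. \<phi> x \<noteq> 0})"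

text \<open>A multi-index of order m is written as a list of m coordinate directions.  On smooth
  functions the order of the list is irrelevant.\<close>

fun pds :: "'n::finite list \<Rightarrow> (real^'n \<Rightarrow> 'b::real_normed_vector) \<Rightarrow> real^'n \<Rightarrow> 'b" where
  "pds [] f = f"
| "pds (d # ds) f = pd d (pds ds f)"

definition L2 :: "(real^'n::finite \<Rightarrow> 'b::euclidean_space) \<Rightarrow> bool" where
  "L2 f \<longleftrightarrow> f \<in> borel_measurable lborel \<and> integrable lborel (\<lambda>x. (norm (f x))\<^sup>2)"

definition has_weak_deriv ::
    "'n::finite list \<Rightarrow> (real^'n \<Rightarrow> 'b::euclidean_space) \<Rightarrow> (real^'n \<Rightarrow> 'b) \<Rightarrow> bool" where
  "has_weak_deriv ds f g \<longleftrightarrow>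
     (\<forall>\<phi>. test_function \<phi> \<longrightarrow>
        (LINT x|lborel. pds ds \<phi> x *\<^sub>R f x)
          = (- 1) ^ length ds *\<^sub>R (LINT x|lborel. \<phi> x *\<^sub>R g x))"

definition sobolev :: "nat \<Rightarrow> (real^'n::finite \<Rightarrow> 'b::euclidean_space) \<Rightarrow> bool" where
  "sobolev k f \<longleftrightarrow> L2 f \<and> (\<forall>ds. length ds \<le> k \<longrightarrow> (\<exists>g. L2 g \<and> has_weak_deriv ds f g))"

text \<open>Weak derivatives are unique almost everywhere, so the choice does not affect the norm below.\<close>

definition weak_deriv ::
    "'n::finite list \<Rightarrow> (real^'n \<Rightarrow> 'b::euclidean_space) \<Rightarrow> real^'n \<Rightarrow> 'b" where
  "weak_deriv ds f = (SOME g. L2 g \<and> has_weak_deriv ds f g)"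

text \<open>Summing over lists counts each mixed derivative once for every ordering of its multi-index,
  so that the terms of order m add up to the squared norm of the full m-th derivative tensor.
  This norm is equivalent to the one that counts each multi-index once.\<close>

definition sobolev_norm :: "nat \<Rightarrow> (real^'n::finite \<Rightarrow> 'b::euclidean_space) \<Rightarrow> real" where
  "sobolev_norm k f =
     sqrt (\<Sum>ds\<in>{ds. length ds \<le> k}. LINT x|lborel. (norm (weak_deriv ds f x))\<^sup>2)"

text \<open>The space $C^1(I;H^k)$: the curve has a derivative in $H^k$ at every time of I, one-sided at
  the end points, and this derivative is continuous with values in $H^k$.\<close>

definition C1_sobolev ::
    "real set \<Rightarrow> nat \<Rightarrow> (real \<Rightarrow> real^'n::finite \<Rightarrow> 'b::euclidean_space) \<Rightarrow> bool" where
  "C1_sobolev I k f \<longleftrightarrow>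
     (\<exists>f'. \<forall>t\<in>I.
        sobolev k (f t) \<and> sobolev k (f' t) \<and>
        ((\<lambda>s. sobolev_norm k (\<lambda>x. (f s x - f t x) /\<^sub>R (s - t) - f' t x)) \<longlongrightarrow> 0) (at t within I) \<and>
        ((\<lambda>s. sobolev_norm k (\<lambda>x. f' s x - f' t x)) \<longlongrightarrow> 0) (at t within I))"

text \<open>The interval $[0,T]$, understood as $[0,\infty)$ for infinite T.\<close>

definition time_interval :: "ereal \<Rightarrow> real set" where
  "time_interval T = {t. 0 \<le> t \<and> ereal t \<le> T}"

text \<open>The equations hold pointwise.  Elements of $H^k$ with $k > 3$ are represented by their
  twice continuously differentiable representatives (in two dimensions these exist by the Sobolev
  embedding and are unique), so all spatial derivatives below are classical.\<close>

definition navier_stokes_solution ::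
    "real \<Rightarrow> (real \<Rightarrow> real) \<Rightarrow> (real \<Rightarrow> real) \<Rightarrow> real set \<Rightarrow> (real^2 \<Rightarrow> real) \<Rightarrow> (real^2 \<Rightarrow> real^2)
      \<Rightarrow> (real \<Rightarrow> real^2 \<Rightarrow> real) \<Rightarrow> (real \<Rightarrow> real^2 \<Rightarrow> real^2) \<Rightarrow> bool" where
  "navier_stokes_solution \<mu> P lam I \<rho>0 u0 \<rho> u \<longleftrightarrow>
     (\<forall>t\<in>I. C_diff 2 (\<rho> t) \<and> C_diff 2 (u t)) \<and>
     (\<forall>t\<in>I. \<forall>x. 0 \<le> \<rho> t x) \<and>
     (\<forall>t\<in>I. \<forall>x.
        (\<lambda>s. \<rho> s x) differentiable (at t within I) \<and>
        vector_derivative (\<lambda>s. \<rho> s x) (at t within I)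
          + divergence (\<lambda>y. \<rho> t y *\<^sub>R u t y) x = 0) \<and>
     (\<forall>t\<in>I. \<forall>x.
        (\<lambda>s. \<rho> s x *\<^sub>R u s x) differentiable (at t within I) \<and>
        vector_derivative (\<lambda>s. \<rho> s x *\<^sub>R u s x) (at t within I)
          + div_matrix (\<lambda>y. \<rho> t y *\<^sub>R tensor (u t y) (u t y)) x
          + grad (\<lambda>y. P (\<rho> t y)) x
        = \<mu> *\<^sub>R laplacian (u t) x
          + grad (\<lambda>y. (\<mu> + lam (\<rho> t y)) * divergence (u t) y) x) \<and>
     (\<forall>x. \<rho> 0 x = \<rho>0 x \<and> u 0 x = u0 x)"

text \<open>At the origin \<open>x /\<^sub>R norm x\<close> is 0, which is the value there of any continuous
  radial vector field.\<close>

definition spherically_symmetric ::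
    "real set \<Rightarrow> (real \<Rightarrow> real^2 \<Rightarrow> real) \<Rightarrow> (real \<Rightarrow> real^2 \<Rightarrow> real^2) \<Rightarrow> bool" where
  "spherically_symmetric I \<rho> u \<longleftrightarrow>
     (\<exists>(\<rho>r :: real \<Rightarrow> real \<Rightarrow> real) (v :: real \<Rightarrow> real \<Rightarrow> real). \<forall>t\<in>I. \<forall>x.
        \<rho> t x = \<rho>r (norm x) t \<and> u t x = v (norm x) t *\<^sub>R (x /\<^sub>R norm x))"

end

theory Submission
  imports Defs
begin

text \<open>Suppose that the solution exists for all times, and let the initial density vanish outside the
  ball of radius \<open>R0\<close>.

  The fluid stays in that ball.  Where there is no fluid outside a disc, the momentum equation says
  that \<open>\<mu> (\<Delta> u + \<nabla> div u) = 0\<close>, and for a radial field \<open>u = v(r) x / r\<close> this integrates to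
  \<open>v = a r + b / r\<close>.  In the plane no such field is square integrable at infinity unless \<open>a = b = 0\<close>, so
  the velocity vanishes in the outer vacuum (\<open>radial_vacuum_velocity_eq_0\<close>).  Consequently, shortly
  after a given time the velocity is still tiny there, and the boundary of the fluid moves at most at that
  tiny speed (\<open>finite_speed_of_vacuum_front\<close>); it follows that it does not move outwards at all
  (\<open>density_support\<close>).

  A virial argument shows that the fluid cannot stay in the ball.  Put \<open>I = \<integral> \<rho> |x|^2\<close>,
  \<open>J = \<integral> \<rho> u \<bullet> x\<close> and \<open>F = \<integral> \<rho>^\<beta>\<close>.  The continuity equation gives \<open>I' = 2 J\<close> and
  \<open>F' = - (\<beta> - 1) \<integral> \<rho>^\<beta> div u\<close>, and the momentum equation gives
  \<open>J' = \<integral> \<rho> |u|^2 + 2 \<integral> P(\<rho>) - 2 c \<integral> \<rho>^\<beta> div u\<close>.  The term with the density dependent viscosity is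
  thus a multiple of \<open>F'\<close>, and \<open>J - 2 c F / (\<beta> - 1)\<close> has a derivative of at least \<open>2 \<integral> P(\<rho>)\<close>.  Since a
  fixed mass occupies a fixed ball, this is bounded below by a positive constant.  As \<open>F \<ge> 0\<close>, the
  function \<open>J\<close> grows at least linearly and \<open>I\<close> at least quadratically, whereas \<open>I\<close> is at most
  \<open>R0^2\<close> times the mass.

  The time derivatives of these integrals need more than pointwise differentiability of the solution in
  time.  Membership in \<open>C^1\<close> with values in \<open>H^k\<close> is used through two consequences
  (\<open>C1_sobolev_time_regularity\<close>): continuity in time uniformly in space, which follows from a Sobolev
  inequality, and convergence of the difference quotients in \<open>L^2\<close>.  Functions with these two properties
  on a bounded set are stable under products and under composition with \<open>C^1\<close> functions, and their
  integrals can be differentiated in time by integrating the pointwise derivative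
  (\<open>has_real_derivative_integral\<close>).\<close>

section \<open>Partial derivatives and functions of class C^m\<close>

lemma pd_eq: "(f has_derivative f') (at x) \<Longrightarrow> pd i f x = f' (axis i 1)"
  unfolding pd_def by (metis frechet_derivative_at)

lemma pd_has_vector_derivative_line:
  assumes "f differentiable (at (x + s *\<^sub>R axis i 1))"
  shows "((\<lambda>s. f (x + s *\<^sub>R axis i 1)) has_vector_derivative pd i f (x + s *\<^sub>R axis i 1)) (at s)"
proof -
  let ?D = "frechet_derivative f (at (x + s *\<^sub>R axis i 1))"
  have D: "(f has_derivative ?D) (at (x + s *\<^sub>R axis i 1))"
    using assms frechet_derivative_works by blast
  have L: "((\<lambda>s. x + s *\<^sub>R axis i 1) has_derivative (\<lambda>h. h *\<^sub>R axis i 1)) (at s)"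
    by (auto intro!: derivative_eq_intros)
  have "((\<lambda>s. f (x + s *\<^sub>R axis i 1)) has_derivative (\<lambda>h. ?D (h *\<^sub>R axis i 1))) (at s)"
    using diff_chain_at[OF L D] by (simp add: o_def)
  moreover have "?D (h *\<^sub>R axis i 1) = h *\<^sub>R ?D (axis i 1)" for h
    using linear_frechet_derivative[OF assms] by (simp add: linear_cmul)
  ultimately show ?thesis
    by (simp add: has_vector_derivative_def pd_def)
qed

text \<open>The equations hold pointwise, so it matters that a partial derivative at a point only sees the
  function near that point: this is what makes all terms vanish outside the support of the density.\<close>

lemma pd_cong_open:
  assumes "open S" "x \<in> S" "\<And>y. y \<in> S \<Longrightarrow> f y = g y"
  shows "pd i f x = pd i g x"
proof -
  have "(f has_derivative f') (at x) \<longleftrightarrow> (g has_derivative f') (at x)" for f'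
    using has_derivative_transform_within_open[of f f' x UNIV S g]
      has_derivative_transform_within_open[of g f' x UNIV S f] assms by auto
  then show ?thesis by (simp add: pd_def frechet_derivative_def)
qed

lemma pd_const [simp]: "pd i (\<lambda>x. c) = (\<lambda>x. 0)"
  by (rule ext) (simp add: pd_def)

lemma pd_eq_0_open:
  assumes "open S" "x \<in> S" "\<And>y. y \<in> S \<Longrightarrow> f y = c"
  shows "pd i f x = 0"
  using pd_cong_open[OF assms(1,2), of f "\<lambda>_. c"] assms(3) by simp

lemma pd_add:
  assumes "f differentiable (at x)" "g differentiable (at x)"
  shows "pd i (\<lambda>x. f x + g x) x = pd i f x + pd i g x"
  using pd_eq[OF has_derivative_add[OF assms[THEN frechet_derivative_works[THEN iffD1]]]]
  by (simp add: pd_def)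

lemma pd_bounded_linear:
  assumes "bounded_linear h" "f differentiable (at x)"
  shows "pd i (\<lambda>x. h (f x)) x = h (pd i f x)"
  using pd_eq[OF bounded_linear.has_derivative[OF assms(1) assms(2)[THEN frechet_derivative_works[THEN iffD1]]]]
  by (simp add: pd_def)

lemma pd_diff:
  assumes "f differentiable (at x)" "g differentiable (at x)"
  shows "pd i (\<lambda>x. f x - g x) x = pd i f x - pd i g x"
  using pd_eq[OF has_derivative_diff[OF assms[THEN frechet_derivative_works[THEN iffD1]]]]
  by (simp add: pd_def)

lemma pd_component:
  "f differentiable (at x) \<Longrightarrow> pd i (\<lambda>x. f x $ j) x = pd i f x $ j"
  by (rule pd_bounded_linear[OF bounded_linear_vec_nth])

lemma pd_scaleR:
  assumes "f differentiable (at x)" "g differentiable (at x)"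
  shows "pd i (\<lambda>x. f x *\<^sub>R g x) x = pd i f x *\<^sub>R g x + f x *\<^sub>R pd i g x"
proof -
  let ?F = "frechet_derivative f (at x)" and ?G = "frechet_derivative g (at x)"
  have "((\<lambda>x. f x *\<^sub>R g x) has_derivative (\<lambda>h. f x *\<^sub>R ?G h + ?F h *\<^sub>R g x)) (at x)"
    by (intro has_derivative_scaleR assms[THEN frechet_derivative_works[THEN iffD1]])
  from pd_eq[OF this] show ?thesis by (simp add: pd_def)
qed

lemma pd_mult:
  fixes f g :: "real^'n::finite \<Rightarrow> real"
  assumes "f differentiable (at x)" "g differentiable (at x)"
  shows "pd i (\<lambda>x. f x * g x) x = pd i f x * g x + f x * pd i g x"
  using pd_scaleR[OF assms] by simp

lemma pd_compose_real:
  fixes f :: "real^'n::finite \<Rightarrow> real"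
  assumes "f differentiable (at x)" "(h has_real_derivative h') (at (f x))"
  shows "pd i (\<lambda>x. h (f x)) x = h' * pd i f x" "(\<lambda>x. h (f x)) differentiable (at x)"
proof -
  have "((\<lambda>x. h (f x)) has_derivative (\<lambda>k. h' * frechet_derivative f (at x) k)) (at x)"
    using diff_chain_at[of f "frechet_derivative f (at x)" x h "\<lambda>k. h' * k"] assms
    by (simp add: has_field_derivative_def o_def frechet_derivative_works)
  then show "pd i (\<lambda>x. h (f x)) x = h' * pd i f x" "(\<lambda>x. h (f x)) differentiable (at x)"
    by (auto simp: pd_eq pd_def[symmetric] intro: differentiableI)
qed

lemma pd_nth: "pd i (\<lambda>x. x $ j) x = (if i = j then 1 else 0)"
  by (subst pd_eq[OF bounded_linear.has_derivative[OF bounded_linear_vec_nth has_derivative_ident]])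
     (simp add: axis_def)

lemma differentiable_nth [simp]: "(\<lambda>x::real^'n::finite. x $ j) differentiable F"
  by (rule bounded_linear_imp_differentiable[OF bounded_linear_vec_nth])

lemma C_diff_continuous: "C_diff m f \<Longrightarrow> continuous_on UNIV f"
  by (cases m) (auto simp: differentiable_imp_continuous_within continuous_on_eq_continuous_within)

lemma C_diff_Suc_D: "C_diff (Suc m) f \<Longrightarrow> C_diff m f"
proof (induction m arbitrary: f)
  case 0
  then show ?case using C_diff_continuous by (metis C_diff.simps(1))
qed auto

lemma C_diff_mono: "C_diff n f \<Longrightarrow> m \<le> n \<Longrightarrow> C_diff m f"
  by (induction n) (auto simp: le_Suc_eq simp del: C_diff.simps dest: C_diff_Suc_D)

lemma C_diff_2_D:
  assumes "C_diff 2 f" shows "C_diff 1 f" "C_diff 1 (pd i f)"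
proof -
  show "C_diff 1 f" by (rule C_diff_mono[OF assms]) simp
  show "C_diff 1 (pd i f)"
    using assms unfolding numeral_2_eq_2 One_nat_def C_diff.simps(2)[of "Suc 0"] by blast
qed

lemma C_diff_const: "C_diff m (\<lambda>x. c)"
  by (induction m arbitrary: c) auto

lemma C_diff_add:
  "C_diff m f \<Longrightarrow> C_diff m g \<Longrightarrow> C_diff m (\<lambda>x. f x + g x)"
proof (induction m arbitrary: f g)
  case (Suc m)
  have "pd i (\<lambda>x. f x + g x) = (\<lambda>x. pd i f x + pd i g x)" for i
    using Suc.prems by (auto simp: pd_add)
  then show ?case using Suc by auto
qed (auto intro: continuous_intros)

lemma C_diff_bounded_linear:
  "C_diff m f \<Longrightarrow> bounded_linear h \<Longrightarrow> C_diff m (\<lambda>x. h (f x))"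
proof (induction m arbitrary: f)
  case 0
  then show ?case
    by (simp add: bounded_linear.continuous_on)
next
  case (Suc m)
  have "pd i (\<lambda>x. h (f x)) = (\<lambda>x. h (pd i f x))" for i
    using Suc.prems by (auto simp: pd_bounded_linear)
  moreover have "(\<lambda>x. h (f x)) differentiable (at x)" for x
    using Suc.prems bounded_linear.has_derivative[OF Suc.prems(2)] unfolding differentiable_def
    by (force simp: differentiable_def)
  ultimately show ?case using Suc by auto
qed

lemma C_diff_diff:
  "C_diff m f \<Longrightarrow> C_diff m g \<Longrightarrow> C_diff m (\<lambda>x. f x - g x)"
  using C_diff_add[of m f "\<lambda>x. - g x"]
    C_diff_bounded_linear[OF _ bounded_linear_minus[OF bounded_linear_ident], of m g] by simp

lemma C_diff_component: "C_diff m f \<Longrightarrow> C_diff m (\<lambda>x. f x $ j)"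
  by (rule C_diff_bounded_linear[OF _ bounded_linear_vec_nth])

lemma C_diff_scaleR:
  "C_diff m f \<Longrightarrow> C_diff m g \<Longrightarrow> C_diff m (\<lambda>x. f x *\<^sub>R g x)"
proof (induction m arbitrary: f g)
  case (Suc m)
  have "pd i (\<lambda>x. f x *\<^sub>R g x) = (\<lambda>x. pd i f x *\<^sub>R g x + f x *\<^sub>R pd i g x)" for i
    using Suc.prems by (auto simp: pd_scaleR)
  moreover have "C_diff m (\<lambda>x. pd i f x *\<^sub>R g x + f x *\<^sub>R pd i g x)" for i
    using Suc.prems C_diff_Suc_D[OF Suc.prems(1)] C_diff_Suc_D[OF Suc.prems(2)]
    by (intro C_diff_add Suc.IH) simp_all
  ultimately show ?case using Suc.prems by auto
qed (auto intro: continuous_intros)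

lemma C_diff_mult:
  fixes f g :: "real^'n::finite \<Rightarrow> real"
  shows "C_diff m f \<Longrightarrow> C_diff m g \<Longrightarrow> C_diff m (\<lambda>x. f x * g x)"
  using C_diff_scaleR[of m f g] by simp

lemma C_diff_sum:
  "(\<And>a. a \<in> A \<Longrightarrow> C_diff m (f a)) \<Longrightarrow> C_diff m (\<lambda>x. \<Sum>a\<in>A. f a x)"
  by (induction A rule: infinite_finite_induct) (auto intro: C_diff_const C_diff_add)

lemma C_diff_prod:
  fixes f :: "'a \<Rightarrow> real^'n::finite \<Rightarrow> real"
  shows "(\<And>a. a \<in> A \<Longrightarrow> C_diff m (f a)) \<Longrightarrow> C_diff m (\<lambda>x. \<Prod>a\<in>A. f a x)"
  by (induction A rule: infinite_finite_induct) (auto intro: C_diff_const C_diff_mult)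

lemma C_diff_nth: "C_diff m (\<lambda>x::real^'n::finite. x $ j)"
proof (cases m)
  case (Suc n)
  have "pd i (\<lambda>x::real^'n. x $ j) = (\<lambda>_. if i = j then 1 else 0)" for i
    by (rule ext) (rule pd_nth)
  then show ?thesis by (simp add: Suc C_diff_const)
qed (auto intro: continuous_intros)

lemma C_diff_1_compose_real:
  fixes f :: "real^'n::finite \<Rightarrow> real"
  assumes f: "C_diff 1 f" and h: "\<And>y. (h has_real_derivative h' y) (at y)"
    and h': "continuous_on UNIV h'"
  shows "C_diff 1 (\<lambda>x. h (f x))"
proof -
  have d: "f differentiable (at x)" for x using f by simp
  have "pd i (\<lambda>x. h (f x)) = (\<lambda>x. h' (f x) * pd i f x)" for i
    using pd_compose_real(1)[OF d h] by auto
  moreover have "continuous_on UNIV (\<lambda>x. h' (f x) * pd i f x)" for i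
    using f C_diff_continuous[OF f]
    by (intro continuous_on_mult continuous_on_compose2[OF h']) auto
  ultimately show ?thesis using pd_compose_real(2)[OF d h] by simp
qed

section \<open>Smooth bump functions and the fundamental lemma of the calculus of variations\<close>

definition smooth_real :: "(real \<Rightarrow> real) \<Rightarrow> bool" where
  "smooth_real h \<longleftrightarrow> (\<exists>g. g (0::nat) = h \<and> (\<forall>n x. (g n has_real_derivative g (Suc n) x) (at x)))"

text \<open>The whole sequence of derivatives has to be carried through the induction, because each partial
  derivative replaces the function by the next one in the sequence.\<close>

lemma C_diff_smooth_affine:
  assumes "smooth_real h"
  shows "C_diff m (\<lambda>x::real^'n::finite. h (c * x $ j + d))"
proof -
  obtain g where g0: "g (0::nat) = h" and g: "\<And>n x. (g n has_real_derivative g (Suc n) x) (at x)"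
    using assms unfolding smooth_real_def by blast
  have "C_diff m (\<lambda>x::real^'n. g k (c * x $ j + d))" for k
  proof (induction m arbitrary: k)
    case 0
    have "continuous_on UNIV (g k)"
      using g by (meson DERIV_isCont continuous_at_imp_continuous_on)
    then show ?case
      by (auto intro!: continuous_intros continuous_on_compose2[of UNIV "g k"])
  next
    case (Suc m)
    let ?f = "\<lambda>x::real^'n. c * x $ j + d"
    have dl: "?f differentiable (at x)" for x
      by (auto intro!: differentiable_add differentiable_mult)
    have pl: "pd i ?f x = (if i = j then c else 0)" for i x
      by (subst pd_add) (auto simp: pd_mult pd_nth intro!: differentiable_mult)
    have "pd i (\<lambda>x. g k (?f x)) = (\<lambda>x. g (Suc k) (?f x) * (if i = j then c else 0))" for i
      using pd_compose_real(1)[OF dl g] by (auto simp: pl)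
    then show ?case
      using pd_compose_real(2)[OF dl g]
      by (simp only: C_diff.simps) (intro conjI allI TrueI C_diff_mult C_diff_const Suc.IH)
  qed
  from this[of 0] show ?thesis by (simp add: g0)
qed

text \<open>The functions \<open>p(1/x) exp(-1/x)\<close>, extended by 0.  The polynomial factor is there because this
  family, unlike the single function with \<open>p = 1\<close>, is closed under differentiation.\<close>

definition flat_exp :: "real poly \<Rightarrow> real \<Rightarrow> real" where
  "flat_exp p x = (if x > 0 then poly p (1 / x) * exp (- (1 / x)) else 0)"

lemma poly_times_exp_tendsto_0: "((\<lambda>y. poly p y * exp (- y)) \<longlongrightarrow> 0) at_top" for p :: "real poly"
proof -
  have "((\<lambda>y. \<Sum>i\<le>degree p. coeff p i * (y ^ i / exp y)) \<longlongrightarrow> (\<Sum>i\<le>degree p. coeff p i * 0)) at_top"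
    by (intro tendsto_intros tendsto_power_div_exp_0)
  then show ?thesis
    by (simp add: poly_altdef sum_distrib_right sum_divide_distrib exp_minus divide_inverse mult.assoc)
qed

lemma DERIV_flat_exp:
  "(flat_exp p has_real_derivative flat_exp (monom 1 2 * (p - pderiv p)) x) (at x)"
proof (cases x "0::real" rule: linorder_cases)
  case less
  have "((\<lambda>_. 0) has_real_derivative 0) (at x)" by simp
  then have "(flat_exp p has_real_derivative 0) (at x)"
    by (rule has_field_derivative_transform_within_open[of _ _ _ "{..<0}"])
       (use less in \<open>auto simp: flat_exp_def\<close>)
  then show ?thesis using less by (simp add: flat_exp_def)
next
  case greater
  have "((\<lambda>x. poly p (1 / x) * exp (- (1 / x))) has_real_derivative
         flat_exp (monom 1 2 * (p - pderiv p)) x) (at x)"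
    using greater
    by (auto intro!: derivative_eq_intros DERIV_chain2[OF poly_DERIV]
        simp: flat_exp_def poly_monom field_simps power2_eq_square)
  then show ?thesis
    by (rule has_field_derivative_transform_within_open[of _ _ _ "{0<..}"])
       (use greater in \<open>auto simp: flat_exp_def\<close>)
next
  case equal
  have "((\<lambda>h. poly (pCons 0 p) (inverse h) * exp (- inverse h)) \<longlongrightarrow> 0) (at_right 0)"
    by (rule filterlim_compose[OF poly_times_exp_tendsto_0 filterlim_inverse_at_top_right])
  then have "((\<lambda>h. flat_exp p h / h) \<longlongrightarrow> 0) (at_right 0)"
    by (rule Lim_transform_eventually)
       (auto simp: eventually_at_right_less flat_exp_def field_simps
          intro!: eventually_mono[OF eventually_at_right_less])
  moreover have "((\<lambda>h. flat_exp p h / h) \<longlongrightarrow> 0) (at_left 0)"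
    by (rule Lim_transform_eventually[OF tendsto_const])
       (auto simp: flat_exp_def eventually_at_filter)
  ultimately have "((\<lambda>h. flat_exp p h / h) \<longlongrightarrow> 0) (at 0)"
    by (simp add: filterlim_at_split)
  then show ?thesis
    using equal by (simp add: has_field_derivative_iff flat_exp_def)
qed

lemma smooth_real_flat_exp: "smooth_real (flat_exp p)"
  unfolding smooth_real_def
  by (rule exI[of _ "\<lambda>n. flat_exp (((\<lambda>p. monom 1 2 * (p - pderiv p)) ^^ n) p)"])
     (simp add: DERIV_flat_exp)

text \<open>The family tends to the indicator function of the open box.  Scaling the argument of
  \<open>exp(-1/y)\<close> by \<open>n\<close> amounts to taking an n-th root, which makes every positive value tend to 1.\<close>

definition box_bump :: "real^'n::finite \<Rightarrow> real^'n \<Rightarrow> nat \<Rightarrow> real^'n \<Rightarrow> real" where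
  "box_bump a b n x =
     (\<Prod>i\<in>UNIV. flat_exp 1 (real (Suc n) * (x $ i - a $ i)) * flat_exp 1 (real (Suc n) * (b $ i - x $ i)))"

lemma flat_exp_1_bounds: "0 \<le> flat_exp 1 x" "flat_exp 1 x \<le> 1"
  by (auto simp: flat_exp_def)

lemma box_bump_bounds: "0 \<le> box_bump a b n x" "box_bump a b n x \<le> 1"
  unfolding box_bump_def
  by (auto intro!: prod_nonneg prod_le_1 mult_nonneg_nonneg mult_le_one flat_exp_1_bounds)

lemma box_bump_eq_0: "x \<notin> box a b \<Longrightarrow> box_bump a b n x = 0"
proof -
  assume "x \<notin> box a b"
  then obtain i where "x $ i \<le> a $ i \<or> b $ i \<le> x $ i"
    by (auto simp: mem_box_cart not_less)
  then have "flat_exp 1 (real (Suc n) * (x $ i - a $ i)) * flat_exp 1 (real (Suc n) * (b $ i - x $ i)) = 0"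
    by (auto simp: flat_exp_def zero_less_mult_iff)
  then show ?thesis
    unfolding box_bump_def by (intro prod_zero) auto
qed

lemma flat_exp_tendsto_1:
  assumes "0 < y" shows "(\<lambda>n. flat_exp 1 (real (Suc n) * y)) \<longlonglongrightarrow> 1"
proof -
  have "(\<lambda>n. exp (- (inverse y * inverse (real (Suc n))))) \<longlonglongrightarrow> exp (- (inverse y * 0))"
    by (intro tendsto_intros LIMSEQ_inverse_real_of_nat)
  then show ?thesis using assms
    by (simp add: flat_exp_def field_simps zero_less_mult_iff add_pos_nonneg)
qed

lemma box_bump_tendsto: "(\<lambda>n. box_bump a b n x) \<longlonglongrightarrow> indicator (box a b) x"
proof (cases "x \<in> box a b")
  case True
  have "(\<lambda>n. box_bump a b n x) \<longlonglongrightarrow> (\<Prod>i\<in>(UNIV::'a set). 1 * 1)"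
    unfolding box_bump_def
    by (intro tendsto_prod tendsto_mult flat_exp_tendsto_1) (use True in \<open>auto simp: mem_box_cart\<close>)
  then show ?thesis using True by simp
qed (simp add: box_bump_eq_0)

lemma test_function_box_bump: "test_function (box_bump a b n)"
proof -
  have "C_diff m (box_bump a b n)" for m
  proof -
    have "C_diff m (\<lambda>x. flat_exp 1 (real (Suc n) * (x $ i - a $ i)))"
         "C_diff m (\<lambda>x. flat_exp 1 (real (Suc n) * (b $ i - x $ i)))" for i
      using C_diff_smooth_affine[OF smooth_real_flat_exp[of 1], of m "real (Suc n)" i "- real (Suc n) * a $ i"]
        C_diff_smooth_affine[OF smooth_real_flat_exp[of 1], of m "- real (Suc n)" i "real (Suc n) * b $ i"]
      by (simp_all add: algebra_simps)
    then show ?thesis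
      unfolding box_bump_def[abs_def] by (intro C_diff_prod C_diff_mult)
  qed
  moreover have "bounded {x. box_bump a b n x \<noteq> 0}"
    by (rule bounded_subset[OF bounded_box]) (use box_bump_eq_0 in blast)
  ultimately show ?thesis by (simp add: test_function_def)
qed

text \<open>Bump functions increase to indicators of boxes, so all integrals over boxes vanish, and by Lebesgue
  differentiation the function is almost everywhere the limit of its averages over small boxes.\<close>

lemma ae_eq_0_if_test_integrals_0:
  fixes h :: "real^'n::finite \<Rightarrow> 'b::euclidean_space"
  assumes int: "\<And>a b. set_integrable lborel (cbox a b) h"
    and test: "\<And>\<phi>. test_function \<phi> \<Longrightarrow> (LINT x|lborel. \<phi> x *\<^sub>R h x) = 0"
  shows "AE x in lborel. h x = 0"
proof -
  have box0: "integral (cbox a b) h = 0" for a b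
  proof -
    let ?w = "\<lambda>x. indicator (cbox a b) x *\<^sub>R h x"
    have w: "integrable lborel ?w" using int by (simp add: set_integrable_def)
    have sub: "x \<in> box a b \<Longrightarrow> x \<in> cbox a b" for x using box_subset_cbox by blast
    have s_eq: "box_bump a b n x *\<^sub>R h x = box_bump a b n x *\<^sub>R ?w x" for n x
      using sub by (cases "x \<in> box a b") (auto simp: box_bump_eq_0)
    have m: "box_bump a b n \<in> borel_measurable lborel" for n
    proof -
      have "C_diff 0 (box_bump a b n)"
        using test_function_box_bump[of a b n] by (simp add: test_function_def)
      then show ?thesis
        by (simp add: borel_measurable_continuous_onI)
    qed
    have conv: "(\<lambda>n. LINT x|lborel. box_bump a b n x *\<^sub>R ?w x)
        \<longlonglongrightarrow> (LINT x|lborel. indicator (box a b) x *\<^sub>R ?w x)"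
    proof (rule integral_dominated_convergence[where w = "\<lambda>x. norm (?w x)"])
      show "(\<lambda>x. indicator (box a b) x *\<^sub>R ?w x) \<in> borel_measurable lborel"
        by (rule borel_measurable_scaleR[OF _ borel_measurable_integrable[OF w]]) simp
      show "(\<lambda>x. box_bump a b n x *\<^sub>R ?w x) \<in> borel_measurable lborel" for n
        by (intro borel_measurable_scaleR m borel_measurable_integrable[OF w])
      show "AE x in lborel. (\<lambda>n. box_bump a b n x *\<^sub>R ?w x) \<longlonglongrightarrow> indicator (box a b) x *\<^sub>R ?w x"
        by (intro AE_I2 tendsto_scaleR box_bump_tendsto tendsto_const)
      show "AE x in lborel. norm (box_bump a b n x *\<^sub>R ?w x) \<le> norm (?w x)" for n
        using box_bump_bounds[of a b n] by (intro AE_I2) (simp add: indicator_def mult_left_le_one_le)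
    qed (rule integrable_norm[OF w])
    have zero: "(LINT x|lborel. box_bump a b n x *\<^sub>R ?w x) = 0" for n
      unfolding s_eq[symmetric] by (rule test[OF test_function_box_bump])
    have "(LINT x|lborel. indicator (box a b) x *\<^sub>R ?w x) = 0"
      by (rule LIMSEQ_unique[OF conv[unfolded zero] tendsto_const])
    moreover have w_eq: "indicator (box a b) x *\<^sub>R ?w x = indicator (box a b) x *\<^sub>R h x" for x
      using sub by (auto simp: indicator_def)
    ultimately have "(LINT x:box a b|lborel. h x) = 0"
      unfolding w_eq set_lebesgue_integral_def by simp
    moreover have "set_integrable lborel (box a b) h"
      by (rule set_integrable_subset[OF int[of a b]]) (auto simp: sub)
    ultimately have "integral (box a b) h = 0"
      using set_borel_integral_eq_integral(2) by metis
    then show ?thesis by (simp add: integral_open_interval)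
  qed
  have "h integrable_on cbox a b" for a b
    using set_borel_integral_eq_integral(1)[OF int] .
  then obtain N where N: "negligible N"
    and conv: "\<And>x e. \<lbrakk>x \<notin> N; 0 < e\<rbrakk> \<Longrightarrow> \<exists>d>0. \<forall>k. 0 < k \<and> k < d \<longrightarrow>
        norm (integral (cbox x (x + k *\<^sub>R One)) h /\<^sub>R k ^ DIM(real^'n) - h x) < e"
    using integrable_ccontinuous_explicit by blast
  have "h x = 0" if xN: "x \<notin> N" for x
  proof (rule ccontr)
    assume "h x \<noteq> 0"
    then obtain d where d: "d > 0" "\<forall>k. 0 < k \<and> k < d \<longrightarrow> norm (0 /\<^sub>R k ^ DIM(real^'n) - h x) < norm (h x)"
      using conv[OF xN, of "norm (h x)"] unfolding box0 zero_less_norm_iff by blast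
    from d(2)[rule_format, of "d / 2"] d(1) show False by simp
  qed
  then have "AE x in lebesgue. h x = 0"
    using N by (intro AE_I'[of N]) (auto simp: negligible_iff_null_sets)
  then show ?thesis by (simp add: AE_completion_iff)
qed

section \<open>Integration by parts and weak derivatives\<close>

lemma has_vector_derivative_iff_quotient:
  "(f has_vector_derivative D) (at t within S)
    \<longleftrightarrow> ((\<lambda>s. (f s - f t) /\<^sub>R (s - t)) \<longlongrightarrow> D) (at t within S)"
proof -
  have ev: "\<forall>\<^sub>F s in at t within S. norm (f s - f t - (s - t) *\<^sub>R D) / norm (s - t)
      = norm ((f s - f t) /\<^sub>R (s - t) - D)"
  proof (rule eventually_at_filter[THEN iffD2, OF always_eventually], intro allI impI)
    fix s assume "s \<noteq> t"
    then have "(f s - f t) /\<^sub>R (s - t) - D = (f s - f t - (s - t) *\<^sub>R D) /\<^sub>R (s - t)"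
      by (simp add: scaleR_diff_right[of _ "f s - f t"])
    then show "norm (f s - f t - (s - t) *\<^sub>R D) / norm (s - t) = norm ((f s - f t) /\<^sub>R (s - t) - D)"
      by (simp add: divide_inverse mult.commute)
  qed
  have "(f has_vector_derivative D) (at t within S)
    \<longleftrightarrow> ((\<lambda>s. norm (f s - f t - (s - t) *\<^sub>R D) / norm (s - t)) \<longlongrightarrow> 0) (at t within S)"
    by (simp add: has_vector_derivative_def has_derivative_iff_norm bounded_linear_scaleR_left)
  also have "\<dots> \<longleftrightarrow> ((\<lambda>s. norm ((f s - f t) /\<^sub>R (s - t) - D)) \<longlongrightarrow> 0) (at t within S)"
    by (rule tendsto_cong[OF ev])
  also have "\<dots> \<longleftrightarrow> ((\<lambda>s. (f s - f t) /\<^sub>R (s - t)) \<longlongrightarrow> D) (at t within S)"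
    by (simp add: tendsto_norm_zero_iff LIM_zero_iff)
  finally show ?thesis .
qed

definition vanishes_off_compact :: "('a::topological_space \<Rightarrow> 'b::zero) \<Rightarrow> bool" where
  "vanishes_off_compact f \<longleftrightarrow> (\<exists>K. compact K \<and> (\<forall>x. x \<notin> K \<longrightarrow> f x = 0))"

lemma vanishes_off_compact_pd:
  assumes "vanishes_off_compact f"
  shows "vanishes_off_compact (pd i f)"
proof -
  obtain K where K: "compact K" "\<And>x. x \<notin> K \<Longrightarrow> f x = 0"
    using assms by (auto simp: vanishes_off_compact_def)
  have "pd i f x = 0" if "x \<notin> K" for x
    by (rule pd_eq_0_open[of "- K"]) (use that K compact_imp_closed in auto)
  then show ?thesis using K(1) by (auto simp: vanishes_off_compact_def)
qed

lemma vanishes_off_compact_scaleR: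
  fixes f :: "'a::topological_space \<Rightarrow> real" and g :: "'a \<Rightarrow> 'b::real_vector"
  shows "vanishes_off_compact f \<Longrightarrow> vanishes_off_compact (\<lambda>x. f x *\<^sub>R g x)"
  unfolding vanishes_off_compact_def by (erule ex_forward) simp

lemma vanishes_off_compact_bound:
  fixes f :: "'a::euclidean_space \<Rightarrow> 'b::real_normed_vector"
  assumes "continuous_on UNIV f" "vanishes_off_compact f"
  obtains C where "C \<ge> 0" "\<And>x. norm (f x) \<le> C"
proof -
  obtain K where K: "compact K" "\<And>x. x \<notin> K \<Longrightarrow> f x = 0"
    using assms by (auto simp: vanishes_off_compact_def)
  have "bounded (f ` K)"
    using compact_continuous_image[OF continuous_on_subset[OF assms(1)] K(1)] compact_imp_bounded by auto
  then obtain C where C: "\<And>x. x \<in> K \<Longrightarrow> norm (f x) \<le> C"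
    by (auto simp: bounded_iff)
  have "norm (f x) \<le> max C 0" for x
    using C[of x] K(2)[of x] by (cases "x \<in> K") auto
  then show ?thesis using that[of "max C 0"] by auto
qed

lemma integrable_if_vanishes_off_compact:
  fixes f :: "'a::euclidean_space \<Rightarrow> 'b::euclidean_space"
  assumes "continuous_on UNIV f" "vanishes_off_compact f"
  shows "integrable lborel f"
proof -
  obtain K where K: "compact K" "\<And>x. x \<notin> K \<Longrightarrow> f x = 0"
    using assms by (auto simp: vanishes_off_compact_def)
  have "(\<lambda>x. indicator K x *\<^sub>R f x) = f"
    using K(2) by (auto simp: indicator_def)
  then show ?thesis
    using borel_integrable_compact[OF K(1) continuous_on_subset[OF assms(1)]] by simp
qed

lemma norm_shift_le_pd_bound:
  fixes f :: "real^'n::finite \<Rightarrow> 'b::euclidean_space"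
  assumes f: "\<And>x. f differentiable (at x)" and C: "\<And>x. norm (pd i f x) \<le> C"
  shows "norm (f (x + h *\<^sub>R axis i 1) - f x) \<le> C * \<bar>h\<bar>"
proof -
  have "norm (f (x + h *\<^sub>R axis i 1) - f (x + 0 *\<^sub>R axis i 1)) \<le> C * norm (h - 0)"
  proof (rule differentiable_bound[of UNIV "\<lambda>s. f (x + s *\<^sub>R axis i 1)" "\<lambda>s k. k *\<^sub>R pd i f (x + s *\<^sub>R axis i 1)"])
    show "((\<lambda>s. f (x + s *\<^sub>R axis i 1)) has_derivative (\<lambda>k. k *\<^sub>R pd i f (x + s *\<^sub>R axis i 1))) (at s within UNIV)" for s
      using pd_has_vector_derivative_line[OF f] by (simp add: has_vector_derivative_def)
    show "onorm (\<lambda>k. k *\<^sub>R pd i f (x + s *\<^sub>R axis i 1)) \<le> C" for s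
      by (rule onorm_bound) (use C in \<open>auto simp: mult.commute[of C] intro!: mult_left_mono order_trans[OF norm_ge_zero C]\<close>)
  qed auto
  then show ?thesis by simp
qed

text \<open>The integral of \<open>f(x + h e)\<close> does not depend on \<open>h\<close>, so the difference quotients of \<open>f\<close> have
  integral 0.  They are dominated by a constant on a ball, and dominated convergence applies.\<close>

lemma integral_pd_eq_0:
  fixes f :: "real^'n::finite \<Rightarrow> 'b::euclidean_space"
  assumes f: "C_diff 1 f" and K: "vanishes_off_compact f"
  shows "(LINT x|lborel. pd i f x) = 0"
proof -
  let ?e = "axis i 1 :: real^'n"
  have fd: "f differentiable (at x)" and pc: "continuous_on UNIV (pd i f)" for x
    using f by auto
  have fc: "continuous_on UNIV f" using C_diff_continuous[OF f] .
  have fint: "integrable lborel f" by (rule integrable_if_vanishes_off_compact[OF fc K])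
  have fb: "f \<in> borel_measurable borel" using fc by (rule borel_measurable_continuous_onI)
  obtain C where C: "C \<ge> 0" "\<And>x. norm (pd i f x) \<le> C"
    using vanishes_off_compact_bound[OF pc vanishes_off_compact_pd[OF K]] by blast
  obtain K where "compact K" "\<And>x. x \<notin> K \<Longrightarrow> f x = 0"
    using K by (auto simp: vanishes_off_compact_def)
  then obtain r where r: "\<And>x. norm x > r \<Longrightarrow> f x = 0"
    by (meson bounded_iff compact_imp_bounded not_le)
  define h where "h n = inverse (real (Suc n))" for n
  have h: "0 < h n" "h n \<le> 1" for n by (auto simp: h_def inverse_le_1_iff)
  define q where "q n x = (f (x + h n *\<^sub>R ?e) - f x) /\<^sub>R h n" for n x
  have shift_meas: "(\<lambda>x. f (x + c)) \<in> borel_measurable lborel" for c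
  proof -
    have "continuous_on UNIV (\<lambda>x. f (x + c))"
      by (intro continuous_on_compose2[OF fc] continuous_intros) auto
    then show ?thesis using borel_measurable_continuous_onI by simp
  qed
  have shift: "integrable lborel (\<lambda>x. f (x + c))" "(LINT x|lborel. f (x + c)) = (LINT x|lborel. f x)" for c
  proof -
    have m: "(+) c \<in> measurable lborel borel" by simp
    show "(LINT x|lborel. f (x + c)) = (LINT x|lborel. f x)"
      using integral_distr[OF m fb] by (simp add: lborel_distr_plus add.commute)
    show "integrable lborel (\<lambda>x. f (x + c))"
      using integrable_distr_eq[OF m fb] fint by (simp add: lborel_distr_plus add.commute)
  qed
  have q0: "(LINT x|lborel. q n x) = 0" for n
    unfolding q_def using shift fint by simp
  have conv: "(\<lambda>n. LINT x|lborel. q n x) \<longlonglongrightarrow> (LINT x|lborel. pd i f x)"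
  proof (rule integral_dominated_convergence[where w = "\<lambda>x. indicator (cball 0 (r + 1)) x * C"])
    show "pd i f \<in> borel_measurable lborel"
      using borel_measurable_continuous_onI[OF pc] by simp
    show "q n \<in> borel_measurable lborel" for n
      unfolding q_def[abs_def] using shift_meas fb by simp
    show "integrable lborel (\<lambda>x::real^'n. indicator (cball 0 (r + 1)) x * C)"
      using borel_integrable_compact[of "cball 0 (r + 1)" "\<lambda>_::real^'n. C"] by simp
    show "AE x in lborel. (\<lambda>n. q n x) \<longlonglongrightarrow> pd i f x"
    proof (rule AE_I2)
      fix x
      have "((\<lambda>s. f (x + s *\<^sub>R ?e)) has_vector_derivative pd i f x) (at 0)"
        using pd_has_vector_derivative_line[of f x 0 i] fd by simp
      then have "((\<lambda>s. (f (x + s *\<^sub>R ?e) - f x) /\<^sub>R s) \<longlongrightarrow> pd i f x) (at 0)"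
        by (simp add: has_vector_derivative_iff_quotient)
      moreover have "filterlim h (at 0) sequentially"
        unfolding filterlim_at using LIMSEQ_inverse_real_of_nat by (auto simp: h_def[abs_def])
      ultimately show "(\<lambda>n. q n x) \<longlonglongrightarrow> pd i f x"
        unfolding q_def by (rule filterlim_compose)
    qed
    show "AE x in lborel. norm (q n x) \<le> indicator (cball 0 (r + 1)) x * C" for n
    proof (rule AE_I2)
      fix x
      show "norm (q n x) \<le> indicator (cball 0 (r + 1)) x * C"
      proof (cases "norm x \<le> r + 1")
        case True
        have "norm (q n x) \<le> (C * \<bar>h n\<bar>) / h n"
          unfolding q_def using norm_shift_le_pd_bound[OF fd C(2), of x "h n"] h[of n]
          by (simp add: divide_inverse mult.commute mult_right_mono)
        then show ?thesis using True h[of n] by simp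
      next
        case False
        have "norm (x + h n *\<^sub>R ?e) \<ge> norm x - norm (h n *\<^sub>R ?e)"
          by (metis add.commute norm_diff_ineq)
        then have "norm (x + h n *\<^sub>R ?e) > r" using False h[of n] by simp
        then show ?thesis using False r C by (simp add: q_def)
      qed
    qed
  qed
  show ?thesis by (rule LIMSEQ_unique[OF conv[unfolded q0] tendsto_const])
qed

lemma integral_by_parts_pd:
  fixes f :: "real^'n::finite \<Rightarrow> 'b::euclidean_space" and \<phi> :: "real^'n \<Rightarrow> real"
  assumes \<phi>: "C_diff 1 \<phi>" and f: "C_diff 1 f" and K: "vanishes_off_compact \<phi>"
  shows "(LINT x|lborel. pd i \<phi> x *\<^sub>R f x) = - (LINT x|lborel. \<phi> x *\<^sub>R pd i f x)"
proof -
  have pd: "pd i (\<lambda>x. \<phi> x *\<^sub>R f x) = (\<lambda>x. pd i \<phi> x *\<^sub>R f x + \<phi> x *\<^sub>R pd i f x)"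
    using \<phi> f by (auto simp: pd_scaleR)
  have "integrable lborel (\<lambda>x. pd i \<phi> x *\<^sub>R f x)"
    using \<phi> f C_diff_continuous[OF f]
    by (intro integrable_if_vanishes_off_compact vanishes_off_compact_scaleR vanishes_off_compact_pd K)
       (auto intro!: continuous_intros)
  moreover have "integrable lborel (\<lambda>x. \<phi> x *\<^sub>R pd i f x)"
    using \<phi> f C_diff_continuous[OF \<phi>]
    by (intro integrable_if_vanishes_off_compact vanishes_off_compact_scaleR K)
       (auto intro!: continuous_intros)
  moreover have "(LINT x|lborel. pd i (\<lambda>x. \<phi> x *\<^sub>R f x) x) = 0"
    by (intro integral_pd_eq_0 C_diff_scaleR \<phi> f vanishes_off_compact_scaleR K)
  ultimately show ?thesis by (simp add: pd add_eq_0_iff)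
qed

text \<open>Both square integrable and continuous functions have this property, which is all that uniqueness of
  weak derivatives requires.\<close>

definition locally_integrable :: "(real^'n::finite \<Rightarrow> 'b::euclidean_space) \<Rightarrow> bool" where
  "locally_integrable f \<longleftrightarrow> (\<forall>a b. set_integrable lborel (cbox a b) f)"

lemma locally_integrable_continuous:
  "continuous_on UNIV f \<Longrightarrow> locally_integrable f"
  unfolding locally_integrable_def set_integrable_def
  by (metis borel_integrable_compact compact_cbox continuous_on_subset subset_UNIV)

lemma locally_integrable_L2:
  assumes "L2 f" shows "locally_integrable f"
  unfolding locally_integrable_def set_integrable_def
proof (intro allI)
  fix a b :: "real^'a"
  have f: "f \<in> borel_measurable lborel" "integrable lborel (\<lambda>x. (norm (f x))\<^sup>2)"
    using assms by (auto simp: L2_def)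
  have "integrable lborel (\<lambda>x. indicator (cbox a b) x *\<^sub>R (1::real))"
    by (rule borel_integrable_compact) auto
  then have "integrable lborel (\<lambda>x. indicator (cbox a b) x *\<^sub>R (1::real) + (norm (f x))\<^sup>2)"
    using f(2) by (rule Bochner_Integration.integrable_add)
  then show "integrable lborel (\<lambda>x. indicator (cbox a b) x *\<^sub>R f x)"
  proof (rule Bochner_Integration.integrable_bound)
    have "norm (f x) \<le> 1 + (norm (f x))\<^sup>2" for x
      using zero_le_power2[of "norm (f x) - 1"] by (simp add: power2_diff) (use norm_ge_zero[of "f x"] in linarith)
    then show "AE x in lborel. norm (indicator (cbox a b) x *\<^sub>R f x)
        \<le> norm (indicator (cbox a b) x *\<^sub>R (1::real) + (norm (f x))\<^sup>2)"
      by (intro AE_I2) (auto simp: indicator_def)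
  qed (use f(1) in simp)
qed

lemma locally_integrable_lincomb:
  assumes "locally_integrable f" "locally_integrable g"
  shows "locally_integrable (\<lambda>x. a *\<^sub>R f x + b *\<^sub>R g x)"
  using assms unfolding locally_integrable_def
  by (auto intro!: set_integral_add set_integrable_scaleR_right)

lemma integrable_scaleR_locally_integrable:
  assumes g: "locally_integrable g" and \<phi>: "continuous_on UNIV \<phi>" "vanishes_off_compact \<phi>"
  shows "integrable lborel (\<lambda>x. \<phi> x *\<^sub>R g x)"
proof -
  obtain K where K: "compact K" "\<And>x. x \<notin> K \<Longrightarrow> \<phi> x = 0"
    using \<phi>(2) by (auto simp: vanishes_off_compact_def)
  obtain a where a: "K \<subseteq> cbox (- a) a"
    using bounded_subset_cbox_symmetric[OF compact_imp_bounded[OF K(1)]] by blast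
  obtain C where C: "\<And>x. norm (\<phi> x) \<le> C" using vanishes_off_compact_bound[OF \<phi>] by blast
  let ?g = "\<lambda>x. indicator (cbox (- a) a) x *\<^sub>R g x"
  have g: "integrable lborel ?g"
    using g by (simp add: locally_integrable_def set_integrable_def)
  have eq: "\<phi> x *\<^sub>R g x = \<phi> x *\<^sub>R ?g x" for x
    using K a by (auto simp: indicator_def)
  have "\<phi> \<in> borel_measurable lborel"
    using borel_measurable_continuous_onI[OF \<phi>(1)] by simp
  then have m: "(\<lambda>x. \<phi> x *\<^sub>R ?g x) \<in> borel_measurable lborel"
    using borel_measurable_integrable[OF g] by (rule borel_measurable_scaleR)
  have "integrable lborel (\<lambda>x. C *\<^sub>R norm (?g x))"
    by (intro integrable_scaleR_right integrable_norm g)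
  then have "integrable lborel (\<lambda>x. \<phi> x *\<^sub>R ?g x)"
  proof (rule Bochner_Integration.integrable_bound[OF _ m], intro AE_I2)
    fix x
    have "norm (\<phi> x) * norm (?g x) \<le> \<bar>C\<bar> * norm (?g x)"
      by (rule mult_right_mono) (use C[of x] in auto)
    then show "norm (\<phi> x *\<^sub>R ?g x) \<le> norm (C *\<^sub>R norm (?g x))"
      by (simp add: abs_mult)
  qed
  then show ?thesis by (simp only: eq[symmetric])
qed

lemma test_function_C_diff: "test_function \<phi> \<Longrightarrow> C_diff m \<phi>"
  by (simp add: test_function_def)

lemma test_function_vanishes: "test_function \<phi> \<Longrightarrow> vanishes_off_compact \<phi>"
  unfolding vanishes_off_compact_def test_function_def
  using closure_subset[of "{x. \<phi> x \<noteq> 0}"] by (intro exI[of _ "closure {x. \<phi> x \<noteq> 0}"]) auto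

lemma C_diff_pds: "C_diff (length ds + m) f \<Longrightarrow> C_diff m (pds ds f)"
proof (induction ds arbitrary: m)
  case (Cons d ds)
  then have "C_diff (Suc m) (pds ds f)" by (simp del: C_diff.simps)
  then show ?case by simp
qed simp

lemma test_function_pds: 
  assumes "test_function \<phi>" 
  shows "C_diff m (pds ds \<phi>)" "vanishes_off_compact (pds ds \<phi>)"
proof -
  show "C_diff m (pds ds \<phi>)" by (rule C_diff_pds[OF test_function_C_diff[OF assms]])
  show "vanishes_off_compact (pds ds \<phi>)"
    by (induction ds) (auto simp: test_function_vanishes[OF assms] vanishes_off_compact_pd)
qed

lemma integrable_pds_test_function:
  assumes "test_function \<phi>" "locally_integrable f"
  shows "integrable lborel (\<lambda>x. pds ds \<phi> x *\<^sub>R f x)"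
  by (rule integrable_scaleR_locally_integrable[OF assms(2) C_diff_continuous[OF test_function_pds(1)]
        test_function_pds(2)]) (rule assms(1))+

lemma has_weak_deriv_lincomb:
  assumes "has_weak_deriv ds f f'" "has_weak_deriv ds g g'"
    and "locally_integrable f" "locally_integrable f'" "locally_integrable g" "locally_integrable g'"
  shows "has_weak_deriv ds (\<lambda>x. a *\<^sub>R f x + b *\<^sub>R g x) (\<lambda>x. a *\<^sub>R f' x + b *\<^sub>R g' x)"
  unfolding has_weak_deriv_def
proof (intro allI impI)
  fix \<phi> :: "real^'a \<Rightarrow> real" assume \<phi>: "test_function \<phi>"
  have *: "(LINT x|lborel. pds es \<phi> x *\<^sub>R (a *\<^sub>R u x + b *\<^sub>R v x))
      = a *\<^sub>R (LINT x|lborel. pds es \<phi> x *\<^sub>R u x) + b *\<^sub>R (LINT x|lborel. pds es \<phi> x *\<^sub>R v x)"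
    if "locally_integrable u" "locally_integrable v" for es and u v :: "real^'a \<Rightarrow> 'b"
  proof -
    have "pds es \<phi> x *\<^sub>R (a *\<^sub>R u x + b *\<^sub>R v x) = a *\<^sub>R (pds es \<phi> x *\<^sub>R u x) + b *\<^sub>R (pds es \<phi> x *\<^sub>R v x)" for x
      by (simp add: scaleR_add_right mult.commute)
    then show ?thesis
      using integrable_pds_test_function[OF \<phi> that(1), of es] integrable_pds_test_function[OF \<phi> that(2), of es]
      by (simp del: scaleR_scaleR)
  qed
  have f: "(LINT x|lborel. pds ds \<phi> x *\<^sub>R f x) = (- 1) ^ length ds *\<^sub>R (LINT x|lborel. pds [] \<phi> x *\<^sub>R f' x)"
    and g: "(LINT x|lborel. pds ds \<phi> x *\<^sub>R g x) = (- 1) ^ length ds *\<^sub>R (LINT x|lborel. pds [] \<phi> x *\<^sub>R g' x)"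
    using assms(1,2) \<phi> by (auto simp: has_weak_deriv_def)
  show "(LINT x|lborel. pds ds \<phi> x *\<^sub>R (a *\<^sub>R f x + b *\<^sub>R g x))
      = (- 1) ^ length ds *\<^sub>R (LINT x|lborel. \<phi> x *\<^sub>R (a *\<^sub>R f' x + b *\<^sub>R g' x))"
    unfolding *[OF assms(3,5)] f g using *[OF assms(4,6), of "[]"]
    by (simp add: scaleR_add_right mult.commute[of _ a] mult.commute[of _ b])
qed

lemma has_weak_deriv_unique:
  assumes "has_weak_deriv ds f g" "has_weak_deriv ds f h" "locally_integrable g" "locally_integrable h"
  shows "AE x in lborel. g x = h x"
proof -
  have "AE x in lborel. 1 *\<^sub>R g x + (- 1) *\<^sub>R h x = 0"
  proof (rule ae_eq_0_if_test_integrals_0)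
    show "set_integrable lborel (cbox a b) (\<lambda>x. 1 *\<^sub>R g x + (- 1) *\<^sub>R h x)" for a b
      using locally_integrable_lincomb[OF assms(3,4)] unfolding locally_integrable_def by blast
    show "(LINT x|lborel. \<phi> x *\<^sub>R (1 *\<^sub>R g x + (- 1) *\<^sub>R h x)) = 0" if \<phi>: "test_function \<phi>" for \<phi>
    proof -
      have "(- 1) ^ length ds *\<^sub>R (LINT x|lborel. \<phi> x *\<^sub>R g x) = (- 1) ^ length ds *\<^sub>R (LINT x|lborel. \<phi> x *\<^sub>R h x)"
        using assms(1,2) \<phi> by (simp add: has_weak_deriv_def)
      then have "(LINT x|lborel. \<phi> x *\<^sub>R g x) = (LINT x|lborel. \<phi> x *\<^sub>R h x)" by simp
      then show ?thesis
        using integrable_pds_test_function[OF \<phi> assms(3), of "[]"] integrable_pds_test_function[OF \<phi> assms(4), of "[]"]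
        by (simp add: scaleR_diff_right)
    qed
  qed
  then show ?thesis by simp
qed

lemma pds_append: "pds (as @ bs) f = pds as (pds bs f)"
  by (induction as) auto

text \<open>Moving the derivatives one at a time from the test function to \<open>f\<close> reverses their order.\<close>

lemma C_diff_has_weak_deriv:
  assumes "C_diff m f" "length ds \<le> m"
  shows "has_weak_deriv ds f (pds (rev ds) f)"
  unfolding has_weak_deriv_def
proof (intro allI impI)
  fix \<phi> :: "real^'a \<Rightarrow> real" assume \<phi>: "test_function \<phi>"
  show "(LINT x|lborel. pds ds \<phi> x *\<^sub>R f x) = (- 1) ^ length ds *\<^sub>R (LINT x|lborel. \<phi> x *\<^sub>R pds (rev ds) f x)"
    using assms
  proof (induction ds arbitrary: f m)
    case (Cons d ds)
    then obtain m' where m': "m = Suc m'" by (cases m) auto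
    have "C_diff 1 f" by (rule C_diff_mono[OF Cons.prems(1)]) (simp add: m')
    then have "(LINT x|lborel. pds (d # ds) \<phi> x *\<^sub>R f x) = - (LINT x|lborel. pds ds \<phi> x *\<^sub>R pd d f x)"
      unfolding pds.simps by (rule integral_by_parts_pd[OF test_function_pds(1)[OF \<phi>] _ test_function_pds(2)[OF \<phi>]])
    also have "\<dots> = - ((- 1) ^ length ds *\<^sub>R (LINT x|lborel. \<phi> x *\<^sub>R pds (rev ds) (pd d f) x))"
      using Cons.IH[of m' "pd d f"] Cons.prems by (simp add: m')
    finally show ?case by (simp add: pds_append)
  qed simp
qed

section \<open>A Sobolev inequality in the plane\<close>

text \<open>Integrate the derivative of \<open>(s - 1) |g(s)|^2\<close>, which vanishes at \<open>s = 1\<close>, from 0 to 1.\<close>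

lemma sq_norm_le_integral_C1:
  fixes g :: "real \<Rightarrow> 'b::euclidean_space"
  assumes g: "\<And>s. (g has_vector_derivative g' s) (at s)" and g': "continuous_on UNIV g'"
  shows "(norm (g 0))\<^sup>2 \<le> 2 * integral {0..1} (\<lambda>s. (norm (g s))\<^sup>2 + (norm (g' s))\<^sup>2)"
proof -
  have gc: "continuous_on UNIV g"
    by (intro continuous_at_imp_continuous_on ballI has_vector_derivative_continuous[OF g])
  define h where "h s = (s - 1) * (g s \<bullet> g s)" for s
  define h' where "h' s = g s \<bullet> g s + (s - 1) * (2 * (g s \<bullet> g' s))" for s
  have "(h has_vector_derivative h' s) (at s within {0..1})" for s
  proof -
    have gs: "(g has_derivative (\<lambda>k. k *\<^sub>R g' s)) (at s within {0..1})"
      using g has_vector_derivative_at_within unfolding has_vector_derivative_def by blast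
    show ?thesis
      unfolding h_def[abs_def] h'_def has_vector_derivative_def
      by (rule derivative_eq_intros gs refl | simp add: inner_commute algebra_simps)+
  qed
  then have "(h' has_integral (h 1 - h 0)) {0..1}"
    by (intro fundamental_theorem_of_calculus) auto
  then have 1: "(h' has_integral (norm (g 0))\<^sup>2) {0..1}"
    by (simp add: h_def power2_norm_eq_inner)
  have ic: "(\<lambda>s. (norm (g s))\<^sup>2 + (norm (g' s))\<^sup>2) integrable_on {0..1}"
    by (intro integrable_continuous_interval continuous_intros)
       (auto intro: continuous_on_subset[OF gc] continuous_on_subset[OF g'])
  have 2: "((\<lambda>s. 2 * ((norm (g s))\<^sup>2 + (norm (g' s))\<^sup>2)) has_integral
      2 * integral {0..1} (\<lambda>s. (norm (g s))\<^sup>2 + (norm (g' s))\<^sup>2)) {0..1}"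
    by (rule has_integral_mult_right[OF integrable_integral[OF ic]])
  have "h' s \<le> 2 * ((norm (g s))\<^sup>2 + (norm (g' s))\<^sup>2)" if s: "s \<in> {0..1}" for s
  proof -
    have "\<bar>(s - 1) * (2 * (g s \<bullet> g' s))\<bar> \<le> 1 * (2 * (norm (g s) * norm (g' s)))"
      unfolding abs_mult using s Cauchy_Schwarz_ineq2[of "g s" "g' s"] by (intro mult_mono) auto
    from abs_le_D1[OF this]
    have "(s - 1) * (2 * (g s \<bullet> g' s)) \<le> 2 * (norm (g s) * norm (g' s))" by simp
    moreover have "2 * (norm (g s) * norm (g' s)) \<le> (norm (g s))\<^sup>2 + (norm (g' s))\<^sup>2"
      using zero_le_power2[of "norm (g s) - norm (g' s)"] by (simp add: power2_diff)
    ultimately have X: "(s - 1) * (2 * (g s \<bullet> g' s)) \<le> (norm (g s))\<^sup>2 + (norm (g' s))\<^sup>2"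
      by (rule order_trans)
    have "p + r \<le> 2 * (p + q)" if "r \<le> p + q" "0 \<le> q" for p q r :: real
      using that by simp
    from this[OF X] show ?thesis by (simp add: h'_def power2_norm_eq_inner[symmetric])
  qed
  then show ?thesis by (rule has_integral_le[OF 1 2])
qed

text \<open>This transfers iterated integration from pairs of reals to the plane.\<close>

lemma lborel_real2_coordinates:
  fixes a :: "real^2"
  shows "distr lborel borel (\<lambda>(y, z). a + y *\<^sub>R axis 1 1 + z *\<^sub>R axis 2 1) = lborel"
    (is "distr lborel borel ?T = lborel")
proof (rule lborel_eqI[symmetric])
  have T: "?T \<in> borel_measurable borel"
    by (intro borel_measurable_continuous_onI) (auto simp: case_prod_unfold intro!: continuous_intros)
  fix l u :: "real^2" assume lu: "\<And>b. b \<in> Basis \<Longrightarrow> l \<bullet> b \<le> u \<bullet> b"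
  have lu12: "l $ 1 \<le> u $ 1" "l $ 2 \<le> u $ 2"
    using lu[of "axis 1 1"] lu[of "axis 2 1"] by (auto simp: inner_axis)
  have "?T -` box l u = box (l $ 1 - a $ 1) (u $ 1 - a $ 1) \<times> box (l $ 2 - a $ 2) (u $ 2 - a $ 2)"
    by (auto simp: mem_box_cart forall_2 axis_def)
  moreover have "emeasure (lborel :: (real \<times> real) measure) (A \<times> B) = emeasure lborel A * emeasure lborel B"
    if "A \<in> sets borel" "B \<in> sets borel" for A B :: "real set"
    unfolding lborel_prod[symmetric] using that by (simp add: lborel.emeasure_pair_measure_Times)
  ultimately have "emeasure lborel (?T -` box l u) = ennreal (u $ 1 - l $ 1) * ennreal (u $ 2 - l $ 2)"
    using lu12 by simp
  also have "\<dots> = ennreal (\<Prod>b\<in>Basis. (u - l) \<bullet> b)"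
    using lu12 by (simp add: Basis_vec_def UNIV_2 axis_eq_axis inner_axis inner_diff_left ennreal_mult mult.commute)
  finally show "emeasure (distr lborel borel ?T) (box l u) = ennreal (\<Prod>b\<in>Basis. (u - l) \<bullet> b)"
    using T by (simp add: emeasure_distr)
qed simp

lemma double_integral_le_lborel_real2:
  fixes H :: "real^2 \<Rightarrow> real"
  assumes c: "continuous_on UNIV H" and i: "integrable lborel H" and pos: "\<And>x. 0 \<le> H x"
  shows "integral {0..1} (\<lambda>y. integral {0..1} (\<lambda>z. H (a + y *\<^sub>R axis 1 1 + z *\<^sub>R axis 2 1))) \<le> (LINT x|lborel. H x)"
proof -
  let ?T = "\<lambda>(y, z). a + y *\<^sub>R axis 1 1 + z *\<^sub>R axis 2 1"
  have Tc: "continuous_on UNIV ?T" by (auto simp: case_prod_unfold intro!: continuous_intros)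
  have T: "?T \<in> borel_measurable borel"
    using Tc by (rule borel_measurable_continuous_onI)
  have Hm: "H \<in> borel_measurable borel" using c by (rule borel_measurable_continuous_onI)
  let ?G = "\<lambda>p. H (?T p)"
  have Gc: "continuous_on UNIV ?G" by (rule continuous_on_compose2[OF c Tc]) auto
  have Gi: "integrable lborel ?G"
    using integrable_distr_eq[of ?T lborel borel H] T Hm i by (simp add: lborel_real2_coordinates)
  have GI: "(LINT p|lborel. ?G p) = (LINT x|lborel. H x)"
    using integral_distr[of ?T lborel borel H] T Hm by (simp add: lborel_real2_coordinates)
  have "integral {0..1} (\<lambda>y. integral {0..1} (\<lambda>z. H (a + y *\<^sub>R axis 1 1 + z *\<^sub>R axis 2 1)))
      = integral (cbox (0, 0) (1, 1)) ?G"
    using integral_prod_continuous[of 0 0 1 1 ?G] continuous_on_subset[OF Gc] by simp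
  also have "\<dots> = (LINT p:cbox (0, 0) (1, 1)|lborel. ?G p)"
  proof (rule set_borel_integral_eq_integral(2)[symmetric])
    show "set_integrable lborel (cbox (0, 0) (1, 1)) ?G"
      unfolding set_integrable_def
      by (rule borel_integrable_compact) (auto intro: continuous_on_subset[OF Gc])
  qed
  also have "\<dots> \<le> (LINT p|lborel. ?G p)"
    unfolding set_lebesgue_integral_def
    by (rule integral_mono'[OF Gi]) (auto simp: indicator_def pos)
  finally show ?thesis by (simp only: GI)
qed

text \<open>Apply the one-dimensional estimate along the first coordinate, and then to \<open>f\<close> and to its first
  derivative along the second coordinate.  Only one mixed second derivative enters.\<close>

lemma sq_norm_le_sobolev_2:
  fixes f :: "real^2 \<Rightarrow> 'b::euclidean_space"
  assumes f: "C_diff 2 f"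
    and i: "integrable lborel (\<lambda>x. (norm (f x))\<^sup>2)" "integrable lborel (\<lambda>x. (norm (pd 1 f x))\<^sup>2)"
      "integrable lborel (\<lambda>x. (norm (pd 2 f x))\<^sup>2)" "integrable lborel (\<lambda>x. (norm (pd 2 (pd 1 f) x))\<^sup>2)"
  shows "(norm (f a))\<^sup>2 \<le> 4 * ((LINT x|lborel. (norm (f x))\<^sup>2) + (LINT x|lborel. (norm (pd 1 f x))\<^sup>2)
    + (LINT x|lborel. (norm (pd 2 f x))\<^sup>2) + (LINT x|lborel. (norm (pd 2 (pd 1 f) x))\<^sup>2))"
proof -
  define H where "H x = (norm (f x))\<^sup>2 + (norm (pd 1 f x))\<^sup>2 + (norm (pd 2 f x))\<^sup>2 + (norm (pd 2 (pd 1 f) x))\<^sup>2" for x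
  let ?e1 = "axis 1 1 :: real^2" and ?e2 = "axis 2 1 :: real^2"
  have f1: "C_diff 1 f" and p1: "C_diff 1 (pd 1 f)"
    using C_diff_2_D[OF f] by auto
  have c: "continuous_on UNIV f" "continuous_on UNIV (pd 1 f)" "continuous_on UNIV (pd 2 f)"
    "continuous_on UNIV (pd 2 (pd 1 f))"
    using f1 p1 C_diff_continuous[OF f1] C_diff_continuous[OF p1] by auto
  have Hc: "continuous_on UNIV H"
    unfolding H_def[abs_def] by (intro continuous_intros c)
  have line: "continuous_on UNIV (\<lambda>s. u (b + s *\<^sub>R v))" if "continuous_on UNIV u" for u :: "real^2 \<Rightarrow> 'b" and b v
    by (intro continuous_on_compose2[OF that] continuous_intros) auto
  have zline: "(norm (u b))\<^sup>2 \<le> 2 * integral {0..1} (\<lambda>z. (norm (u (b + z *\<^sub>R axis j 1)))\<^sup>2 + (norm (pd j u (b + z *\<^sub>R axis j 1)))\<^sup>2)"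
    if "C_diff 1 u" for u :: "real^2 \<Rightarrow> 'b" and b j
  proof -
    have "u differentiable (at x)" for x using that by simp
    then show ?thesis
      using sq_norm_le_integral_C1[of "\<lambda>z. u (b + z *\<^sub>R axis j 1)" "\<lambda>z. pd j u (b + z *\<^sub>R axis j 1)"]
        pd_has_vector_derivative_line[of u b _ j] line[of "pd j u"] that by simp
  qed
  have Hl: "(\<lambda>z. H (b + z *\<^sub>R ?e2)) integrable_on {0..1}" for b
    by (intro integrable_continuous_interval continuous_on_compose2[OF Hc] continuous_intros) auto
  have inner: "(norm (f (a + y *\<^sub>R ?e1)))\<^sup>2 + (norm (pd 1 f (a + y *\<^sub>R ?e1)))\<^sup>2
      \<le> 2 * integral {0..1} (\<lambda>z. H (a + y *\<^sub>R ?e1 + z *\<^sub>R ?e2))" for y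
  proof -
    let ?b = "a + y *\<^sub>R ?e1"
    have "(\<lambda>z. (norm (f (?b + z *\<^sub>R ?e2)))\<^sup>2 + (norm (pd 2 f (?b + z *\<^sub>R ?e2)))\<^sup>2) integrable_on {0..1}"
         "(\<lambda>z. (norm (pd 1 f (?b + z *\<^sub>R ?e2)))\<^sup>2 + (norm (pd 2 (pd 1 f) (?b + z *\<^sub>R ?e2)))\<^sup>2) integrable_on {0..1}"
      by (intro integrable_continuous_interval continuous_intros continuous_on_subset[OF line] c; simp)+
    from integral_add[OF this]
    have "integral {0..1} (\<lambda>z. H (?b + z *\<^sub>R ?e2))
      = integral {0..1} (\<lambda>z. (norm (f (?b + z *\<^sub>R ?e2)))\<^sup>2 + (norm (pd 2 f (?b + z *\<^sub>R ?e2)))\<^sup>2)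
      + integral {0..1} (\<lambda>z. (norm (pd 1 f (?b + z *\<^sub>R ?e2)))\<^sup>2 + (norm (pd 2 (pd 1 f) (?b + z *\<^sub>R ?e2)))\<^sup>2)"
      unfolding H_def by (simp add: add.assoc add.left_commute)
    then show ?thesis using zline[OF f1, of ?b 2] zline[OF p1, of ?b 2] by argo
  qed
  have Hll: "(\<lambda>y. integral {0..1} (\<lambda>z. H (a + y *\<^sub>R ?e1 + z *\<^sub>R ?e2))) integrable_on {0..1}"
  proof (rule integrable_continuous_interval)
    have "continuous_on ({0..1} \<times> cbox 0 1) (\<lambda>(y, z). H (a + y *\<^sub>R ?e1 + z *\<^sub>R ?e2))"
      unfolding case_prod_unfold by (intro continuous_on_compose2[OF Hc] continuous_intros) auto
    from integral_continuous_on_param[OF this]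
    show "continuous_on {0..1} (\<lambda>y. integral {0..1} (\<lambda>z. H (a + y *\<^sub>R ?e1 + z *\<^sub>R ?e2)))" by simp
  qed
  have "(norm (f a))\<^sup>2 \<le> 2 * integral {0..1} (\<lambda>y. (norm (f (a + y *\<^sub>R ?e1)))\<^sup>2 + (norm (pd 1 f (a + y *\<^sub>R ?e1)))\<^sup>2)"
    by (rule zline[OF f1])
  also have "\<dots> \<le> 2 * integral {0..1} (\<lambda>y. 2 * integral {0..1} (\<lambda>z. H (a + y *\<^sub>R ?e1 + z *\<^sub>R ?e2)))"
    by (intro mult_left_mono integral_le inner integrable_on_mult_right Hll
        integrable_continuous_interval continuous_intros continuous_on_subset[OF line] c) auto
  also have "\<dots> = 4 * integral {0..1} (\<lambda>y. integral {0..1} (\<lambda>z. H (a + y *\<^sub>R ?e1 + z *\<^sub>R ?e2)))"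
    by simp
  also have "\<dots> \<le> 4 * (LINT x|lborel. H x)"
  proof -
    have "integrable lborel H" unfolding H_def[abs_def] using i by simp
    from double_integral_le_lborel_real2[OF Hc this, of a] show ?thesis by (simp add: H_def)
  qed
  also have "(LINT x|lborel. H x) = (LINT x|lborel. (norm (f x))\<^sup>2) + (LINT x|lborel. (norm (pd 1 f x))\<^sup>2)
    + (LINT x|lborel. (norm (pd 2 f x))\<^sup>2) + (LINT x|lborel. (norm (pd 2 (pd 1 f) x))\<^sup>2)"
    unfolding H_def using i by simp
  finally show ?thesis .
qed

section \<open>Curves in Sobolev spaces\<close>

lemma L2_lincomb:
  assumes "L2 f" "L2 g" shows "L2 (\<lambda>x. a *\<^sub>R f x + b *\<^sub>R g x)"
proof -
  have f: "f \<in> borel_measurable lborel" "integrable lborel (\<lambda>x. (norm (f x))\<^sup>2)"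
    and g: "g \<in> borel_measurable lborel" "integrable lborel (\<lambda>x. (norm (g x))\<^sup>2)"
    using assms by (auto simp: L2_def)
  have m: "(\<lambda>x. a *\<^sub>R f x + b *\<^sub>R g x) \<in> borel_measurable lborel" using f g by simp
  have "integrable lborel (\<lambda>x. 2 * a\<^sup>2 * (norm (f x))\<^sup>2 + 2 * b\<^sup>2 * (norm (g x))\<^sup>2)" using f g by simp
  then have "integrable lborel (\<lambda>x. (norm (a *\<^sub>R f x + b *\<^sub>R g x))\<^sup>2)"
  proof (rule Bochner_Integration.integrable_bound)
    have "(norm (a *\<^sub>R f x + b *\<^sub>R g x))\<^sup>2 \<le> 2 * a\<^sup>2 * (norm (f x))\<^sup>2 + 2 * b\<^sup>2 * (norm (g x))\<^sup>2" for x
    proof -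
      have "(norm (a *\<^sub>R f x + b *\<^sub>R g x))\<^sup>2 \<le> (norm (a *\<^sub>R f x) + norm (b *\<^sub>R g x))\<^sup>2"
        by (intro power_mono norm_triangle_ineq) simp
      also have "\<dots> \<le> 2 * (norm (a *\<^sub>R f x))\<^sup>2 + 2 * (norm (b *\<^sub>R g x))\<^sup>2"
        using zero_le_power2[of "norm (a *\<^sub>R f x) - norm (b *\<^sub>R g x)"] by (simp add: power2_diff power2_sum)
      finally show ?thesis by (simp add: power_mult_distrib)
    qed
    then show "AE x in lborel. norm ((norm (a *\<^sub>R f x + b *\<^sub>R g x))\<^sup>2)
        \<le> norm (2 * a\<^sup>2 * (norm (f x))\<^sup>2 + 2 * b\<^sup>2 * (norm (g x))\<^sup>2)"
      unfolding real_norm_def abs_power2 by (intro AE_I2 order_trans[OF _ abs_ge_self])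
  qed (use m in simp)
  then show ?thesis using m by (simp add: L2_def)
qed

lemma sobolev_lincomb:
  assumes "sobolev k f" "sobolev k g" shows "sobolev k (\<lambda>x. a *\<^sub>R f x + b *\<^sub>R g x)"
  unfolding sobolev_def
proof (intro conjI allI impI)
  have f: "L2 f" and g: "L2 g" using assms by (auto simp: sobolev_def)
  show "L2 (\<lambda>x. a *\<^sub>R f x + b *\<^sub>R g x)" by (rule L2_lincomb[OF f g])
  fix ds :: "'a list" assume "length ds \<le> k"
  then obtain f' g' where "L2 f'" "has_weak_deriv ds f f'" "L2 g'" "has_weak_deriv ds g g'"
    using assms unfolding sobolev_def by blast
  then show "\<exists>h. L2 h \<and> has_weak_deriv ds (\<lambda>x. a *\<^sub>R f x + b *\<^sub>R g x) h"
    using f g by (intro exI[of _ "\<lambda>x. a *\<^sub>R f' x + b *\<^sub>R g' x"])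
      (auto intro!: L2_lincomb has_weak_deriv_lincomb locally_integrable_L2)
qed

lemma weak_deriv_sobolev:
  assumes "sobolev k f" "length ds \<le> k"
  shows "L2 (weak_deriv ds f)" "has_weak_deriv ds f (weak_deriv ds f)"
    "(LINT x|lborel. (norm (weak_deriv ds f x))\<^sup>2) \<le> (sobolev_norm k f)\<^sup>2"
proof -
  have "\<exists>g. L2 g \<and> has_weak_deriv ds f g"
    using assms unfolding sobolev_def by blast
  from someI_ex[OF this] show "L2 (weak_deriv ds f)" "has_weak_deriv ds f (weak_deriv ds f)"
    by (auto simp: weak_deriv_def)
  let ?S = "\<lambda>ds. LINT x|lborel. (norm (weak_deriv ds f x))\<^sup>2"
  have fin: "finite {ds :: 'a list. length ds \<le> k}"
    using finite_lists_length_le[of "UNIV :: 'a set" k] by simp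
  have "?S ds \<le> (\<Sum>ds\<in>{ds. length ds \<le> k}. ?S ds)"
    using assms(2) by (intro member_le_sum fin) auto
  also have "\<dots> = (sobolev_norm k f)\<^sup>2"
    unfolding sobolev_norm_def by (simp add: sum_nonneg)
  finally show "?S ds \<le> (sobolev_norm k f)\<^sup>2" .
qed

text \<open>Here \<open>d\<close> is an increment of a curve in time, \<open>h\<close> the time step, \<open>g\<close> the derivative of the curve
  and \<open>Q\<close> the remainder.  Only \<open>d\<close> is known to be classically differentiable; \<open>Q\<close> and \<open>g\<close> have weak
  derivatives, and these add up to the classical derivatives of \<open>d\<close>.\<close>

lemma C1_sobolev_sq_sup_bound:
  fixes g :: "real^2 \<Rightarrow> 'b::euclidean_space"
  assumes Q: "sobolev k Q" and g: "sobolev k g" and k: "2 \<le> k" and d: "C_diff 2 d"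
    and eq: "\<And>x. d x = h *\<^sub>R Q x + h *\<^sub>R g x"
  shows "(norm (d a))\<^sup>2 \<le> 32 * h\<^sup>2 * ((sobolev_norm k Q)\<^sup>2 + (sobolev_norm k g)\<^sup>2)"
proof -
  let ?B = "2 * h\<^sup>2 * ((sobolev_norm k Q)\<^sup>2 + (sobolev_norm k g)\<^sup>2)"
  have *: "integrable lborel (\<lambda>x. (norm (pds (rev ds) d x))\<^sup>2) \<and>
      (LINT x|lborel. (norm (pds (rev ds) d x))\<^sup>2) \<le> ?B" if len: "length ds \<le> 2" for ds
  proof -
    have lk: "length ds \<le> k" using len k by simp
    let ?q = "weak_deriv ds Q" and ?g = "weak_deriv ds g"
    note q = weak_deriv_sobolev[OF Q lk] and g' = weak_deriv_sobolev[OF g lk]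
    let ?w = "\<lambda>x. h *\<^sub>R ?q x + h *\<^sub>R ?g x"
    have L2w: "L2 ?w" by (rule L2_lincomb[OF q(1) g'(1)])
    have "has_weak_deriv ds d ?w"
      unfolding eq[abs_def]
      using Q g q g' by (intro has_weak_deriv_lincomb locally_integrable_L2) (auto simp: sobolev_def)
    moreover have "has_weak_deriv ds d (pds (rev ds) d)"
      by (rule C_diff_has_weak_deriv[OF d len])
    moreover have cont: "continuous_on UNIV (pds (rev ds) d)"
      using C_diff_continuous[OF C_diff_pds[of "rev ds" 0 d]] C_diff_mono[OF d] len by simp
    ultimately have ae: "AE x in lborel. ?w x = pds (rev ds) d x"
      by (intro has_weak_deriv_unique[of ds d] locally_integrable_L2[OF L2w] locally_integrable_continuous)
    have m: "pds (rev ds) d \<in> borel_measurable lborel"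
      using borel_measurable_continuous_onI[OF cont] by simp
    have wm: "?w \<in> borel_measurable lborel" and wi: "integrable lborel (\<lambda>x. (norm (?w x))\<^sup>2)"
      using L2w by (auto simp: L2_def)
    have m2: "(\<lambda>x. (norm (?w x))\<^sup>2) \<in> borel_measurable lborel"
        "(\<lambda>x. (norm (pds (rev ds) d x))\<^sup>2) \<in> borel_measurable lborel"
      using m wm by (auto intro!: borel_measurable_power borel_measurable_norm)
    have ae2: "AE x in lborel. (norm (?w x))\<^sup>2 = (norm (pds (rev ds) d x))\<^sup>2"
      using ae by (rule AE_mp) (auto intro!: AE_I2)
    have "integrable lborel (\<lambda>x. (norm (pds (rev ds) d x))\<^sup>2)"
      using wi integrable_cong_AE[OF m2 ae2] by blast
    moreover have "(LINT x|lborel. (norm (pds (rev ds) d x))\<^sup>2) \<le> ?B"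
    proof -
      have qi: "integrable lborel (\<lambda>x. (norm (?q x))\<^sup>2)" and gi: "integrable lborel (\<lambda>x. (norm (?g x))\<^sup>2)"
        using q(1) g'(1) by (auto simp: L2_def)
      have "(LINT x|lborel. (norm (pds (rev ds) d x))\<^sup>2) = (LINT x|lborel. (norm (?w x))\<^sup>2)"
        using integral_cong_AE[OF m2 ae2] by simp
      also have "\<dots> \<le> (LINT x|lborel. 2 * h\<^sup>2 * (norm (?q x))\<^sup>2 + 2 * h\<^sup>2 * (norm (?g x))\<^sup>2)"
      proof (rule integral_mono[OF wi])
        show "integrable lborel (\<lambda>x. 2 * h\<^sup>2 * (norm (?q x))\<^sup>2 + 2 * h\<^sup>2 * (norm (?g x))\<^sup>2)"
          using qi gi by simp
        fix x
        have "(norm (?q x + ?g x))\<^sup>2 \<le> (norm (?q x) + norm (?g x))\<^sup>2"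
          by (intro power_mono norm_triangle_ineq) simp
        also have "\<dots> \<le> 2 * (norm (?q x))\<^sup>2 + 2 * (norm (?g x))\<^sup>2"
          using zero_le_power2[of "norm (?q x) - norm (?g x)"] by (simp add: power2_diff power2_sum)
        finally have "h\<^sup>2 * (norm (?q x + ?g x))\<^sup>2 \<le> h\<^sup>2 * (2 * (norm (?q x))\<^sup>2 + 2 * (norm (?g x))\<^sup>2)"
          by (intro mult_left_mono) auto
        then show "(norm (?w x))\<^sup>2 \<le> 2 * h\<^sup>2 * (norm (?q x))\<^sup>2 + 2 * h\<^sup>2 * (norm (?g x))\<^sup>2"
          unfolding scaleR_add_right[symmetric] norm_scaleR by (simp add: power_mult_distrib algebra_simps)
      qed
      also have "\<dots> = 2 * h\<^sup>2 * ((LINT x|lborel. (norm (?q x))\<^sup>2) + (LINT x|lborel. (norm (?g x))\<^sup>2))"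
        using qi gi by (simp add: distrib_left)
      also have "\<dots> \<le> ?B" by (intro mult_left_mono add_mono q g') auto
      finally show ?thesis .
    qed
    ultimately show ?thesis by blast
  qed
  have d0: "integrable lborel (\<lambda>x. (norm (d x))\<^sup>2)" "(LINT x|lborel. (norm (d x))\<^sup>2) \<le> ?B"
    using *[of "[]"] by simp_all
  have d1: "integrable lborel (\<lambda>x. (norm (pd i d x))\<^sup>2)" "(LINT x|lborel. (norm (pd i d x))\<^sup>2) \<le> ?B" for i
    using *[of "[i]"] by simp_all
  have d2: "integrable lborel (\<lambda>x. (norm (pd 2 (pd 1 d) x))\<^sup>2)" "(LINT x|lborel. (norm (pd 2 (pd 1 d) x))\<^sup>2) \<le> ?B"
    using *[of "[1, 2]"] by simp_all
  have "(norm (d a))\<^sup>2 \<le> 4 * (?B + ?B + ?B + ?B)"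
    by (rule order_trans[OF sq_norm_le_sobolev_2[OF d d0(1) d1(1) d1(1) d2(1)]])
       (intro mult_left_mono add_mono d0 d1 d2, simp)
  then show ?thesis by simp
qed

text \<open>The choice of weak derivatives inside the norm is harmless: up to a null set the weak derivative of
  order 0 is the function itself, which gives the statement about \<open>L2\<close>.\<close>

lemma C1_sobolev_time_regularity:
  fixes f :: "real \<Rightarrow> real^2 \<Rightarrow> 'b::euclidean_space"
  assumes C1: "C1_sobolev I k f" and k: "2 \<le> k" and C2: "\<And>t. t \<in> I \<Longrightarrow> C_diff 2 (f t)"
  obtains f' where "\<And>t. t \<in> I \<Longrightarrow> L2 (f t)" and "\<And>t. t \<in> I \<Longrightarrow> L2 (f' t)"
    and "\<And>t. t \<in> I \<Longrightarrow>
      ((\<lambda>s. LINT x|lborel. (norm ((f s x - f t x) /\<^sub>R (s - t) - f' t x))\<^sup>2) \<longlongrightarrow> 0) (at t within I)"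
    and "\<And>t. t \<in> I \<Longrightarrow> uniform_limit UNIV f (f t) (at t within I)"
proof -
  obtain f' where f': "\<And>t. t \<in> I \<Longrightarrow> sobolev k (f t) \<and> sobolev k (f' t) \<and>
        ((\<lambda>s. sobolev_norm k (\<lambda>x. (f s x - f t x) /\<^sub>R (s - t) - f' t x)) \<longlongrightarrow> 0) (at t within I)"
    using C1 unfolding C1_sobolev_def by blast
  define Q where "Q t s = (\<lambda>x. (f s x - f t x) /\<^sub>R (s - t) - f' t x)" for t s
  have lim: "((\<lambda>s. sobolev_norm k (Q t s)) \<longlongrightarrow> 0) (at t within I)" if "t \<in> I" for t
    using f'[OF that] by (simp add: Q_def)
  have Q: "sobolev k (Q t s)" if "t \<in> I" "s \<in> I" for t s
  proof -
    have "sobolev k (\<lambda>x. inverse (s - t) *\<^sub>R (1 *\<^sub>R f s x + (- 1) *\<^sub>R f t x) + (- 1) *\<^sub>R f' t x)"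
      using f' that by (intro sobolev_lincomb) auto
    then show ?thesis by (simp add: Q_def)
  qed
  have ev: "\<forall>\<^sub>F s in at t within I. s \<in> I \<and> s \<noteq> t" for t
    by (auto simp: eventually_at_filter)
  show ?thesis
  proof (rule that[of f'])
    fix t assume t: "t \<in> I"
    show "L2 (f t)" "L2 (f' t)" using f'[OF t] by (simp_all add: sobolev_def)
    show "((\<lambda>s. LINT x|lborel. (norm ((f s x - f t x) /\<^sub>R (s - t) - f' t x))\<^sup>2) \<longlongrightarrow> 0) (at t within I)"
    proof (rule tendsto_sandwich[OF _ _ tendsto_const])
      show "\<forall>\<^sub>F s in at t within I. 0 \<le> (LINT x|lborel. (norm ((f s x - f t x) /\<^sub>R (s - t) - f' t x))\<^sup>2)"
        by simp
      show "((\<lambda>s. (sobolev_norm k (Q t s))\<^sup>2) \<longlongrightarrow> 0) (at t within I)"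
        using tendsto_power[OF lim[OF t], of 2] by simp
      show "\<forall>\<^sub>F s in at t within I. (LINT x|lborel. (norm ((f s x - f t x) /\<^sub>R (s - t) - f' t x))\<^sup>2)
          \<le> (sobolev_norm k (Q t s))\<^sup>2"
        using ev
      proof eventually_elim
        case (elim s)
        then have Qs: "sobolev k (Q t s)" using Q t by blast
        note wd = weak_deriv_sobolev[OF Qs, of "[]", simplified]
        have L2Q: "L2 (Q t s)" using Qs by (simp add: sobolev_def)
        have "has_weak_deriv [] (Q t s) (Q t s)" by (simp add: has_weak_deriv_def)
        then have "AE x in lborel. Q t s x = weak_deriv [] (Q t s) x"
          by (rule has_weak_deriv_unique) (intro wd locally_integrable_L2 L2Q)+
        then have "AE x in lborel. (norm (Q t s x))\<^sup>2 = (norm (weak_deriv [] (Q t s) x))\<^sup>2"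
          by (rule AE_mp) (auto intro!: AE_I2)
        then have "(LINT x|lborel. (norm (Q t s x))\<^sup>2) = (LINT x|lborel. (norm (weak_deriv [] (Q t s) x))\<^sup>2)"
          using L2Q wd(1) by (intro integral_cong_AE) (auto simp: L2_def)
        then show ?case using wd(3) by (simp add: Q_def)
      qed
    qed
    let ?B = "\<lambda>s. 32 * (s - t)\<^sup>2 * ((sobolev_norm k (Q t s))\<^sup>2 + (sobolev_norm k (f' t))\<^sup>2)"
    have "(?B \<longlongrightarrow> 32 * (t - t)\<^sup>2 * (0\<^sup>2 + (sobolev_norm k (f' t))\<^sup>2)) (at t within I)"
      by (intro tendsto_intros lim t)
    then have B: "(?B \<longlongrightarrow> 0) (at t within I)" by simp
    have bound: "(norm (f s x - f t x))\<^sup>2 \<le> ?B s" if s: "s \<in> I" "s \<noteq> t" for s x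
    proof (rule C1_sobolev_sq_sup_bound[OF Q[OF t s(1)] _ k])
      show "sobolev k (f' t)" using f' t by blast
      show "C_diff 2 (\<lambda>x. f s x - f t x)" by (intro C_diff_diff C2 t s)
      show "f s y - f t y = (s - t) *\<^sub>R Q t s y + (s - t) *\<^sub>R f' t y" for y
        using s by (simp add: Q_def scaleR_diff_right)
    qed
    show "uniform_limit UNIV f (f t) (at t within I)"
    proof (rule uniform_limitI)
      fix e :: real assume e: "e > 0"
      have "\<forall>\<^sub>F s in at t within I. ?B s < e\<^sup>2"
        using order_tendstoD(2)[OF B] e by simp
      with ev show "\<forall>\<^sub>F s in at t within I. \<forall>x\<in>UNIV. dist (f s x) (f t x) < e"
      proof eventually_elim
        case (elim s)
        have "norm (f s x - f t x) < e" for x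
          using bound[of s x] elim e by (intro power_less_imp_less_base[of _ 2 e]) auto
        then show ?case by (simp add: dist_norm)
      qed
    qed
  qed
qed

section \<open>Curves of functions that are uniformly continuous and differentiable in L1\<close>

text \<open>Integrability of the approximating functions is only needed near the limit, since a curve may be
  unbounded in space at distant times.\<close>

definition L1_tendsto :: "'a measure \<Rightarrow> ('i \<Rightarrow> 'a \<Rightarrow> real) \<Rightarrow> ('a \<Rightarrow> real) \<Rightarrow> 'i filter \<Rightarrow> bool" where
  "L1_tendsto M q g F \<longleftrightarrow> integrable M g \<and> (\<forall>\<^sub>F s in F. integrable M (q s)) \<and>
     ((\<lambda>s. LINT x|M. \<bar>q s x - g x\<bar>) \<longlongrightarrow> 0) F"

lemma L1_tendsto_dominated:
  assumes "integrable M g" "\<forall>\<^sub>F s in F. integrable M (q s)"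
    and "\<forall>\<^sub>F s in F. (LINT x|M. \<bar>q s x - g x\<bar>) \<le> b s" "(b \<longlongrightarrow> 0) F"
  shows "L1_tendsto M q g F"
  unfolding L1_tendsto_def
  using assms by (auto intro!: tendsto_sandwich[OF _ assms(3) tendsto_const assms(4)])

lemma L1_tendsto_integral:
  assumes "L1_tendsto M q g F"
  shows "((\<lambda>s. LINT x|M. q s x) \<longlongrightarrow> (LINT x|M. g x)) F"
proof -
  have g: "integrable M g" and q: "\<forall>\<^sub>F s in F. integrable M (q s)"
    and l: "((\<lambda>s. LINT x|M. \<bar>q s x - g x\<bar>) \<longlongrightarrow> 0) F"
    using assms by (auto simp: L1_tendsto_def)
  have "((\<lambda>s. (LINT x|M. q s x) - (LINT x|M. g x)) \<longlongrightarrow> 0) F"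
  proof (rule Lim_null_comparison[OF _ l])
    show "\<forall>\<^sub>F s in F. norm ((LINT x|M. q s x) - (LINT x|M. g x)) \<le> (LINT x|M. \<bar>q s x - g x\<bar>)"
      using q
    proof eventually_elim
      case (elim s)
      then show ?case
        using integral_norm_bound[of M "\<lambda>x. q s x - g x"] g by simp
    qed
  qed
  then show ?thesis by (rule LIM_zero_cancel)
qed

lemma L1_tendsto_cong:
  assumes "L1_tendsto M q g F" "\<forall>\<^sub>F s in F. \<forall>x\<in>space M. q s x = q' s x" "\<And>x. x \<in> space M \<Longrightarrow> g x = g' x"
  shows "L1_tendsto M q' g' F"
proof -
  have g: "integrable M g" and q: "\<forall>\<^sub>F s in F. integrable M (q s)"
    and l: "((\<lambda>s. LINT x|M. \<bar>q s x - g x\<bar>) \<longlongrightarrow> 0) F"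
    using assms by (auto simp: L1_tendsto_def)
  have "integrable M g'" using g assms(3) Bochner_Integration.integrable_cong by metis
  moreover have "\<forall>\<^sub>F s in F. integrable M (q' s)"
    using q assms(2)
  proof eventually_elim
    case (elim s)
    then show ?case using Bochner_Integration.integrable_cong[of M M "q s" "q' s"] by auto
  qed
  moreover have "\<forall>\<^sub>F s in F. (LINT x|M. \<bar>q s x - g x\<bar>) = (LINT x|M. \<bar>q' s x - g' x\<bar>)"
    using assms(2)
  proof eventually_elim
    case (elim s)
    then show ?case using assms(3) by (intro Bochner_Integration.integral_cong) auto
  qed
  ultimately show ?thesis
    using l unfolding L1_tendsto_def by (auto elim: Lim_transform_eventually)
qed

lemma L1_tendsto_add:
  assumes "L1_tendsto M q g F" "L1_tendsto M r h F"
  shows "L1_tendsto M (\<lambda>s x. q s x + r s x) (\<lambda>x. g x + h x) F"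
proof -
  have g: "integrable M g" and q: "\<forall>\<^sub>F s in F. integrable M (q s)"
    and lq: "((\<lambda>s. LINT x|M. \<bar>q s x - g x\<bar>) \<longlongrightarrow> 0) F"
    and h: "integrable M h" and r: "\<forall>\<^sub>F s in F. integrable M (r s)"
    and lr: "((\<lambda>s. LINT x|M. \<bar>r s x - h x\<bar>) \<longlongrightarrow> 0) F"
    using assms by (auto simp: L1_tendsto_def)
  show ?thesis
  proof (rule L1_tendsto_dominated)
    show "integrable M (\<lambda>x. g x + h x)" using g h by simp
    show "\<forall>\<^sub>F s in F. integrable M (\<lambda>x. q s x + r s x)" using q r by eventually_elim simp
    show "((\<lambda>s. (LINT x|M. \<bar>q s x - g x\<bar>) + (LINT x|M. \<bar>r s x - h x\<bar>)) \<longlongrightarrow> 0) F"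
      using tendsto_add[OF lq lr] by simp
    show "\<forall>\<^sub>F s in F. (LINT x|M. \<bar>q s x + r s x - (g x + h x)\<bar>)
        \<le> (LINT x|M. \<bar>q s x - g x\<bar>) + (LINT x|M. \<bar>r s x - h x\<bar>)"
      using q r
    proof eventually_elim
      case (elim s)
      have "(LINT x|M. \<bar>q s x + r s x - (g x + h x)\<bar>) \<le> (LINT x|M. \<bar>q s x - g x\<bar> + \<bar>r s x - h x\<bar>)"
        using elim g h by (intro integral_mono) auto
      then show ?case using elim g h by simp
    qed
  qed
qed

lemma bounded_real_imageE:
  assumes "bounded (f ` S)"
  obtains C where "C > 0" "\<And>x. x \<in> S \<Longrightarrow> \<bar>f x :: real\<bar> \<le> C"
  using assms unfolding bounded_pos by auto

lemma uniform_limit_eventually_bounded: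
  fixes f :: "'i \<Rightarrow> 'a \<Rightarrow> real"
  assumes "uniform_limit S f l F" "bounded (l ` S)"
  obtains C where "C > 0" "\<And>x. x \<in> S \<Longrightarrow> \<bar>l x\<bar> \<le> C" "\<forall>\<^sub>F s in F. \<forall>x\<in>S. \<bar>f s x\<bar> \<le> C"
proof -
  obtain C where C: "C > 0" "\<And>x. x \<in> S \<Longrightarrow> \<bar>l x\<bar> \<le> C"
    using bounded_real_imageE[OF assms(2)] by blast
  have "\<forall>\<^sub>F s in F. \<forall>x\<in>S. dist (f s x) (l x) < 1"
    using uniform_limitD[OF assms(1), of 1] by simp
  then have "\<forall>\<^sub>F s in F. \<forall>x\<in>S. \<bar>f s x\<bar> \<le> C + 1"
    by eventually_elim (use C(2) in \<open>fastforce simp: dist_real_def\<close>)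
  then show ?thesis using that[of "C + 1"] C by fastforce
qed

text \<open>Write \<open>\<psi> q - \<psi>' g = \<psi> (q - g) + (\<psi> - \<psi>') g\<close>; the first factor is bounded in the first term and
  uniformly small in the second.\<close>

lemma L1_tendsto_mult_uniform:
  assumes L: "L1_tendsto M q g F"
    and u: "uniform_limit (space M) \<psi> \<psi>' F" and b: "bounded (\<psi>' ` space M)"
    and m: "\<forall>\<^sub>F s in F. \<psi> s \<in> borel_measurable M" "\<psi>' \<in> borel_measurable M"
  shows "L1_tendsto M (\<lambda>s x. \<psi> s x * q s x) (\<lambda>x. \<psi>' x * g x) F"
proof -
  have g: "integrable M g" and q: "\<forall>\<^sub>F s in F. integrable M (q s)"
    and lq: "((\<lambda>s. LINT x|M. \<bar>q s x - g x\<bar>) \<longlongrightarrow> 0) F"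
    using L by (auto simp: L1_tendsto_def)
  obtain C where C: "C > 0" "\<And>x. x \<in> space M \<Longrightarrow> \<bar>\<psi>' x\<bar> \<le> C" "\<forall>\<^sub>F s in F. \<forall>x\<in>space M. \<bar>\<psi> s x\<bar> \<le> C"
    using uniform_limit_eventually_bounded[OF u b] by blast
  have bm: "integrable M (\<lambda>x. p x * f x)"
    if "p \<in> borel_measurable M" "integrable M f" "\<And>x. x \<in> space M \<Longrightarrow> \<bar>p x\<bar> \<le> c" for p f :: "'a \<Rightarrow> real" and c
  proof (rule Bochner_Integration.integrable_bound)
    show "integrable M (\<lambda>x. c * f x)" using that(2) by simp
    show "AE x in M. norm (p x * f x) \<le> norm (c * f x)"
    proof (rule AE_I2)
      fix x assume "x \<in> space M"
      from that(3)[OF this] show "norm (p x * f x) \<le> norm (c * f x)"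
        unfolding norm_mult by (intro mult_right_mono) auto
    qed
  qed (use that in simp)
  have lg: "((\<lambda>s. LINT x|M. \<bar>\<psi> s x - \<psi>' x\<bar> * \<bar>g x\<bar>) \<longlongrightarrow> 0) F"
  proof (rule tendstoI)
    fix e :: real assume e: "e > 0"
    let ?G = "LINT x|M. \<bar>g x\<bar>"
    have G: "?G \<ge> 0" by simp
    define e' where "e' = e / (?G + 1)"
    have e1: "e' > 0" unfolding e'_def by (rule divide_pos_pos[OF e]) (use G in linarith)
    have "e' * ?G < e' * (?G + 1)" using e1 by (intro mult_strict_left_mono) auto
    also have "\<dots> = e" unfolding e'_def using G by (simp add: add_nonneg_eq_0_iff)
    finally have e': "e' > 0" "e' * ?G < e" using e1 by auto
    have "\<forall>\<^sub>F s in F. \<forall>x\<in>space M. dist (\<psi> s x) (\<psi>' x) < e'"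
      using uniform_limitD[OF u e'(1)] .
    with m(1) show "\<forall>\<^sub>F s in F. dist (LINT x|M. \<bar>\<psi> s x - \<psi>' x\<bar> * \<bar>g x\<bar>) 0 < e"
    proof eventually_elim
      case (elim s)
      have le: "\<bar>\<psi> s x - \<psi>' x\<bar> \<le> e'" if "x \<in> space M" for x
        using elim that by (auto simp: dist_real_def intro: less_imp_le)
      have "(LINT x|M. \<bar>\<psi> s x - \<psi>' x\<bar> * \<bar>g x\<bar>) \<le> (LINT x|M. e' * \<bar>g x\<bar>)"
        using g elim m(2) le e1 by (intro integral_mono bm[of _ _ e'] mult_right_mono) auto
      then show ?case using e' by (simp add: dist_real_def)
    qed
  qed
  show ?thesis
  proof (rule L1_tendsto_dominated)
    show "integrable M (\<lambda>x. \<psi>' x * g x)" by (rule bm[OF m(2) g C(2)])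
    show iq: "\<forall>\<^sub>F s in F. integrable M (\<lambda>x. \<psi> s x * q s x)"
      using m(1) q C(3) by eventually_elim (rule bm[of _ _ C], auto)
    show "((\<lambda>s. C * (LINT x|M. \<bar>q s x - g x\<bar>) + (LINT x|M. \<bar>\<psi> s x - \<psi>' x\<bar> * \<bar>g x\<bar>)) \<longlongrightarrow> 0) F"
      using tendsto_add[OF tendsto_mult[OF tendsto_const[of C] lq] lg] by simp
    show "\<forall>\<^sub>F s in F. (LINT x|M. \<bar>\<psi> s x * q s x - \<psi>' x * g x\<bar>)
        \<le> C * (LINT x|M. \<bar>q s x - g x\<bar>) + (LINT x|M. \<bar>\<psi> s x - \<psi>' x\<bar> * \<bar>g x\<bar>)"
      using m(1) q C(3) iq
    proof eventually_elim
      case (elim s)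
      have ie: "integrable M (\<lambda>x. \<bar>\<psi> s x - \<psi>' x\<bar> * \<bar>g x\<bar>)"
      proof (rule bm[of _ _ "C + C"])
        show "\<bar>\<bar>\<psi> s x - \<psi>' x\<bar>\<bar> \<le> C + C" if x: "x \<in> space M" for x
        proof -
          have "\<bar>\<psi> s x - \<psi>' x\<bar> \<le> \<bar>\<psi> s x\<bar> + \<bar>\<psi>' x\<bar>" by (rule abs_triangle_ineq4)
          also have "\<dots> \<le> C + C" using elim(3) C(2) x by (intro add_mono) auto
          finally show ?thesis by simp
        qed
      qed (use elim m(2) g in auto)
      have "(LINT x|M. \<bar>\<psi> s x * q s x - \<psi>' x * g x\<bar>)
          \<le> (LINT x|M. C * \<bar>q s x - g x\<bar> + \<bar>\<psi> s x - \<psi>' x\<bar> * \<bar>g x\<bar>)"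
      proof (rule integral_mono)
        show "integrable M (\<lambda>x. \<bar>\<psi> s x * q s x - \<psi>' x * g x\<bar>)"
          using elim(4) bm[OF m(2) g C(2)] by simp
        show "integrable M (\<lambda>x. C * \<bar>q s x - g x\<bar> + \<bar>\<psi> s x - \<psi>' x\<bar> * \<bar>g x\<bar>)"
          using elim g ie by simp
        fix x assume x: "x \<in> space M"
        have "\<psi> s x * q s x - \<psi>' x * g x = \<psi> s x * (q s x - g x) + (\<psi> s x - \<psi>' x) * g x"
          by (simp add: algebra_simps)
        then have "\<bar>\<psi> s x * q s x - \<psi>' x * g x\<bar> \<le> \<bar>\<psi> s x\<bar> * \<bar>q s x - g x\<bar> + \<bar>\<psi> s x - \<psi>' x\<bar> * \<bar>g x\<bar>"
          by (metis abs_mult abs_triangle_ineq)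
        also have "\<bar>\<psi> s x\<bar> * \<bar>q s x - g x\<bar> \<le> C * \<bar>q s x - g x\<bar>"
          using elim(3) x by (intro mult_right_mono) auto
        finally show "\<bar>\<psi> s x * q s x - \<psi>' x * g x\<bar> \<le> C * \<bar>q s x - g x\<bar> + \<bar>\<psi> s x - \<psi>' x\<bar> * \<bar>g x\<bar>"
          by simp
      qed
      then show ?case using elim g ie by simp
    qed
  qed
qed

text \<open>Differentiability in \<open>L1\<close> alone is not stable under products.  With uniform continuity added, the
  class is an algebra that is also closed under composition with \<open>C^1\<close> functions.\<close>

definition L1_differentiable :: "'a measure \<Rightarrow> real set \<Rightarrow> real \<Rightarrow> (real \<Rightarrow> 'a \<Rightarrow> real) \<Rightarrow> bool" where
  "L1_differentiable M I t f \<longleftrightarrow>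
     (\<forall>s\<in>I. f s \<in> borel_measurable M) \<and> bounded (f t ` space M) \<and>
     uniform_limit (space M) f (f t) (at t within I) \<and>
     (\<exists>g. L1_tendsto M (\<lambda>s x. (f s x - f t x) / (s - t)) g (at t within I))"

lemma eventually_at_within_in: "\<forall>\<^sub>F s in at t within I. s \<in> I \<and> s \<noteq> (t :: real)"
  by (auto simp: eventually_at_filter)

lemma L1_tendsto_const: "integrable M g \<Longrightarrow> L1_tendsto M (\<lambda>_. g) g F"
  by (simp add: L1_tendsto_def)

lemma L1_differentiable_const:
  assumes "f \<in> borel_measurable M" "bounded (f ` space M)"
  shows "L1_differentiable M I t (\<lambda>_. f)"
  unfolding L1_differentiable_def
  using assms L1_tendsto_const[of M "\<lambda>_. 0" "at t within I"]
  by (auto intro!: uniform_limitI exI[of _ "\<lambda>_. 0"])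

lemma L1_differentiable_add:
  assumes "L1_differentiable M I t f" "L1_differentiable M I t h"
  shows "L1_differentiable M I t (\<lambda>s x. f s x + h s x)"
proof -
  obtain g g' where
    g: "L1_tendsto M (\<lambda>s x. (f s x - f t x) / (s - t)) g (at t within I)"
    and g': "L1_tendsto M (\<lambda>s x. (h s x - h t x) / (s - t)) g' (at t within I)"
    using assms unfolding L1_differentiable_def by blast
  have "L1_tendsto M (\<lambda>s x. (f s x + h s x - (f t x + h t x)) / (s - t)) (\<lambda>x. g x + g' x) (at t within I)"
    by (rule L1_tendsto_cong[OF L1_tendsto_add[OF g g']]) (auto simp: add_divide_distrib diff_divide_distrib)
  then show ?thesis
    using assms unfolding L1_differentiable_def
    by (auto intro!: uniform_limit_add bounded_plus_comp borel_measurable_add)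
qed

lemma L1_differentiable_sum:
  assumes "finite A" "\<And>a. a \<in> A \<Longrightarrow> L1_differentiable M I t (f a)"
  shows "L1_differentiable M I t (\<lambda>s x. \<Sum>a\<in>A. f a s x)"
  using assms
proof (induction A rule: finite_induct)
  case empty
  have "bounded ((\<lambda>_. 0 :: real) ` space M)" by (rule bounded_subset[of "{0}"]) auto
  then show ?case by (simp add: L1_differentiable_const)
next
  case (insert a A)
  then show ?case using L1_differentiable_add[of M I t "f a"] by simp
qed

text \<open>The difference quotient of a product is \<open>h(s) (f(s) - f(t)) / (s - t) + f(t) (h(s) - h(t)) / (s - t)\<close>,
  and \<open>h(s)\<close> tends to \<open>h(t)\<close> uniformly.\<close>

lemma L1_differentiable_mult:
  assumes t: "t \<in> I" and f: "L1_differentiable M I t f" and h: "L1_differentiable M I t h"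
  shows "L1_differentiable M I t (\<lambda>s x. f s x * h s x)"
proof -
  have fm: "\<And>s. s \<in> I \<Longrightarrow> f s \<in> borel_measurable M" and fb: "bounded (f t ` space M)"
    and fu: "uniform_limit (space M) f (f t) (at t within I)"
    and hm: "\<And>s. s \<in> I \<Longrightarrow> h s \<in> borel_measurable M" and hb: "bounded (h t ` space M)"
    and hu: "uniform_limit (space M) h (h t) (at t within I)"
    using f h by (auto simp: L1_differentiable_def)
  obtain g g' where
    g: "L1_tendsto M (\<lambda>s x. (f s x - f t x) / (s - t)) g (at t within I)"
    and g': "L1_tendsto M (\<lambda>s x. (h s x - h t x) / (s - t)) g' (at t within I)"
    using f h unfolding L1_differentiable_def by blast
  have hm': "\<forall>\<^sub>F s in at t within I. h s \<in> borel_measurable M"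
    using eventually_at_within_in by eventually_elim (use hm in auto)
  note A = L1_tendsto_mult_uniform[OF g hu hb hm' hm[OF t]]
  have const: "uniform_limit (space M) (\<lambda>_. f t) (f t) (at t within I)"
    by (rule uniform_limitI) simp
  have const_m: "\<forall>\<^sub>F s in at t within I. f t \<in> borel_measurable M"
    using fm[OF t] by simp
  note B = L1_tendsto_mult_uniform[OF g' const fb const_m fm[OF t]]
  have "L1_tendsto M (\<lambda>s x. (f s x * h s x - f t x * h t x) / (s - t)) (\<lambda>x. h t x * g x + f t x * g' x) (at t within I)"
  proof (rule L1_tendsto_cong[OF L1_tendsto_add[OF A B]])
    show "\<forall>\<^sub>F s in at t within I. \<forall>x\<in>space M. h s x * ((f s x - f t x) / (s - t)) + f t x * ((h s x - h t x) / (s - t))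
        = (f s x * h s x - f t x * h t x) / (s - t)"
      by (simp add: algebra_simps diff_divide_distrib)
  qed simp
  moreover have "bounded ((\<lambda>x. f t x * h t x) ` space M)"
  proof -
    obtain C D where "\<And>x. x \<in> space M \<Longrightarrow> \<bar>f t x\<bar> \<le> C" "\<And>x. x \<in> space M \<Longrightarrow> \<bar>h t x\<bar> \<le> D" "C > 0" "D > 0"
      using bounded_real_imageE[OF fb] bounded_real_imageE[OF hb] by metis
    then show ?thesis
      unfolding bounded_iff by (intro exI[of _ "C * D"]) (auto simp: abs_mult intro!: mult_mono)
  qed
  ultimately show ?thesis
    using fm hm uniform_lim_mult[OF fu hu fb hb] unfolding L1_differentiable_def by auto
qed

text \<open>The difference quotient of \<open>\<phi> \<circ> f\<close> is that of \<open>f\<close> times a difference quotient of \<open>\<phi>\<close>.  By the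
  mean value theorem and uniform continuity of \<open>\<phi>'\<close> on bounded sets the latter tends uniformly to
  \<open>\<phi>'(f(t))\<close>.\<close>

lemma L1_differentiable_compose:
  assumes t: "t \<in> I" and f: "L1_differentiable M I t f"
    and \<phi>: "\<And>y. (\<phi> has_real_derivative \<phi>' y) (at y)" and \<phi>': "continuous_on UNIV \<phi>'"
  shows "L1_differentiable M I t (\<lambda>s x. \<phi> (f s x))"
proof -
  have fm: "\<And>s. s \<in> I \<Longrightarrow> f s \<in> borel_measurable M" and fb: "bounded (f t ` space M)"
    and fu: "uniform_limit (space M) f (f t) (at t within I)"
    using f by (auto simp: L1_differentiable_def)
  obtain g where g: "L1_tendsto M (\<lambda>s x. (f s x - f t x) / (s - t)) g (at t within I)"
    using f unfolding L1_differentiable_def by blast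
  obtain C where C: "C > 0" "\<And>x. x \<in> space M \<Longrightarrow> \<bar>f t x\<bar> \<le> C"
      "\<forall>\<^sub>F s in at t within I. \<forall>x\<in>space M. \<bar>f s x\<bar> \<le> C"
    using uniform_limit_eventually_bounded[OF fu fb] by blast
  have \<phi>c: "continuous_on UNIV \<phi>"
    by (intro continuous_at_imp_continuous_on ballI DERIV_isCont[OF \<phi>])
  have \<phi>m: "\<phi> \<in> borel_measurable borel" "\<phi>' \<in> borel_measurable borel"
    using \<phi>c \<phi>' by (auto intro: borel_measurable_continuous_onI)
  have img_bounded: "bounded ((\<lambda>x. u (f t x)) ` space M)" if u: "continuous_on UNIV u" for u :: "real \<Rightarrow> real"
  proof -
    have "bounded (u ` {- C..C})"
      by (intro compact_imp_bounded compact_continuous_image continuous_on_subset[OF u]) auto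
    then show ?thesis by (rule bounded_subset) (use C(2) in \<open>fastforce simp: abs_le_iff\<close>)
  qed
  have uc: "uniformly_continuous_on {- C..C} u" if u: "continuous_on UNIV u" for u :: "real \<Rightarrow> real"
    by (intro compact_uniformly_continuous continuous_on_subset[OF u]) auto
  have comp_u: "uniform_limit (space M) (\<lambda>s x. \<phi> (f s x)) (\<lambda>x. \<phi> (f t x)) (at t within I)"
  proof (rule uniform_limitI)
    fix e :: real assume "e > 0"
    then obtain d where d: "d > 0" "\<And>a b. a \<in> {- C..C} \<Longrightarrow> b \<in> {- C..C} \<Longrightarrow> dist a b < d \<Longrightarrow> dist (\<phi> a) (\<phi> b) < e"
      using uc[OF \<phi>c] unfolding uniformly_continuous_on_def by metis
    have "\<forall>\<^sub>F s in at t within I. \<forall>x\<in>space M. dist (f s x) (f t x) < d"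
      by (rule uniform_limitD[OF fu d(1)])
    with C(3) show "\<forall>\<^sub>F s in at t within I. \<forall>x\<in>space M. dist (\<phi> (f s x)) (\<phi> (f t x)) < e"
      by eventually_elim (use C(2) in \<open>auto intro!: d(2) simp: abs_le_iff minus_le_iff\<close>)
  qed
  \<comment> \<open>The difference quotient of \<open>\<phi>\<close>, continuously extended to the diagonal by the derivative.\<close>
  define \<psi> where "\<psi> s x = (if f s x = f t x then \<phi>' (f t x) else (\<phi> (f s x) - \<phi> (f t x)) / (f s x - f t x))" for s x
  have mvt: "\<exists>z\<in>{- C..C}. \<bar>z - f t x\<bar> \<le> \<bar>f s x - f t x\<bar> \<and> \<psi> s x = \<phi>' z"
    if x: "x \<in> space M" and le: "\<bar>f s x\<bar> \<le> C" for s x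
  proof (cases "f s x = f t x")
    case True
    then show ?thesis using C(2)[OF x] by (intro bexI[of _ "f t x"]) (auto simp: \<psi>_def)
  next
    case False
    have *: "\<exists>z. min a b < z \<and> z < max a b \<and> (\<phi> b - \<phi> a) / (b - a) = \<phi>' z" if "a \<noteq> b" for a b
    proof (cases "a < b")
      case True
      then obtain z where "a < z" "z < b" "\<phi> b - \<phi> a = (b - a) * \<phi>' z"
        using MVT2[OF True \<phi>] by auto
      then show ?thesis by (intro exI[of _ z]) auto
    next
      case False
      then have ba: "b < a" using that by simp
      then obtain z where "b < z" "z < a" "\<phi> a - \<phi> b = (a - b) * \<phi>' z"
        using MVT2[OF ba \<phi>] by auto
      then show ?thesis by (intro exI[of _ z]) (auto simp: field_simps)
    qed
    obtain z where "min (f t x) (f s x) < z" "z < max (f t x) (f s x)"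
        "(\<phi> (f s x) - \<phi> (f t x)) / (f s x - f t x) = \<phi>' z"
      using *[of "f t x" "f s x"] False by metis
    then show ?thesis using C(2)[OF x] le False by (intro bexI[of _ z]) (auto simp: \<psi>_def)
  qed
  have \<psi>u: "uniform_limit (space M) \<psi> (\<lambda>x. \<phi>' (f t x)) (at t within I)"
  proof (rule uniform_limitI)
    fix e :: real assume "e > 0"
    then obtain d where d: "d > 0" "\<And>a b. a \<in> {- C..C} \<Longrightarrow> b \<in> {- C..C} \<Longrightarrow> dist a b < d \<Longrightarrow> dist (\<phi>' a) (\<phi>' b) < e"
      using uc[OF \<phi>'] unfolding uniformly_continuous_on_def by metis
    have "\<forall>\<^sub>F s in at t within I. \<forall>x\<in>space M. dist (f s x) (f t x) < d"
      by (rule uniform_limitD[OF fu d(1)])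
    with C(3) show "\<forall>\<^sub>F s in at t within I. \<forall>x\<in>space M. dist (\<psi> s x) (\<phi>' (f t x)) < e"
    proof eventually_elim
      case (elim s)
      show ?case
      proof
        fix x assume x: "x \<in> space M"
        then obtain z where z: "z \<in> {- C..C}" "\<bar>z - f t x\<bar> \<le> \<bar>f s x - f t x\<bar>" "\<psi> s x = \<phi>' z"
          using mvt elim by metis
        moreover have "dist z (f t x) < d" using elim(2) x z(2) by (auto simp: dist_real_def)
        ultimately show "dist (\<psi> s x) (\<phi>' (f t x)) < e"
          using d(2)[of z "f t x"] C(2)[OF x] by (auto simp: abs_le_iff minus_le_iff)
      qed
    qed
  qed
  have \<psi>m: "\<psi> s \<in> borel_measurable M" if "s \<in> I" for s
  proof -
    note [measurable] = fm[OF that] fm[OF t] \<phi>m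
    show ?thesis unfolding \<psi>_def[abs_def] by measurable
  qed
  have "\<forall>\<^sub>F s in at t within I. \<psi> s \<in> borel_measurable M"
    using eventually_at_within_in by eventually_elim (use \<psi>m in auto)
  moreover have "(\<lambda>x. \<phi>' (f t x)) \<in> borel_measurable M"
    using measurable_compose[OF fm[OF t] \<phi>m(2)] .
  ultimately have "L1_tendsto M (\<lambda>s x. \<psi> s x * ((f s x - f t x) / (s - t))) (\<lambda>x. \<phi>' (f t x) * g x) (at t within I)"
    by (rule L1_tendsto_mult_uniform[OF g \<psi>u img_bounded[OF \<phi>']])
  then have "L1_tendsto M (\<lambda>s x. (\<phi> (f s x) - \<phi> (f t x)) / (s - t)) (\<lambda>x. \<phi>' (f t x) * g x) (at t within I)"
    by (rule L1_tendsto_cong) (auto simp: \<psi>_def)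
  moreover have "(\<lambda>x. \<phi> (f s x)) \<in> borel_measurable M" if "s \<in> I" for s
    using measurable_compose[OF fm[OF that] \<phi>m(1)] .
  ultimately show ?thesis
    using comp_u img_bounded[OF \<phi>c] unfolding L1_differentiable_def by auto
qed

lemma L1_differentiable_real_function:
  assumes t: "t \<in> I" and p: "(p has_real_derivative p') (at t within I)" and M: "finite_measure M"
  shows "L1_differentiable M I t (\<lambda>s _. p s)"
proof -
  interpret finite_measure M by fact
  have lim: "((\<lambda>s. (p s - p t) / (s - t)) \<longlongrightarrow> p') (at t within I)"
    using p by (simp add: has_field_derivative_iff)
  have "(p \<longlongrightarrow> p t) (at t within I)"
    using DERIV_continuous[OF p] by (simp add: continuous_within)
  then have "uniform_limit (space M) (\<lambda>s _. p s) (\<lambda>_. p t) (at t within I)"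
    unfolding uniform_limit_iff tendsto_iff by (auto elim: eventually_mono)
  moreover have "L1_tendsto M (\<lambda>s _. (p s - p t) / (s - t)) (\<lambda>_. p') (at t within I)"
  proof (rule L1_tendsto_dominated)
    have "((\<lambda>s. measure M (space M) * \<bar>(p s - p t) / (s - t) - p'\<bar>) \<longlongrightarrow> measure M (space M) * \<bar>p' - p'\<bar>) (at t within I)"
      by (intro tendsto_intros lim)
    then show "((\<lambda>s. measure M (space M) * \<bar>(p s - p t) / (s - t) - p'\<bar>) \<longlongrightarrow> 0) (at t within I)" by simp
  qed auto
  moreover have "bounded ((\<lambda>_. p t) ` space M)"
    by (rule bounded_subset[of "{p t}"]) auto
  ultimately show ?thesis by (auto simp: L1_differentiable_def)
qed

lemma finite_measure_restrict_lborel: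
  "compact B \<Longrightarrow> finite_measure (restrict_space lborel (B :: 'a::euclidean_space set))"
  by (intro finite_measureI)
     (auto simp: emeasure_restrict_space compact_imp_closed borel_closed emeasure_lborel_cbox
        space_restrict_space dest!: emeasure_compact_finite)

lemma integral_restrict_lborel:
  fixes f :: "'a::euclidean_space \<Rightarrow> real"
  assumes "compact B" "\<And>x. x \<notin> B \<Longrightarrow> f x = 0"
  shows "(LINT x|restrict_space lborel B. f x) = (LINT x|lborel. f x)"
proof -
  have eq: "(\<lambda>x. indicator B x *\<^sub>R f x) = f"
  proof
    fix x show "indicator B x *\<^sub>R f x = f x" using assms(2)[of x] by (cases "x \<in> B") auto
  qed
  have "B \<inter> space lborel \<in> sets lborel" using assms(1) by (simp add: compact_imp_closed borel_closed)
  from integral_restrict_space[OF this, of f] show ?thesis unfolding eq .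
qed

text \<open>On a set of finite measure convergence in \<open>L2\<close> implies convergence in \<open>L1\<close>, by
  \<open>|y| \<le> \<delta> + y^2 / \<delta>\<close>.\<close>

lemma L1_differentiable_if_L2:
  fixes f :: "real \<Rightarrow> real^'n::finite \<Rightarrow> 'b::euclidean_space"
  assumes t: "t \<in> I" and B: "compact B" and e: "norm e = 1"
    and c: "\<And>s. s \<in> I \<Longrightarrow> continuous_on UNIV (f s)"
    and L2: "\<And>s. s \<in> I \<Longrightarrow> L2 (f s)" "L2 f'"
    and lim: "((\<lambda>s. LINT x|lborel. (norm ((f s x - f t x) /\<^sub>R (s - t) - f' x))\<^sup>2) \<longlongrightarrow> 0) (at t within I)"
    and u: "uniform_limit UNIV f (f t) (at t within I)"
  shows "L1_differentiable (restrict_space lborel B) I t (\<lambda>s x. f s x \<bullet> e)"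
proof -
  let ?M = "restrict_space lborel B"
  interpret finite_measure ?M by (rule finite_measure_restrict_lborel[OF B])
  have Bs: "B \<inter> space lborel \<in> sets lborel" using B by (simp add: compact_imp_closed borel_closed)
  have sp: "space ?M = B" by (simp add: space_restrict_space)
  have cm: "(\<lambda>x. f s x \<bullet> e) \<in> borel_measurable ?M" if "s \<in> I" for s
  proof -
    have "(\<lambda>x. f s x \<bullet> e) \<in> borel_measurable borel"
      by (intro borel_measurable_continuous_onI continuous_intros c that)
    then show ?thesis by (intro measurable_restrict_space1) simp
  qed
  define Q where "Q s x = (f s x - f t x) /\<^sub>R (s - t) - f' x" for s x
  have LQ: "L2 (Q s)" if "s \<in> I" for s
  proof -
    have "L2 (\<lambda>x. inverse (s - t) *\<^sub>R (1 *\<^sub>R f s x + (- 1) *\<^sub>R f t x) + (- 1) *\<^sub>R f' x)"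
      by (intro L2_lincomb L2 that t)
    then show ?thesis by (simp add: Q_def[abs_def])
  qed
  have int1: "integrable ?M g" if g: "g \<in> borel_measurable lborel" "integrable lborel (\<lambda>x. (g x)\<^sup>2)" for g :: "real^'n \<Rightarrow> real"
  proof (rule Bochner_Integration.integrable_bound)
    have "integrable ?M (\<lambda>x. (g x)\<^sup>2)"
      unfolding integrable_restrict_space[OF Bs]
      using integrable_mult_indicator[of B lborel "\<lambda>x. (g x)\<^sup>2"] g Bs by simp
    then show "integrable ?M (\<lambda>x. 1 + (g x)\<^sup>2)" by simp
    show "g \<in> borel_measurable ?M" using g(1) by (rule measurable_restrict_space1)
    have "\<bar>g x\<bar> \<le> 1 + (g x)\<^sup>2" for x
      using zero_le_power2[of "\<bar>g x\<bar> - 1"] by (simp add: power2_diff)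
    then show "AE x in ?M. norm (g x) \<le> norm (1 + (g x)\<^sup>2)" by (intro AE_I2) simp
  qed
  have L2_inner: "(\<lambda>x. g x \<bullet> e) \<in> borel_measurable lborel \<and> integrable lborel (\<lambda>x. (g x \<bullet> e)\<^sup>2)"
    if g: "L2 g" for g :: "real^'n \<Rightarrow> 'b"
  proof
    show m: "(\<lambda>x. g x \<bullet> e) \<in> borel_measurable lborel" using g by (auto simp: L2_def)
    show "integrable lborel (\<lambda>x. (g x \<bullet> e)\<^sup>2)"
    proof (rule Bochner_Integration.integrable_bound)
      show "integrable lborel (\<lambda>x. (norm (g x))\<^sup>2)" using g by (simp add: L2_def)
      have "\<bar>g x \<bullet> e\<bar> \<le> norm (g x)" for x using Cauchy_Schwarz_ineq2[of "g x" e] e by simp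
      then show "AE x in lborel. norm ((g x \<bullet> e)\<^sup>2) \<le> norm ((norm (g x))\<^sup>2)"
        by (intro AE_I2) (simp add: abs_le_square_iff[symmetric])
    qed (use m in simp)
  qed
  have tend: "((\<lambda>s. LINT x|?M. \<bar>Q s x \<bullet> e\<bar>) \<longlongrightarrow> 0) (at t within I)"
  proof (rule tendstoI)
    fix \<epsilon> :: real assume \<epsilon>: "\<epsilon> > 0"
    let ?m = "measure ?M (space ?M)"
    define \<delta> where "\<delta> = \<epsilon> / (2 * (?m + 1))"
    have m0: "?m + 1 > 0" by (simp add: add_nonneg_pos)
    have \<delta>: "\<delta> > 0" unfolding \<delta>_def using \<epsilon> m0 by (intro divide_pos_pos) auto
    have "\<delta> * ?m < \<delta> * (?m + 1)" using \<delta> by (intro mult_strict_left_mono) auto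
    also have "\<dots> = \<epsilon> / 2" using m0 unfolding \<delta>_def by (simp add: field_simps)
    finally have \<delta>m: "\<delta> * ?m < \<epsilon> / 2" .
    have "\<forall>\<^sub>F s in at t within I. (LINT x|lborel. (norm (Q s x))\<^sup>2) < \<delta> * (\<epsilon> / 2)"
      using order_tendstoD(2)[OF lim, of "\<delta> * (\<epsilon> / 2)"] \<delta> \<epsilon> by (simp add: Q_def)
    with eventually_at_within_in show "\<forall>\<^sub>F s in at t within I. dist (LINT x|?M. \<bar>Q s x \<bullet> e\<bar>) 0 < \<epsilon>"
    proof eventually_elim
      case (elim s)
      then have L: "L2 (Q s)" using LQ by blast
      have i2: "integrable lborel (\<lambda>x. (norm (Q s x))\<^sup>2)" using L by (simp add: L2_def)
      have i3: "integrable ?M (\<lambda>x. (norm (Q s x))\<^sup>2)"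
        unfolding integrable_restrict_space[OF Bs]
        using integrable_mult_indicator[of B lborel "\<lambda>x. (norm (Q s x))\<^sup>2"] i2 Bs by simp
      have pt: "\<bar>Q s x \<bullet> e\<bar> \<le> \<delta> + (norm (Q s x))\<^sup>2 / \<delta>" for x
      proof -
        have "\<bar>Q s x \<bullet> e\<bar> \<le> norm (Q s x)" using Cauchy_Schwarz_ineq2[of "Q s x" e] e by simp
        moreover have "norm (Q s x) * \<delta> \<le> (\<delta> + (norm (Q s x))\<^sup>2 / \<delta>) * \<delta>"
        proof -
          have "0 \<le> (norm (Q s x) - \<delta>)\<^sup>2" "0 \<le> norm (Q s x) * \<delta>" using \<delta> by auto
          then have "norm (Q s x) * \<delta> \<le> \<delta>\<^sup>2 + (norm (Q s x))\<^sup>2" unfolding power2_diff by linarith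
          also have "\<dots> = (\<delta> + (norm (Q s x))\<^sup>2 / \<delta>) * \<delta>" using \<delta> by (simp add: field_simps power2_eq_square)
          finally show ?thesis .
        qed
        ultimately show ?thesis using \<delta> by (meson mult_le_cancel_right_pos order_trans)
      qed
      have "(LINT x|?M. \<bar>Q s x \<bullet> e\<bar>) \<le> (LINT x|?M. \<delta> + (norm (Q s x))\<^sup>2 / \<delta>)"
      proof (rule integral_mono)
        have "integrable ?M (\<lambda>x. Q s x \<bullet> e)" using L2_inner[OF L] int1 by blast
        then show "integrable ?M (\<lambda>x. \<bar>Q s x \<bullet> e\<bar>)" by (rule integrable_abs)
        show "integrable ?M (\<lambda>x. \<delta> + (norm (Q s x))\<^sup>2 / \<delta>)"
          using i3 by (intro Bochner_Integration.integrable_add integrable_divide) auto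
      qed (rule pt)
      also have "\<dots> = \<delta> * ?m + (LINT x|?M. (norm (Q s x))\<^sup>2) / \<delta>"
        using i3 by simp
      also have "(LINT x|?M. (norm (Q s x))\<^sup>2) \<le> (LINT x|lborel. (norm (Q s x))\<^sup>2)"
        unfolding integral_restrict_space[OF Bs]
        by (rule integral_mono'[OF i2]) (auto simp: indicator_def)
      finally have "(LINT x|?M. \<bar>Q s x \<bullet> e\<bar>) \<le> \<delta> * ?m + (LINT x|lborel. (norm (Q s x))\<^sup>2) / \<delta>"
        using \<delta> by (simp add: divide_right_mono)
      also have "(LINT x|lborel. (norm (Q s x))\<^sup>2) / \<delta> < \<epsilon> / 2"
        using elim \<delta> by (simp add: pos_divide_less_eq mult.commute)
      finally show ?case using \<delta>m by (simp add: dist_real_def)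
    qed
  qed
  have f'i: "integrable ?M (\<lambda>x. f' x \<bullet> e)"
    using L2_inner[OF L2(2)] int1 by blast
  have "L1_tendsto ?M (\<lambda>s x. (f s x \<bullet> e - f t x \<bullet> e) / (s - t)) (\<lambda>x. f' x \<bullet> e) (at t within I)"
    unfolding L1_tendsto_def
  proof (intro conjI f'i)
    have q: "(f s x \<bullet> e - f t x \<bullet> e) / (s - t) - f' x \<bullet> e = Q s x \<bullet> e" for s x
      by (simp add: Q_def inner_diff_left divide_inverse mult.commute)
    show "((\<lambda>s. LINT x|?M. \<bar>(f s x \<bullet> e - f t x \<bullet> e) / (s - t) - f' x \<bullet> e\<bar>) \<longlongrightarrow> 0) (at t within I)"
      unfolding q by (rule tend)
    show "\<forall>\<^sub>F s in at t within I. integrable ?M (\<lambda>x. (f s x \<bullet> e - f t x \<bullet> e) / (s - t))"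
      using eventually_at_within_in
    proof eventually_elim
      case (elim s)
      then have "integrable ?M (\<lambda>x. f s x \<bullet> e)" "integrable ?M (\<lambda>x. f t x \<bullet> e)"
        using L2_inner[OF L2(1)] int1 t by blast+
      then show ?case by simp
    qed
  qed
  moreover have "uniform_limit B (\<lambda>s x. f s x \<bullet> e) (\<lambda>x. f t x \<bullet> e) (at t within I)"
    by (rule bounded_linear.uniform_limit[OF bounded_linear_inner_left uniform_limit_on_subset[OF u]]) auto
  moreover have "bounded ((\<lambda>x. f t x \<bullet> e) ` B)"
    using c[OF t] by (intro compact_imp_bounded compact_continuous_image B continuous_intros)
       (auto intro: continuous_on_subset)
  ultimately show ?thesis
    using cm unfolding L1_differentiable_def sp by blast
qed

text \<open>A sequence of difference quotients tends to \<open>g\<close> in \<open>L1\<close>, so a subsequence does so almost everywhere.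
  Everywhere it tends to the pointwise derivative \<open>D\<close>, hence \<open>g = D\<close> almost everywhere.  In this way the
  pointwise equations can be inserted under the integral.\<close>

lemma has_real_derivative_integral:
  assumes t: "t \<in> I" and lim: "t islimpt I" and M: "finite_measure M"
    and f: "L1_differentiable M I t f"
    and D: "\<And>x. x \<in> space M \<Longrightarrow> ((\<lambda>s. f s x) has_real_derivative D x) (at t within I)"
  shows "((\<lambda>s. LINT x|M. f s x) has_real_derivative (LINT x|M. D x)) (at t within I)"
proof -
  interpret finite_measure M by fact
  have fm: "\<And>s. s \<in> I \<Longrightarrow> f s \<in> borel_measurable M" and fb: "bounded (f t ` space M)"
    and fu: "uniform_limit (space M) f (f t) (at t within I)"
    using f by (auto simp: L1_differentiable_def)
  define q where "q s x = (f s x - f t x) / (s - t)" for s x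
  obtain g where g: "L1_tendsto M q g (at t within I)"
    using f unfolding L1_differentiable_def q_def[abs_def] by blast
  have gi: "integrable M g" and qi: "\<forall>\<^sub>F s in at t within I. integrable M (q s)"
    and ql: "((\<lambda>s. LINT x|M. \<bar>q s x - g x\<bar>) \<longlongrightarrow> 0) (at t within I)"
    using g by (auto simp: L1_tendsto_def)
  obtain S where S: "\<And>n. S n \<in> I - {t}" "S \<longlonglongrightarrow> t"
    using lim islimpt_sequential by blast
  have SF: "filterlim S (at t within I) sequentially"
    unfolding filterlim_at using S by auto
  have "\<forall>\<^sub>F n in sequentially. integrable M (q (S n))"
    using filterlim_iff[THEN iffD1, OF SF] qi by blast
  then obtain N where N: "\<And>n. n \<ge> N \<Longrightarrow> integrable M (q (S n))"
    by (auto simp: eventually_sequentially)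
  define v where "v n x = q (S (n + N)) x - g x" for n x
  have SN: "filterlim (\<lambda>n. S (n + N)) (at t within I) sequentially"
    using filterlim_compose[OF SF filterlim_add_const_nat_at_top] .
  have vi: "integrable M (v n)" for n unfolding v_def using N gi by simp
  have "(\<lambda>n. LINT x|M. norm (v n x)) \<longlonglongrightarrow> 0"
    using filterlim_compose[OF ql SN] by (simp add: v_def)
  then obtain r where r: "strict_mono r" "AE x in M. (\<lambda>n. v (r n) x) \<longlonglongrightarrow> 0"
    using tendsto_L1_AE_subseq[of M v, OF vi] by blast
  have qD: "(\<lambda>n. q (S (n + N)) x) \<longlonglongrightarrow> D x" if "x \<in> space M" for x
    using filterlim_compose[OF D[OF that, unfolded has_field_derivative_iff] SN] by (simp add: q_def)
  have qm: "q (S (n + N)) \<in> borel_measurable M" for n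
    using N by (intro borel_measurable_integrable) simp
  have Dm: "D \<in> borel_measurable M"
    by (rule borel_measurable_LIMSEQ_real[OF qD qm])
  have "AE x in M. D x = g x"
    using r(2)
  proof (rule AE_mp, intro AE_I2 impI)
    fix x assume x: "x \<in> space M" and v0: "(\<lambda>n. v (r n) x) \<longlonglongrightarrow> 0"
    have "(\<lambda>n. v n x) \<longlonglongrightarrow> D x - g x"
      unfolding v_def by (intro tendsto_intros qD x)
    then have "(\<lambda>n. v (r n) x) \<longlonglongrightarrow> D x - g x"
      using LIMSEQ_subseq_LIMSEQ[OF _ r(1)] by (force simp: o_def)
    with v0 show "D x = g x" using LIMSEQ_unique by fastforce
  qed
  then have "(LINT x|M. D x) = (LINT x|M. g x)"
    using Dm gi by (intro integral_cong_AE) auto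
  moreover have "((\<lambda>s. LINT x|M. q s x) \<longlongrightarrow> (LINT x|M. g x)) (at t within I)"
    by (rule L1_tendsto_integral[OF g])
  moreover have "\<forall>\<^sub>F s in at t within I. (LINT x|M. q s x) = ((LINT x|M. f s x) - (LINT x|M. f t x)) / (s - t)"
  proof -
    obtain C where C: "C > 0" "\<And>x. x \<in> space M \<Longrightarrow> \<bar>f t x\<bar> \<le> C"
      "\<forall>\<^sub>F s in at t within I. \<forall>x\<in>space M. \<bar>f s x\<bar> \<le> C"
      using uniform_limit_eventually_bounded[OF fu fb] by blast
    have fi: "integrable M (f s)" if "s \<in> I" "\<forall>x\<in>space M. \<bar>f s x\<bar> \<le> C" for s
      using that fm by (intro integrable_const_bound[of _ C]) (auto intro!: AE_I2)
    show ?thesis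
      using eventually_at_within_in C(3)
      by eventually_elim (use fi t C(2) in \<open>simp add: q_def\<close>)
  qed
  ultimately show ?thesis
    unfolding has_field_derivative_iff by (simp only:) (rule Lim_transform_eventually)
qed

section \<open>Radial velocity fields in a vacuum\<close>

lemma divergence_eq:
  "C_diff 1 w \<Longrightarrow> divergence w = (\<lambda>x. \<Sum>i\<in>UNIV. pd i w x $ i)"
  by (rule ext) (simp add: divergence_def pd_component)

lemma C_diff_divergence: "C_diff 2 w \<Longrightarrow> C_diff 1 (divergence w)"
proof -
  assume w: "C_diff 2 w"
  show ?thesis
    unfolding divergence_eq[OF C_diff_2_D(1)[OF w]]
    by (intro C_diff_sum C_diff_component C_diff_2_D(2)[OF w])
qed

text \<open>The difference quotient at 0 is \<open>N\<close> itself.  This computes derivatives of a radial field across an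
  axis, where the factor \<open>y\<close> comes from differentiating the radius, and of truncated powers at 0.\<close>

lemma DERIV_times_self_at_0:
  fixes N :: "real \<Rightarrow> real"
  assumes "isCont N 0"
  shows "((\<lambda>y. N y * y) has_real_derivative N 0) (at 0)"
proof -
  have "((\<lambda>y. (N y * y - N 0 * 0) / (y - 0)) \<longlongrightarrow> N 0) (at 0)"
    by (rule Lim_transform_eventually[OF assms[unfolded isCont_def]]) (auto simp: eventually_at_filter)
  then show ?thesis by (simp add: has_field_derivative_iff)
qed

lemma norm_real2: "norm (x :: real^2) = sqrt ((x $ 1)\<^sup>2 + (x $ 2)\<^sup>2)"
  by (simp add: norm_vec_def L2_set_def UNIV_2)

lemma pd_component_line:
  fixes f :: "real^'n::finite \<Rightarrow> real^'m::finite"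
  assumes "C_diff 1 f"
  shows "((\<lambda>s. f (x + s *\<^sub>R axis i 1) $ j) has_real_derivative pd i f (x + s *\<^sub>R axis i 1) $ j) (at s)"
proof -
  have "f differentiable (at (x + s *\<^sub>R axis i 1))" using assms by simp
  from bounded_linear.has_vector_derivative[OF bounded_linear_vec_nth pd_has_vector_derivative_line[OF this]]
  show ?thesis by (simp add: has_real_derivative_iff_has_vector_derivative)
qed

text \<open>All quantities are evaluated on the first coordinate axis.  With \<open>G(r) = v(r) / r\<close>, the divergence
  there is \<open>v' + G\<close>, and both \<open>(\<Delta> u)\<close> in the axial direction and the axial derivative of the
  divergence equal \<open>v'' + G'\<close>.  So the divergence is constant, and \<open>(r v)' = r (v' + G)\<close>.\<close>

lemma radial_vacuum_profile:
  fixes u :: "real^2 \<Rightarrow> real^2" and v :: "real \<Rightarrow> real"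
  assumes C2: "C_diff 2 u" and rad: "\<And>x. u x = v (norm x) *\<^sub>R (x /\<^sub>R norm x)"
    and R: "0 < R" and eq: "\<And>x. R < norm x \<Longrightarrow> laplacian u x $ 1 + pd 1 (divergence u) x = 0"
  obtains d b where "\<And>s. R < s \<Longrightarrow> s * v s = d * s\<^sup>2 + b"
proof -
  let ?e1 = "axis 1 1 :: real^2" and ?e2 = "axis 2 1 :: real^2"
  have u1: "C_diff 1 u" and p1: "C_diff 1 (pd i u)" for i using C_diff_2_D[OF C2] by auto
  define w where "w s = u (s *\<^sub>R ?e1) $ 1" for s
  define w1 where "w1 s = pd 1 u (s *\<^sub>R ?e1) $ 1" for s
  define w2 where "w2 s = pd 1 (pd 1 u) (s *\<^sub>R ?e1) $ 1" for s
  have dw: "(w has_real_derivative w1 s) (at s)" for s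
    using pd_component_line[OF u1, of 0 1 1 s] by (simp add: w_def[abs_def] w1_def)
  have dw1: "(w1 has_real_derivative w2 s) (at s)" for s
    using pd_component_line[OF p1[of 1], of 0 1 1 s] by (simp add: w1_def[abs_def] w2_def)
  have vw: "v s = w s" if "s > 0" for s
    using that by (simp add: w_def rad norm_scaleR) 
  have rad': "u x $ j = w (norm x) / norm x * x $ j" for x j
    by (cases "x = 0") (simp_all add: rad vw divide_inverse)
  define G where "G r = w r / r" for r
  define G' where "G' r = (w1 r * r - w r) / (r * r)" for r
  have dG: "(G has_real_derivative G' r) (at r)" if "r > 0" for r
    unfolding G_def[abs_def] G'_def using DERIV_divide[OF dw DERIV_ident, of r] that by simp
  have nrm: "norm (s *\<^sub>R ?e1 + y *\<^sub>R ?e2) = sqrt (s\<^sup>2 + y\<^sup>2)" for s y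
    by (simp add: norm_real2 axis_def)
  have sq_pos: "sqrt (s\<^sup>2 + y\<^sup>2) > 0" if "s > 0" for s y :: real
    using that by (simp add: add_pos_nonneg)
  have contG: "isCont G s" "isCont G' s" if "s > 0" for s
    using DERIV_isCont[OF dG[OF that]] that DERIV_isCont[OF dw] DERIV_isCont[OF dw1]
    by (auto simp: G'_def[abs_def] intro!: continuous_intros)
  have cont_sqrt: "isCont (\<lambda>y. F (sqrt (s\<^sup>2 + y\<^sup>2))) 0" if "isCont F s" "s > 0" for F :: "real \<Rightarrow> real" and s
    by (rule isCont_o2[of 0 "\<lambda>y. sqrt (s\<^sup>2 + y\<^sup>2)" F]) (use that in \<open>auto intro!: continuous_intros\<close>)
  have p22: "pd 2 u (s *\<^sub>R ?e1) $ 2 = G s" if s: "s > 0" for s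
  proof -
    have A: "((\<lambda>y. u (s *\<^sub>R ?e1 + y *\<^sub>R ?e2) $ 2) has_real_derivative pd 2 u (s *\<^sub>R ?e1) $ 2) (at 0)"
      using pd_component_line[OF u1, of "s *\<^sub>R ?e1" 2 2 0] by simp
    have B: "(\<lambda>y. u (s *\<^sub>R ?e1 + y *\<^sub>R ?e2) $ 2) = (\<lambda>y. G (sqrt (s\<^sup>2 + y\<^sup>2)) * y)"
      by (rule ext) (simp add: rad' nrm G_def, simp add: axis_def)
    have C: "((\<lambda>y. G (sqrt (s\<^sup>2 + y\<^sup>2)) * y) has_real_derivative G s) (at 0)"
      using DERIV_times_self_at_0[OF cont_sqrt[OF contG(1)[OF s] s]] s by simp
    show ?thesis by (rule DERIV_unique[OF A[unfolded B] C])
  qed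
  have p221: "pd 2 (pd 2 u) (s *\<^sub>R ?e1) $ 1 = G' s" if s: "s > 0" for s
  proof -
    have *: "pd 2 u (s *\<^sub>R ?e1 + y *\<^sub>R ?e2) $ 1 = s * G' (sqrt (s\<^sup>2 + y\<^sup>2)) / sqrt (s\<^sup>2 + y\<^sup>2) * y" for y
    proof -
      have A: "((\<lambda>y. u (s *\<^sub>R ?e1 + y *\<^sub>R ?e2) $ 1) has_real_derivative pd 2 u (s *\<^sub>R ?e1 + y *\<^sub>R ?e2) $ 1) (at y)"
        by (rule pd_component_line[OF u1])
      have B: "(\<lambda>y. u (s *\<^sub>R ?e1 + y *\<^sub>R ?e2) $ 1) = (\<lambda>y. G (sqrt (s\<^sup>2 + y\<^sup>2)) * s)"
        by (rule ext) (simp add: rad' nrm G_def, simp add: axis_def)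
      have C: "((\<lambda>y. G (sqrt (s\<^sup>2 + y\<^sup>2)) * s) has_real_derivative
          s * G' (sqrt (s\<^sup>2 + y\<^sup>2)) / sqrt (s\<^sup>2 + y\<^sup>2) * y) (at y)"
      proof -
        have "s\<^sup>2 + y\<^sup>2 > 0" using s by (simp add: add_pos_nonneg)
        then have "((\<lambda>y. sqrt (s\<^sup>2 + y\<^sup>2)) has_real_derivative y / sqrt (s\<^sup>2 + y\<^sup>2)) (at y)"
          by (auto intro!: derivative_eq_intros simp: field_simps)
        from DERIV_cmult_right[OF DERIV_chain2[OF dG[OF sq_pos[OF s]] this], of s]
        show ?thesis by (simp add: mult_ac)
      qed
      show ?thesis by (rule DERIV_unique[OF A[unfolded B] C])
    qed
    have "((\<lambda>y. pd 2 u (s *\<^sub>R ?e1 + y *\<^sub>R ?e2) $ 1) has_real_derivative pd 2 (pd 2 u) (s *\<^sub>R ?e1) $ 1) (at 0)"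
      using pd_component_line[OF p1[of 2], of "s *\<^sub>R ?e1" 2 1 0] by simp
    moreover have "((\<lambda>y. s * G' (sqrt (s\<^sup>2 + y\<^sup>2)) / sqrt (s\<^sup>2 + y\<^sup>2) * y) has_real_derivative G' s) (at 0)"
    proof -
      have "isCont (\<lambda>y. s * G' (sqrt (s\<^sup>2 + y\<^sup>2)) / sqrt (s\<^sup>2 + y\<^sup>2)) 0"
        using cont_sqrt[OF contG(2)[OF s] s] s by (intro continuous_intros) auto
      from DERIV_times_self_at_0[OF this] show ?thesis using s by simp
    qed
    ultimately show ?thesis unfolding * by (rule DERIV_unique)
  qed
  define Z where "Z s = divergence u (s *\<^sub>R ?e1)" for s
  have ZG: "Z s = w1 s + G s" if "s > 0" for s
    using p22[OF that] by (simp add: Z_def divergence_eq[OF u1] UNIV_2 w1_def)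
  have dZ: "(Z has_real_derivative w2 s + G' s) (at s)" if "s > 0" for s
    by (rule has_field_derivative_transform_within_open[OF DERIV_add[OF dw1 dG[OF that]], of "{0<..}"])
       (use that ZG in auto)
  have dZ': "(Z has_real_derivative pd 1 (divergence u) (s *\<^sub>R ?e1)) (at s)" for s
  proof -
    have "divergence u differentiable (at (0 + s *\<^sub>R ?e1))" using C_diff_divergence[OF C2] by simp
    from pd_has_vector_derivative_line[OF this] show ?thesis
      by (simp add: has_real_derivative_iff_has_vector_derivative Z_def[abs_def])
  qed
  have Z0: "(Z has_real_derivative 0) (at s)" if "s > R" for s
  proof -
    have "s > 0" using that R by simp
    have "laplacian u (s *\<^sub>R ?e1) $ 1 = w2 s + G' s"
      using p221[OF \<open>s > 0\<close>] by (simp add: laplacian_def UNIV_2 w2_def)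
    moreover have "pd 1 (divergence u) (s *\<^sub>R ?e1) = w2 s + G' s"
      using DERIV_unique[OF dZ' dZ[OF \<open>s > 0\<close>]] .
    ultimately have "w2 s + G' s = 0" using eq[of "s *\<^sub>R ?e1"] that \<open>s > 0\<close> by simp
    then show ?thesis using dZ[OF \<open>s > 0\<close>] by simp
  qed
  define s0 where "s0 = R + 1"
  have isconst: "F s = F s0" if F: "\<And>s. R < s \<Longrightarrow> (F has_real_derivative 0) (at s)" and s: "R < s" for F :: "real \<Rightarrow> real" and s
    using DERIV_isconst3[of R "max s s0 + 1" s s0 F] F s by (auto simp: s0_def)
  have "((\<lambda>s. s * w s - Z s0 / 2 * s\<^sup>2) has_real_derivative 0) (at s)" if "s > R" for s
  proof -
    have "s > 0" using that R by simp
    have "Z s0 = w1 s + G s" using isconst[OF Z0 that] ZG[OF \<open>s > 0\<close>] by simp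
    then have "w s + s * w1 s - Z s0 * s = 0" using \<open>s > 0\<close> by (simp add: G_def field_simps)
    moreover have "((\<lambda>s. s * w s - Z s0 / 2 * s\<^sup>2) has_real_derivative (w s + s * w1 s - Z s0 * s)) (at s)"
      by (auto intro!: derivative_eq_intros dw)
    ultimately show ?thesis by simp
  qed
  from isconst[OF this]
  have "s * w s - Z s0 / 2 * s\<^sup>2 = s0 * w s0 - Z s0 / 2 * s0\<^sup>2" if "R < s" for s using that by blast
  then have "s * v s = Z s0 / 2 * s\<^sup>2 + (s0 * w s0 - Z s0 / 2 * s0\<^sup>2)" if "R < s" for s
    using that R vw[of s] by (smt (verit))
  then show ?thesis using that by blast
qed

text \<open>On the square \<open>(2^n, 2^(n+1)) \<times> (0, 2^n)\<close> of area \<open>4^n\<close> the function \<open>|u|^2\<close> is, for large \<open>n\<close>, at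
  least a constant times \<open>4^(-n)\<close>, so each of these disjoint squares contributes at least the same positive amount.\<close>

lemma not_L2_inverse_norm:
  fixes u :: "real^2 \<Rightarrow> 'b::euclidean_space"
  assumes \<kappa>: "\<kappa> > 0" and lower: "\<And>x. S \<le> norm x \<Longrightarrow> \<kappa> \<le> norm x * norm (u x)"
  shows "\<not> L2 u"
proof
  assume "L2 u"
  then have i: "integrable lborel (\<lambda>x. (norm (u x))\<^sup>2)" by (simp add: L2_def)
  define B :: "nat \<Rightarrow> (real^2) set" where
    "B n = box (\<chi> i. if i = 1 then 2 ^ n else 0) (\<chi> i. if i = 1 then 2 ^ Suc n else 2 ^ n)" for n
  have memB: "x \<in> B n \<longleftrightarrow> 2 ^ n < x $ 1 \<and> x $ 1 < 2 ^ Suc n \<and> 0 < x $ 2 \<and> x $ 2 < 2 ^ n" for x n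
    by (auto simp: B_def mem_box_cart forall_2)
  have mB: "measure lborel (B n) = 4 ^ n" for n
  proof -
    let ?l = "(\<chi> i. if i = 1 then 2 ^ n else 0) :: real^2" and ?u = "(\<chi> i. if i = 1 then 2 ^ Suc n else 2 ^ n) :: real^2"
    have "measure lborel (box ?l ?u) = (\<Prod>b\<in>Basis. (?u - ?l) \<bullet> b)"
      by (rule measure_lborel_box) (auto simp: Basis_vec_def inner_axis)
    also have "\<dots> = 2 ^ n * 2 ^ n"
      by (simp add: Basis_vec_def UNIV_2 axis_eq_axis inner_axis)
    also have "\<dots> = (4::real) ^ n" by (simp add: power_mult_distrib[symmetric])
    finally show ?thesis by (simp add: B_def)
  qed
  have disj: "n = m" if "x \<in> B n" "x \<in> B m" for x n m
  proof (rule ccontr)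
    have *: False if "x \<in> B n" "x \<in> B m" "n < m" for n m
    proof -
      have "(2::real) ^ Suc n \<le> 2 ^ m" using that(3) by (intro power_increasing) auto
      then show False using that by (auto simp: memB)
    qed
    assume "n \<noteq> m" then show False using * that by (metis linorder_neqE_nat)
  qed
  obtain n0 where n0: "S \<le> 2 ^ n0"
    using real_arch_pow[of 2 S] by (auto intro: less_imp_le)
  have lowerB: "\<kappa>\<^sup>2 / 16 / 4 ^ n \<le> (norm (u x))\<^sup>2" if x: "x \<in> B n" and n: "n0 \<le> n" for x n
  proof -
    have "norm x \<le> \<bar>x $ 1\<bar> + \<bar>x $ 2\<bar>" using norm_le_l1_cart[of x] by (simp add: UNIV_2)
    also have "\<dots> \<le> 4 * 2 ^ n" using x by (auto simp: memB)
    finally have ub: "norm x \<le> 4 * 2 ^ n" .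
    have "S \<le> 2 ^ n" by (rule order_trans[OF n0 power_increasing[OF n]]) simp
    also have "\<dots> \<le> norm x" using x component_le_norm_cart[of x 1] by (auto simp: memB)
    finally have "\<kappa> \<le> norm x * norm (u x)" by (rule lower)
    also have "\<dots> \<le> (4 * 2 ^ n) * norm (u x)" by (intro mult_right_mono ub) auto
    finally have "\<kappa>\<^sup>2 \<le> ((4 * 2 ^ n) * norm (u x))\<^sup>2" using \<kappa> by (intro power_mono) auto
    also have "\<dots> = (16 * 4 ^ n) * (norm (u x))\<^sup>2"
      by (simp add: power_mult_distrib power2_eq_square power_mult_distrib[symmetric] flip: power_mult)
    finally show ?thesis by (simp add: pos_divide_le_eq mult_ac)
  qed
  have "real N * (\<kappa>\<^sup>2 / 16) \<le> (LINT x|lborel. (norm (u x))\<^sup>2)" for N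
  proof -
    let ?g = "\<lambda>x. \<Sum>n\<in>{n0..<n0 + N}. \<kappa>\<^sup>2 / 16 / 4 ^ n * indicator (B n) x"
    have ii: "integrable lborel (\<lambda>x. indicator (B n) x :: real)" for n
      unfolding B_def by (rule integrable_real_indicator) (auto simp: emeasure_lborel_box_eq)
    have "(LINT x|lborel. ?g x) = (\<Sum>n\<in>{n0..<n0 + N}. \<kappa>\<^sup>2 / 16 / 4 ^ n * measure lborel (B n))"
      using ii by (simp add: Bochner_Integration.integral_sum)
    also have "\<dots> = real N * (\<kappa>\<^sup>2 / 16)" by (simp add: mB)
    finally have "real N * (\<kappa>\<^sup>2 / 16) = (LINT x|lborel. ?g x)" ..
    also have "\<dots> \<le> (LINT x|lborel. (norm (u x))\<^sup>2)"
    proof (rule integral_mono[OF _ i])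
      show "integrable lborel ?g" by (intro Bochner_Integration.integrable_sum integrable_mult_right ii)
      fix x
      show "?g x \<le> (norm (u x))\<^sup>2"
      proof (cases "\<exists>m\<in>{n0..<n0 + N}. x \<in> B m")
        case True
        then obtain m where m: "m \<in> {n0..<n0 + N}" "x \<in> B m" by blast
        have "?g x = (\<Sum>n\<in>{n0..<n0 + N}. if n = m then \<kappa>\<^sup>2 / 16 / 4 ^ n else 0)"
          by (rule sum.cong) (use disj m(2) in \<open>auto simp: indicator_def\<close>)
        also have "\<dots> = \<kappa>\<^sup>2 / 16 / 4 ^ m" using m(1) by simp
        also have "\<dots> \<le> (norm (u x))\<^sup>2" using lowerB m by simp
        finally show ?thesis .
      next
        case False
        then have "?g x = 0" by (intro sum.neutral) (auto simp: indicator_def)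
        then show ?thesis by simp
      qed
    qed
    finally show ?thesis .
  qed
  moreover obtain N where N: "(LINT x|lborel. (norm (u x))\<^sup>2) / (\<kappa>\<^sup>2 / 16) < real N"
    using reals_Archimedean2 by blast
  moreover have "0 < \<kappa>\<^sup>2 / 16" using \<kappa> by simp
  from N[unfolded pos_divide_less_eq[OF this]]
  have "(LINT x|lborel. (norm (u x))\<^sup>2) < real N * (\<kappa>\<^sup>2 / 16)" .
  ultimately show False using not_le by blast
qed

lemma radial_vacuum_velocity_eq_0:
  fixes u :: "real^2 \<Rightarrow> real^2" and v :: "real \<Rightarrow> real"
  assumes C2: "C_diff 2 u" and rad: "\<And>x. u x = v (norm x) *\<^sub>R (x /\<^sub>R norm x)" and L2: "L2 u"
    and R: "0 < R" and eq: "\<And>x. R < norm x \<Longrightarrow> laplacian u x $ 1 + pd 1 (divergence u) x = 0"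
    and x: "R < norm x"
  shows "u x = 0"
proof -
  obtain d b where db: "\<And>s. R < s \<Longrightarrow> s * v s = d * s\<^sup>2 + b"
    using radial_vacuum_profile[OF C2 rad R eq] by blast
  have nu: "norm x * norm (u x) = \<bar>d * (norm x)\<^sup>2 + b\<bar>" if "R < norm x" for x
  proof -
    have "x \<noteq> 0" using that R by auto
    then have "norm (u x) = \<bar>v (norm x)\<bar>" using that R by (simp add: rad abs_mult)
    then have "norm x * norm (u x) = \<bar>norm x * v (norm x)\<bar>" by (simp add: abs_mult)
    then show ?thesis using db[OF that] by simp
  qed
  have "d = 0 \<and> b = 0"
  proof (rule ccontr)
    assume nz: "\<not> (d = 0 \<and> b = 0)"
    have "\<exists>\<kappa> S. 0 < \<kappa> \<and> (\<forall>s. S \<le> s \<longrightarrow> \<kappa> \<le> \<bar>d * s\<^sup>2 + b\<bar>)"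
    proof (cases "d = 0")
      case True
      then show ?thesis using nz by (intro exI[of _ "\<bar>b\<bar>"]) auto
    next
      case False
      define S where "S = max 1 ((1 + \<bar>b\<bar>) / \<bar>d\<bar>)"
      have "1 \<le> \<bar>d * s\<^sup>2 + b\<bar>" if s: "S \<le> s" for s
      proof -
        have s1: "1 \<le> s" "(1 + \<bar>b\<bar>) / \<bar>d\<bar> \<le> s" using s by (auto simp: S_def)
        have "s * 1 \<le> s * s" using s1 by (intro mult_left_mono) auto
        then have "s \<le> s\<^sup>2" by (simp add: power2_eq_square)
        from order_trans[OF s1(2) this] have "(1 + \<bar>b\<bar>) / \<bar>d\<bar> \<le> s\<^sup>2" .
        then have "1 + \<bar>b\<bar> \<le> \<bar>d * s\<^sup>2\<bar>" using False by (simp add: pos_divide_le_eq abs_mult mult.commute)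
        then show ?thesis by linarith
      qed
      then show ?thesis by (intro exI[of _ 1] exI[of _ S]) auto
    qed
    then obtain \<kappa> S where \<kappa>: "0 < \<kappa>" "\<And>s. S \<le> s \<Longrightarrow> \<kappa> \<le> \<bar>d * s\<^sup>2 + b\<bar>" by blast
    have "\<kappa> \<le> norm x * norm (u x)" if "max S (R + 1) \<le> norm x" for x
      using nu[of x] \<kappa>(2)[of "norm x"] that by auto
    from not_L2_inverse_norm[OF \<kappa>(1) this] L2 show False by blast
  qed
  moreover have "x \<noteq> 0" using x R by auto
  ultimately show ?thesis using nu[OF x] by simp
qed

section \<open>Moments and truncated powers\<close>

lemma integral_by_parts_pd_real:
  fixes f g :: "real^'n::finite \<Rightarrow> real"
  assumes f: "C_diff 1 f" and g: "C_diff 1 g" and K: "vanishes_off_compact f \<or> vanishes_off_compact g"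
  shows "integrable lborel (\<lambda>x. f x * pd i g x)" and "integrable lborel (\<lambda>x. pd i f x * g x)"
    and "(LINT x|lborel. f x * pd i g x) = - (LINT x|lborel. pd i f x * g x)"
proof -
  have c: "continuous_on UNIV f" "continuous_on UNIV g" "continuous_on UNIV (pd i f)" "continuous_on UNIV (pd i g)"
    using f g C_diff_continuous[OF f] C_diff_continuous[OF g] by auto
  have v: "vanishes_off_compact (\<lambda>x. f x * pd i g x)" "vanishes_off_compact (\<lambda>x. pd i f x * g x)"
    using K vanishes_off_compact_scaleR[of f "pd i g"] vanishes_off_compact_scaleR[OF vanishes_off_compact_pd, of f i g]
      vanishes_off_compact_scaleR[of g "pd i f"] vanishes_off_compact_scaleR[OF vanishes_off_compact_pd, of g i f]
    by (auto simp: mult.commute)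
  show "integrable lborel (\<lambda>x. f x * pd i g x)" "integrable lborel (\<lambda>x. pd i f x * g x)"
    using c by (auto intro!: integrable_if_vanishes_off_compact v continuous_intros)
  show "(LINT x|lborel. f x * pd i g x) = - (LINT x|lborel. pd i f x * g x)"
    using K integral_by_parts_pd[OF f g, of i] integral_by_parts_pd[OF g f, of i]
    by (auto simp: mult.commute)
qed

text \<open>The virial identities reduce to this moment formula for each term of the momentum equation.\<close>

lemma integral_nth_mult_pd:
  fixes f :: "real^'n::finite \<Rightarrow> real"
  assumes f: "C_diff 1 f" and K: "vanishes_off_compact f"
  shows "integrable lborel (\<lambda>x. x $ j * pd i f x)"
    and "(LINT x|lborel. x $ j * pd i f x) = - (if i = j then LINT x|lborel. f x else 0)"
  using integral_by_parts_pd_real[OF C_diff_nth[of 1 j] f disjI2[OF K], of i] by (simp_all add: pd_nth)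

lemma vanishes_off_compact_component:
  fixes F :: "'a::topological_space \<Rightarrow> real^'n::finite"
  shows "vanishes_off_compact F \<Longrightarrow> vanishes_off_compact (\<lambda>x. F x $ i)"
  unfolding vanishes_off_compact_def by (erule ex_forward) simp

lemma integral_mult_divergence:
  assumes F: "C_diff 1 F" and W: "C_diff 1 W" and K: "vanishes_off_compact W \<or> vanishes_off_compact F"
  shows "(LINT x|lborel. W x * divergence F x) = - (LINT x|lborel. (\<Sum>i\<in>UNIV. pd i W x * F x $ i))"
proof -
  note ibp = integral_by_parts_pd_real[OF W C_diff_component[OF F]]
  have K': "vanishes_off_compact W \<or> vanishes_off_compact (\<lambda>x. F x $ i)" for i
    using K vanishes_off_compact_component by blast
  have eq: "W x * divergence F x = (\<Sum>i\<in>UNIV. W x * pd i (\<lambda>y. F y $ i) x)" for x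
    by (simp add: divergence_def sum_distrib_left)
  show ?thesis
    unfolding eq by (simp add: Bochner_Integration.integral_sum ibp[OF K'] sum_negf)
qed

lemma C_diff_sq_dist: "C_diff m (\<lambda>x::real^'n::finite. (norm (x - a))\<^sup>2)"
proof -
  have "(\<lambda>x::real^'n. (norm (x - a))\<^sup>2) = (\<lambda>x. \<Sum>i\<in>UNIV. (x $ i - a $ i) * (x $ i - a $ i))"
    by (rule ext) (simp add: power2_norm_eq_inner inner_vec_def)
  then show ?thesis
    by (simp only:) (intro C_diff_sum C_diff_mult C_diff_diff C_diff_nth C_diff_const)
qed

lemma pd_sq_dist: "pd i (\<lambda>x. (norm (x - a))\<^sup>2) x = 2 * (x $ i - a $ i)"
proof -
  have "((\<lambda>x. (x - a) \<bullet> (x - a)) has_derivative (\<lambda>h. (x - a) \<bullet> h + h \<bullet> (x - a))) (at x)"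
    by (auto intro!: derivative_eq_intros)
  from pd_eq[OF this, of i] show ?thesis
    by (simp add: power2_norm_eq_inner inner_axis inner_axis' inner_commute)
qed

text \<open>On densities, which are nonnegative, this is the power itself.  The truncation makes it continuously
  differentiable on the whole line for \<open>p > 1\<close>.\<close>

definition pos_powr :: "real \<Rightarrow> real \<Rightarrow> real" where "pos_powr p y = max 0 y powr p"

lemma pos_powr_nonneg [simp]: "0 \<le> pos_powr p y" and pos_powr_nonpos [simp]: "y \<le> 0 \<Longrightarrow> pos_powr p y = 0"
  by (simp_all add: pos_powr_def)

lemma pos_powr_eq: "0 \<le> y \<Longrightarrow> pos_powr p y = y powr p"
  by (simp add: pos_powr_def)

lemma continuous_on_pos_powr: "0 < p \<Longrightarrow> continuous_on UNIV (pos_powr p)"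
  unfolding pos_powr_def[abs_def] by (intro continuous_on_powr' continuous_intros) auto

lemma DERIV_pos_powr:
  assumes p: "1 < p"
  shows "(pos_powr p has_real_derivative p * pos_powr (p - 1) y) (at y)"
proof (cases y "0::real" rule: linorder_cases)
  case less
  have "((\<lambda>_. 0) has_real_derivative 0) (at y)" by simp
  then have "(pos_powr p has_real_derivative 0) (at y)"
    by (rule has_field_derivative_transform_within_open[of _ _ _ "{..<0}"]) (use less in auto)
  then show ?thesis using less by simp
next
  case greater
  then have "((\<lambda>y. y powr p) has_real_derivative p * y powr (p - 1)) (at y)"
    using has_real_derivative_powr by simp
  then have "(pos_powr p has_real_derivative p * y powr (p - 1)) (at y)"
    by (rule has_field_derivative_transform_within_open[of _ _ _ "{0<..}"])
       (use greater in \<open>auto simp: pos_powr_eq\<close>)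
  then show ?thesis using greater by (simp add: pos_powr_eq)
next
  case equal
  have "isCont (pos_powr (p - 1)) 0"
    using continuous_on_pos_powr[of "p - 1"] p by (simp add: continuous_on_eq_continuous_at)
  from DERIV_times_self_at_0[OF this]
  have "((\<lambda>y. pos_powr (p - 1) y * y) has_real_derivative 0) (at 0)" by simp
  moreover have "pos_powr (p - 1) y * y = pos_powr p y" for y
    using powr_mult_base[of y "p - 1"] by (cases "0 < y") (simp_all add: pos_powr_eq mult.commute)
  ultimately show ?thesis using equal by simp
qed

section \<open>Propagation of the vacuum\<close>

lemma nonincreasing_if_derivative_within_nonpos:
  fixes E :: "real \<Rightarrow> real"
  assumes "0 \<le> t1" "t1 \<le> t2"
    and D: "\<And>s. t1 \<le> s \<Longrightarrow> s \<le> t2 \<Longrightarrow> (E has_real_derivative E' s) (at s within {0..})"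
    and neg: "\<And>s. t1 \<le> s \<Longrightarrow> s \<le> t2 \<Longrightarrow> E' s \<le> 0"
  shows "E t2 \<le> E t1"
proof (rule DERIV_nonpos_imp_decreasing_open[OF assms(2)])
  fix s assume s: "t1 < s" "s < t2"
  then have "at s within {0..} = at s"
    using assms(1) by (intro at_within_interior) (simp add: interior_real_atLeast)
  then show "\<exists>y. DERIV E s :> y \<and> y \<le> 0" using D[of s] neg[of s] s by auto
next
  have "continuous (at s within {t1..t2}) E" if "s \<in> {t1..t2}" for s
    using DERIV_continuous[OF DERIV_subset[OF D]] that assms(1) by auto
  then show "continuous_on {t1..t2} E" by (simp add: continuous_on_eq_continuous_within)
qed

text \<open>The set where \<open>f\<close> does not vanish is an open null set.\<close>

lemma eq_0_if_integral_le_0: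
  fixes f :: "'a::euclidean_space \<Rightarrow> real"
  assumes c: "continuous_on UNIV f" and i: "integrable lborel f" and pos: "\<And>x. 0 \<le> f x"
    and le: "(LINT x|lborel. f x) \<le> 0"
  shows "f x = 0"
proof (rule ccontr)
  assume "f x \<noteq> 0"
  have "0 \<le> (LINT x|lborel. f x)" by (rule Bochner_Integration.integral_nonneg) (rule pos)
  with le have "(LINT x|lborel. f x) = 0" by (rule order_antisym)
  then have "AE x in lborel. f x = 0"
    using integral_nonneg_eq_0_iff_AE[OF i] pos by simp
  moreover have o: "open {x. f x \<noteq> 0}"
    by (rule open_Collect_neq[OF c continuous_on_const])
  ultimately have "{x. f x \<noteq> 0} \<in> null_sets lborel"
    using AE_iff_null[of lborel "\<lambda>x. f x = 0"] by simp
  then have "negligible {x. f x \<noteq> 0}"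
    by (simp add: negligible_iff_null_sets null_sets_completionI)
  then show False using open_not_negligible[OF o] \<open>f x \<noteq> 0\<close> by blast
qed

lemma islimpt_atLeast_0: "0 \<le> t \<Longrightarrow> (t::real) islimpt {0..}"
  using islimpt_Icc[of 0 "t + 1"] islimpt_subset[of t "{0..t + 1}" "{0..}"] by auto

text \<open>The consequences of the equations and of the regularity assumptions on which the argument rests,
  for a solution on the time interval \<open>[0, \<infinity>)\<close> whose density vanishes outside the ball of radius
  \<open>R0\<close> at time 0.\<close>

locale global_radial_flow =
  fixes \<mu> A c \<beta> \<gamma> :: real and \<rho> :: "real \<Rightarrow> real^2 \<Rightarrow> real" and u :: "real \<Rightarrow> real^2 \<Rightarrow> real^2" and R0 :: real
  assumes constants: "0 < \<mu>" "0 < A" "0 < c" "1 < \<beta>" "1 < \<gamma>"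
    and C2_rho: "\<And>t. 0 \<le> t \<Longrightarrow> C_diff 2 (\<rho> t)" and C2_u: "\<And>t. 0 \<le> t \<Longrightarrow> C_diff 2 (u t)"
    and rho_nonneg: "\<And>t x. 0 \<le> t \<Longrightarrow> 0 \<le> \<rho> t x"
    and continuity: "\<And>t x. 0 \<le> t \<Longrightarrow>
      ((\<lambda>s. \<rho> s x) has_real_derivative - divergence (\<lambda>y. \<rho> t y *\<^sub>R u t y) x) (at t within {0..})"
    and momentum: "\<And>t x. 0 \<le> t \<Longrightarrow>
      ((\<lambda>s. \<rho> s x *\<^sub>R u s x) has_vector_derivative
        (\<mu> *\<^sub>R laplacian (u t) x + grad (\<lambda>y. (\<mu> + c * \<rho> t y powr \<beta>) * divergence (u t) y) x
          - div_matrix (\<lambda>y. \<rho> t y *\<^sub>R tensor (u t y) (u t y)) x - grad (\<lambda>y. A * \<rho> t y powr \<gamma>) x))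
        (at t within {0..})"
    and radial: "\<And>t. 0 \<le> t \<Longrightarrow> \<exists>v. \<forall>x. u t x = v (norm x) *\<^sub>R (x /\<^sub>R norm x)"
    and L2_u: "\<And>t. 0 \<le> t \<Longrightarrow> L2 (u t)"
    and L1_rho: "\<And>t B. 0 \<le> t \<Longrightarrow> compact B \<Longrightarrow> L1_differentiable (restrict_space lborel B) {0..} t \<rho>"
    and L1_u: "\<And>t B i. 0 \<le> t \<Longrightarrow> compact B \<Longrightarrow> L1_differentiable (restrict_space lborel B) {0..} t (\<lambda>s x. u s x $ i)"
    and u_uniform: "\<And>t. 0 \<le> t \<Longrightarrow> uniform_limit UNIV u (u t) (at t within {0..})"
    and R0: "0 < R0" and rho_0: "\<And>x. R0 < norm x \<Longrightarrow> \<rho> 0 x = 0"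
begin

lemma C1_rho: "0 \<le> t \<Longrightarrow> C_diff 1 (\<rho> t)" and C1_u: "0 \<le> t \<Longrightarrow> C_diff 1 (u t)"
  using C_diff_2_D(1) C2_rho C2_u by blast+

lemma C1_rho_u: "0 \<le> t \<Longrightarrow> C_diff 1 (\<lambda>y. \<rho> t y *\<^sub>R u t y)"
  by (intro C_diff_scaleR C1_rho C1_u)

text \<open>In the vacuum the difference quotient of \<open>\<rho> u\<close> in time is that of \<open>\<rho>\<close>, which tends to 0 by the
  continuity equation, times a velocity that converges.  So the time derivative in the momentum equation
  vanishes there, and what remains of the equation is the one for a radial field in a vacuum.\<close>

lemma velocity_eq_0_in_vacuum:
  assumes t: "0 \<le> t" and R: "0 < R" and vac: "\<And>x. R < norm x \<Longrightarrow> \<rho> t x = 0" and x: "R < norm x"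
  shows "u t x = 0"
proof -
  obtain v where v: "\<And>x. u t x = v (norm x) *\<^sub>R (x /\<^sub>R norm x)" using radial[OF t] by blast
  let ?S = "{y :: real^2. R < norm y}"
  have S: "open ?S" by (intro open_Collect_less continuous_intros)
  have eq: "laplacian (u t) y $ 1 + pd 1 (divergence (u t)) y = 0" if y: "R < norm y" for y
  proof -
    have yS: "y \<in> ?S" using y by simp
    have "divergence (\<lambda>y. \<rho> t y *\<^sub>R u t y) y = 0"
      unfolding divergence_def
      by (intro sum.neutral ballI pd_eq_0_open[OF S yS, of _ 0]) (auto simp: vac)
    then have "((\<lambda>s. (\<rho> s y - \<rho> t y) / (s - t)) \<longlongrightarrow> 0) (at t within {0..})"
      using continuity[OF t, of y] by (simp add: has_field_derivative_iff)
    moreover have "((\<lambda>s. u s y) \<longlongrightarrow> u t y) (at t within {0..})"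
      using tendsto_uniform_limitI[OF u_uniform[OF t]] by simp
    ultimately have "((\<lambda>s. ((\<rho> s y - \<rho> t y) / (s - t)) *\<^sub>R u s y) \<longlongrightarrow> 0 *\<^sub>R u t y) (at t within {0..})"
      by (rule tendsto_scaleR)
    then have "((\<lambda>s. (\<rho> s y *\<^sub>R u s y - \<rho> t y *\<^sub>R u t y) /\<^sub>R (s - t)) \<longlongrightarrow> 0) (at t within {0..})"
      by (simp add: vac[OF y] divide_inverse mult.commute)
    then have d0: "((\<lambda>s. \<rho> s y *\<^sub>R u s y) has_vector_derivative 0) (at t within {0..})"
      by (simp add: has_vector_derivative_iff_quotient)
    have "at t within {0..} \<noteq> bot"
      using islimpt_atLeast_0[OF t] by (simp add: trivial_limit_within)
    then have "\<mu> *\<^sub>R laplacian (u t) y + grad (\<lambda>y. (\<mu> + c * \<rho> t y powr \<beta>) * divergence (u t) y) y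
          - div_matrix (\<lambda>y. \<rho> t y *\<^sub>R tensor (u t y) (u t y)) y - grad (\<lambda>y. A * \<rho> t y powr \<gamma>) y = 0" (is "?rhs = 0")
      using vector_derivative_unique_within[OF _ momentum[OF t, of y] d0] by blast
    then have "?rhs $ 1 = 0" by simp
    moreover have "div_matrix (\<lambda>y. \<rho> t y *\<^sub>R tensor (u t y) (u t y)) y $ 1 = 0"
      unfolding div_matrix_def vec_lambda_beta
      by (intro sum.neutral ballI pd_eq_0_open[OF S yS, of _ 0]) (auto simp: vac)
    moreover have "grad (\<lambda>y. A * \<rho> t y powr \<gamma>) y $ 1 = 0"
      unfolding grad_def vec_lambda_beta by (rule pd_eq_0_open[OF S yS, of _ 0]) (auto simp: vac)
    moreover have "grad (\<lambda>y. (\<mu> + c * \<rho> t y powr \<beta>) * divergence (u t) y) y $ 1 = \<mu> * pd 1 (divergence (u t)) y"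
    proof -
      have "pd 1 (\<lambda>y. (\<mu> + c * \<rho> t y powr \<beta>) * divergence (u t) y) y = pd 1 (\<lambda>y. \<mu> * divergence (u t) y) y"
        by (rule pd_cong_open[OF S yS]) (auto simp: vac)
      also have "\<dots> = \<mu> * pd 1 (divergence (u t)) y"
        using C_diff_divergence[OF C2_u[OF t]] by (intro pd_bounded_linear bounded_linear_mult_right) simp
      finally show ?thesis by (simp add: grad_def)
    qed
    ultimately have "\<mu> * (laplacian (u t) y $ 1 + pd 1 (divergence (u t)) y) = 0" by (simp add: distrib_left)
    then show ?thesis using constants by simp
  qed
  show ?thesis
    by (rule radial_vacuum_velocity_eq_0[OF C2_u[OF t] v L2_u[OF t] R eq x])
qed

text \<open>Follow the mass in a ball around \<open>x0\<close> whose radius shrinks at speed \<open>\<epsilon>\<close>.  The weight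
  \<open>W = max(0, b(s)^2 - |x - x0|^2)^2\<close> is a continuously differentiable substitute for the indicator of the ball of radius
  \<open>b(s)\<close>, and it satisfies \<open>\<partial>W/\<partial>s + u \<bullet> \<nabla>W \<le> 0\<close> because \<open>|u| \<le> \<epsilon>\<close>.  The weighted mass is
  therefore nonincreasing, and it starts from 0.\<close>

lemma finite_speed_of_vacuum_front:
  assumes t: "0 \<le> t1" "t1 \<le> t2" and \<epsilon>: "0 < \<epsilon>"
    and slow: "\<And>s x. t1 \<le> s \<Longrightarrow> s \<le> t2 \<Longrightarrow> R < norm x \<Longrightarrow> norm (u s x) \<le> \<epsilon>"
    and vac: "\<And>x. R < norm x \<Longrightarrow> \<rho> t1 x = 0"
    and x0: "R + \<epsilon> * (t2 - t1) < norm x0"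
  shows "\<rho> t2 x0 = 0"
proof -
  \<comment> \<open>Half of the distance by which \<open>x0\<close> lies beyond the front is the radius of the ball at time \<open>t2\<close>.\<close>
  define \<eta> where "\<eta> = (norm x0 - R - \<epsilon> * (t2 - t1)) / 2"
  have \<eta>: "\<eta> > 0" using x0 by (simp add: \<eta>_def)
  define b where "b s = \<epsilon> * (t2 - s) + \<eta>" for s
  have b_pos: "b s > 0" if "s \<le> t2" for s using that \<epsilon> \<eta> by (auto simp: b_def intro: add_nonneg_pos)
  have b_mono: "b s \<le> b t1" if "t1 \<le> s" for s using that \<epsilon> by (simp add: b_def)
  define B where "B = cball x0 (b t1)"
  have B: "compact B" by (simp add: B_def)
  have B_out: "R < norm x" if "x \<in> B" for x
  proof -
    have "norm x0 \<le> norm x + norm (x0 - x)" by (metis add.commute norm_triangle_sub)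
    also have "norm (x0 - x) \<le> b t1" using that by (simp add: B_def dist_norm)
    finally have "norm x0 \<le> norm x + (\<epsilon> * (t2 - t1) + \<eta>)" by (simp add: b_def)
    moreover have "norm x0 = R + \<epsilon> * (t2 - t1) + 2 * \<eta>" by (simp add: \<eta>_def field_simps)
    ultimately show ?thesis using \<eta> by linarith
  qed
  let ?M = "restrict_space lborel B"
  define a where "a s x = (b s)\<^sup>2 - (norm (x - x0))\<^sup>2" for s x
  define W where "W s x = pos_powr 2 (a s x)" for s x
  define W' where "W' s x = 2 * pos_powr 1 (a s x)" for s x
  have out: "a s x \<le> 0" if "x \<notin> B" "t1 \<le> s" "s \<le> t2" for s x
  proof -
    have "b s \<le> norm (x - x0)" using that b_mono[of s] by (simp add: B_def dist_norm norm_minus_commute)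
    then have "(b s)\<^sup>2 \<le> (norm (x - x0))\<^sup>2" using b_pos[of s] that by (intro power_mono) auto
    then show ?thesis by (simp add: a_def)
  qed
  have out_W: "W s x = 0" "W' s x = 0" if "x \<notin> B" "t1 \<le> s" "s \<le> t2" for s x
    using out[OF that] by (simp_all add: W_def W'_def)
  have C1_a: "C_diff 1 (a s)" for s
    unfolding a_def[abs_def] by (intro C_diff_diff C_diff_const C_diff_sq_dist)
  have C1_W: "C_diff 1 (W s)" for s
    unfolding W_def[abs_def]
    by (rule C_diff_1_compose_real[OF C1_a DERIV_pos_powr]) (auto intro!: continuous_intros continuous_on_pos_powr)
  have pd_W: "pd i (W s) x = W' s x * (- 2 * (x $ i - x0 $ i))" for i s x
  proof -
    have da: "a s differentiable (at x)" using C1_a[of s] by simp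
    have "pd i (a s) x = 0 - pd i (\<lambda>x. (norm (x - x0))\<^sup>2) x"
      unfolding a_def[abs_def] using C_diff_sq_dist[of 1 x0] by (subst pd_diff) simp_all
    then have "pd i (a s) x = - 2 * (x $ i - x0 $ i)" by (simp add: pd_sq_dist)
    then show ?thesis
      unfolding W_def[abs_def] W'_def using pd_compose_real(1)[OF da DERIV_pos_powr[of 2]] by simp
  qed
  define D where "D s x = - divergence (\<lambda>y. \<rho> s y *\<^sub>R u s y) x * W s x + W' s x * (2 * b s * - \<epsilon>) * \<rho> s x" for s x
  define E where "E s = (LINT x|?M. \<rho> s x * W s x)" for s
  have db: "((\<lambda>s. (b s)\<^sup>2) has_real_derivative 2 * b s * - \<epsilon>) (at s within {0..})" for s
    unfolding b_def by (auto intro!: derivative_eq_intros)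
  have dE: "(E has_real_derivative (LINT x|?M. D s x)) (at s within {0..})" if s: "t1 \<le> s" "s \<le> t2" for s
    unfolding E_def[abs_def]
  proof (rule has_real_derivative_integral[OF _ islimpt_atLeast_0 finite_measure_restrict_lborel[OF B]])
    have s0: "0 \<le> s" using s t by simp
    then show "s \<in> {0..}" "0 \<le> s" by simp_all
    have "L1_differentiable ?M {0..} s (\<lambda>s x. (b s)\<^sup>2 + (- (norm (x - x0))\<^sup>2))"
    proof (rule L1_differentiable_add[OF L1_differentiable_real_function L1_differentiable_const])
      have c: "continuous_on UNIV (\<lambda>x. - (norm (x - x0))\<^sup>2)" by (intro continuous_intros)
      show "(\<lambda>x. - (norm (x - x0))\<^sup>2) \<in> borel_measurable ?M"
        using borel_measurable_continuous_onI[OF c] by (intro measurable_restrict_space1) simp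
      show "bounded ((\<lambda>x. - (norm (x - x0))\<^sup>2) ` space ?M)"
        using compact_imp_bounded[OF compact_continuous_image[OF continuous_on_subset[OF c] B]]
        by (simp add: space_restrict_space)
    qed (use s0 db finite_measure_restrict_lborel[OF B] in auto)
    then have La: "L1_differentiable ?M {0..} s a" by (simp add: a_def[abs_def])
    have "L1_differentiable ?M {0..} s W"
      unfolding W_def[abs_def]
      by (rule L1_differentiable_compose[OF _ La DERIV_pos_powr])
         (use s0 in \<open>auto intro!: continuous_intros continuous_on_pos_powr\<close>)
    then show "L1_differentiable ?M {0..} s (\<lambda>s x. \<rho> s x * W s x)"
      by (intro L1_differentiable_mult L1_rho B) (use s0 in auto)
    show "((\<lambda>s. \<rho> s x * W s x) has_real_derivative D s x) (at s within {0..})" for x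
    proof -
      have "((\<lambda>s. a s x) has_real_derivative 2 * b s * - \<epsilon>) (at s within {0..})"
        unfolding a_def using DERIV_diff[OF db DERIV_const] by simp
      from DERIV_mult[OF continuity[OF s0] DERIV_chain2[OF DERIV_pos_powr[of 2] this]]
      show ?thesis unfolding D_def W_def W'_def by simp
    qed
  qed
  have neg: "(LINT x|?M. D s x) \<le> 0" if s: "t1 \<le> s" "s \<le> t2" for s
  proof -
    have s0: "0 \<le> s" using s t by simp
    have K: "vanishes_off_compact (W s)"
      unfolding vanishes_off_compact_def using B out_W s by blast
    let ?F = "\<lambda>y. \<rho> s y *\<^sub>R u s y"
    let ?T = "\<lambda>x. W' s x * (2 * b s * - \<epsilon>) * \<rho> s x"
    let ?V = "\<lambda>x. \<Sum>i\<in>UNIV. pd i (W s) x * ?F x $ i"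
    have c: "continuous_on UNIV (\<rho> s)" "continuous_on UNIV (u s)" "continuous_on UNIV (W s)" "continuous_on UNIV (a s)"
      using C_diff_continuous C1_rho[OF s0] C1_u[OF s0] C1_W C1_a by blast+
    have cd: "continuous_on UNIV (divergence ?F)"
      unfolding divergence_eq[OF C1_rho_u[OF s0]] using C1_rho_u[OF s0] by (auto intro!: continuous_intros)
    have cW': "continuous_on UNIV (W' s)"
      unfolding W'_def[abs_def]
      by (intro continuous_intros continuous_on_compose2[OF continuous_on_pos_powr c(4)]) auto
    have KW': "vanishes_off_compact (\<lambda>x. W' s x *\<^sub>R g x)" for g :: "real^2 \<Rightarrow> real"
      unfolding vanishes_off_compact_def using B out_W s by force
    have iT: "integrable lborel ?T"
      using c cW' KW'[of "\<lambda>x. (2 * b s * - \<epsilon>) * \<rho> s x"]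
      by (intro integrable_if_vanishes_off_compact continuous_intros) (auto simp: mult.assoc)
    have iV: "integrable lborel ?V"
      using c cW' KW'[of "\<lambda>x. \<Sum>i\<in>UNIV. (- 2 * (x $ i - x0 $ i)) * ?F x $ i"]
      unfolding pd_W by (intro integrable_if_vanishes_off_compact continuous_intros) (auto simp: mult.assoc sum_distrib_left)
    have iW: "integrable lborel (\<lambda>x. W s x * divergence ?F x)"
      using c cd vanishes_off_compact_scaleR[OF K, of "divergence ?F"]
      by (intro integrable_if_vanishes_off_compact continuous_intros) auto
    have "(LINT x|?M. D s x) = (LINT x|lborel. D s x)"
      by (rule integral_restrict_lborel[OF B]) (use out_W s in \<open>simp add: D_def\<close>)
    also have "\<dots> = - (LINT x|lborel. W s x * divergence ?F x) + (LINT x|lborel. ?T x)"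
      unfolding D_def using iW iT by (simp add: mult.commute)
    also have "\<dots> = (LINT x|lborel. ?V x + ?T x)"
      using integral_mult_divergence[OF C1_rho_u[OF s0] C1_W disjI1[OF K]] iV iT by simp
    also have "\<dots> \<le> (LINT x|(lborel :: (real^2) measure). 0)"
    proof (rule integral_mono)
      show "integrable lborel (\<lambda>x. ?V x + ?T x)" using iV iT by simp
      fix x
      have eq: "?V x + ?T x = - 2 * W' s x * \<rho> s x * ((x - x0) \<bullet> u s x + b s * \<epsilon>)"
        unfolding pd_W by (simp add: inner_vec_def UNIV_2 algebra_simps)
      show "?V x + ?T x \<le> 0"
      proof (cases "a s x \<le> 0")
        case True
        then have "W' s x = 0" by (simp add: W'_def)
        then show ?thesis unfolding eq by simp
      next
        case False
        then have xB: "x \<in> B" using out s by blast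
        have "(norm (x - x0))\<^sup>2 \<le> (b s)\<^sup>2" using False by (simp add: a_def)
        then have nb: "norm (x - x0) \<le> b s" by (rule power2_le_imp_le) (use b_pos s in \<open>simp add: less_imp_le\<close>)
        have "\<bar>(x - x0) \<bullet> u s x\<bar> \<le> norm (x - x0) * norm (u s x)" by (rule Cauchy_Schwarz_ineq2)
        also have "\<dots> \<le> b s * \<epsilon>" using nb slow[OF s B_out[OF xB]] by (intro mult_mono) (use b_pos s in \<open>auto simp: less_imp_le\<close>)
        finally have "0 \<le> (x - x0) \<bullet> u s x + b s * \<epsilon>" by linarith
        moreover have "0 \<le> W' s x" by (simp add: W'_def)
        ultimately have "0 \<le> 2 * W' s x * \<rho> s x * ((x - x0) \<bullet> u s x + b s * \<epsilon>)"
          using rho_nonneg[OF s0] by simp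
        then show ?thesis unfolding eq by simp
      qed
    qed simp
    finally show ?thesis by simp
  qed
  have "E t2 \<le> E t1"
    by (rule nonincreasing_if_derivative_within_nonpos[OF t dE neg])
  also have "E t1 = (LINT x|?M. 0)"
    unfolding E_def by (rule Bochner_Integration.integral_cong) (auto simp: space_restrict_space vac B_out)
  finally have "E t2 \<le> 0" by simp
  have t2: "0 \<le> t2" using t by simp
  have c: "continuous_on UNIV (\<lambda>x. \<rho> t2 x * W t2 x)"
    using C_diff_continuous[OF C1_rho[OF t2]] C_diff_continuous[OF C1_W] by (intro continuous_intros)
  have "vanishes_off_compact (\<lambda>x. \<rho> t2 x * W t2 x)"
    unfolding vanishes_off_compact_def using B out_W t by force
  then have "\<rho> t2 x0 * W t2 x0 = 0"
  proof (intro eq_0_if_integral_le_0[OF c] integrable_if_vanishes_off_compact[OF c])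
    show "0 \<le> \<rho> t2 x * W t2 x" for x using rho_nonneg[OF t2] by (simp add: W_def)
    show "(LINT x|lborel. \<rho> t2 x * W t2 x) \<le> 0"
      using \<open>E t2 \<le> 0\<close> integral_restrict_lborel[OF B, of "\<lambda>x. \<rho> t2 x * W t2 x"] out_W t by (simp add: E_def)
  qed
  moreover have "W t2 x0 \<noteq> 0" using \<eta> by (simp add: W_def a_def b_def pos_powr_def)
  ultimately show ?thesis by simp
qed

end

context global_radial_flow
begin

text \<open>For every \<open>\<epsilon> > 0\<close> the front moves at most at speed \<open>\<epsilon>\<close>, by continuous induction on time: as long
  as this holds, the velocity beyond the front vanishes, so for a short further time it is at most
  \<open>\<epsilon>\<close>, and the front keeps its speed limit.\<close>

lemma density_support:
  assumes t: "0 \<le> t" and x: "R0 < norm x"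
  shows "\<rho> t x = 0"
proof -
  define Z where "Z \<epsilon> s \<longleftrightarrow> (\<forall>y. R0 + \<epsilon> * s < norm y \<longrightarrow> \<rho> s y = 0)" for \<epsilon> s
  have slow_front: "Z \<epsilon> T" if \<epsilon>: "0 < \<epsilon>" and T: "0 \<le> T" for \<epsilon> T
  proof (rule ccontr)
    assume bad: "\<not> Z \<epsilon> T"
    define S where "S = {s. 0 \<le> s \<and> (\<forall>r\<in>{0..s}. Z \<epsilon> r)}"
    have ub: "s \<le> T" if "s \<in> S" for s
      using that bad T by (force simp: S_def)
    then have bdd: "bdd_above S" by (auto simp: bdd_above_def)
    have S0: "0 \<in> S" using rho_0 by (auto simp: S_def Z_def)
    define \<tau> where "\<tau> = Sup S"
    have \<tau>0: "0 \<le> \<tau>" unfolding \<tau>_def by (rule cSup_upper[OF S0 bdd])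
    have below: "Z \<epsilon> r" if r: "0 \<le> r" "r < \<tau>" for r
    proof -
      obtain s where "s \<in> S" "r < s"
        using r(2) less_cSup_iff[of S r] S0 bdd unfolding \<tau>_def by blast
      then show ?thesis using r(1) by (auto simp: S_def)
    qed
    have Z\<tau>: "Z \<epsilon> \<tau>"
    proof (cases "\<tau> = 0")
      case True
      then show ?thesis using rho_0 by (simp add: Z_def)
    next
      case False
      show ?thesis
        unfolding Z_def
      proof (intro allI impI)
        fix y :: "real^2" assume y: "R0 + \<epsilon> * \<tau> < norm y"
        have cl: "closure {0..<\<tau>} = {0..\<tau>}" using False \<tau>0 by simp
        have "continuous (at s within {0..}) (\<lambda>s. \<rho> s y)" if "0 \<le> s" for s
          using DERIV_continuous[OF continuity[OF that]] .
        then have "continuous_on {0..} (\<lambda>s. \<rho> s y)" by (auto simp: continuous_on_eq_continuous_within)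
        then have c: "continuous_on (closure {0..<\<tau>}) (\<lambda>s. \<rho> s y)"
          unfolding cl by (rule continuous_on_subset) auto
        have z: "\<rho> s y = 0" if "s \<in> {0..<\<tau>}" for s
        proof -
          have "\<epsilon> * s \<le> \<epsilon> * \<tau>" using that \<epsilon> by (intro mult_left_mono) auto
          then show ?thesis using below[of s] that y by (auto simp: Z_def)
        qed
        show "\<rho> \<tau> y = 0"
          by (rule continuous_constant_on_closure[OF c z]) (use \<tau>0 in \<open>auto simp: cl\<close>)
      qed
    qed
    let ?R = "R0 + \<epsilon> * \<tau>"
    have R: "0 < ?R" using R0 \<epsilon> \<tau>0 by (simp add: add_pos_nonneg)
    have u0: "u \<tau> y = 0" if "?R < norm y" for y
      by (rule velocity_eq_0_in_vacuum[OF \<tau>0 R _ that]) (use Z\<tau> in \<open>auto simp: Z_def\<close>)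
    have "\<forall>\<^sub>F s in at \<tau> within {0..}. \<forall>y\<in>UNIV. dist (u s y) (u \<tau> y) < \<epsilon>"
      by (rule uniform_limitD[OF u_uniform[OF \<tau>0] \<epsilon>])
    then obtain \<delta> where \<delta>: "\<delta> > 0"
        "\<And>s y. 0 \<le> s \<Longrightarrow> s \<noteq> \<tau> \<Longrightarrow> dist s \<tau> < \<delta> \<Longrightarrow> dist (u s y) (u \<tau> y) < \<epsilon>"
      unfolding eventually_at by auto
    have "Z \<epsilon> s" if s: "\<tau> \<le> s" "s \<le> \<tau> + \<delta> / 2" for s
      unfolding Z_def
    proof (intro allI impI)
      fix y :: "real^2" assume y: "R0 + \<epsilon> * s < norm y"
      show "\<rho> s y = 0"
      proof (rule finite_speed_of_vacuum_front[OF \<tau>0 s(1) \<epsilon>, of ?R])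
        show "?R + \<epsilon> * (s - \<tau>) < norm y" using y by (simp add: algebra_simps)
        show "\<rho> \<tau> z = 0" if "?R < norm z" for z using Z\<tau> that by (simp add: Z_def)
        show "norm (u r z) \<le> \<epsilon>" if r: "\<tau> \<le> r" "r \<le> s" "?R < norm z" for r z
        proof (cases "r = \<tau>")
          case True
          then show ?thesis using u0[OF r(3)] \<epsilon> by simp
        next
          case False
          then show ?thesis
            using \<delta>(2)[of r z] r s \<tau>0 \<delta>(1) u0[OF r(3)] by (simp add: dist_real_def)
        qed
      qed
    qed
    then have "\<tau> + \<delta> / 2 \<in> S"
      using below \<tau>0 \<delta>(1) by (force simp: S_def not_le[symmetric])
    then have "\<tau> + \<delta> / 2 \<le> \<tau>" unfolding \<tau>_def by (intro cSup_upper bdd)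
    then show False using \<delta>(1) by simp
  qed
  \<comment> \<open>At this speed the front has not reached \<open>x\<close> at time \<open>t\<close>.\<close>
  define \<epsilon> where "\<epsilon> = (norm x - R0) / (2 * (t + 1))"
  have \<epsilon>: "0 < \<epsilon>" using x t by (simp add: \<epsilon>_def)
  have "\<epsilon> * t < \<epsilon> * (2 * (t + 1))" using \<epsilon> t by (intro mult_strict_left_mono) auto
  also have "\<dots> = norm x - R0" using t by (simp add: \<epsilon>_def)
  finally show ?thesis using slow_front[OF \<epsilon> t] by (simp add: Z_def)
qed

lemma velocity_support: "0 \<le> t \<Longrightarrow> R0 < norm x \<Longrightarrow> u t x = 0"
  using velocity_eq_0_in_vacuum[OF _ R0 density_support] by blast

section \<open>Virial identities\<close>

text \<open>The fluid is in this ball at all times.  Integrals that are to be differentiated in time are taken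
  over it, because it has finite measure.\<close>

abbreviation "B \<equiv> cball (0 :: real^2) R0"
abbreviation "M \<equiv> restrict_space lborel B"

lemma density_off_B: "0 \<le> t \<Longrightarrow> x \<notin> B \<Longrightarrow> \<rho> t x = 0" and velocity_off_B: "0 \<le> t \<Longrightarrow> x \<notin> B \<Longrightarrow> u t x = 0"
  by (auto simp: density_support velocity_support)

lemma vanishes_if_0_off_B: "(\<And>x. x \<notin> B \<Longrightarrow> f x = 0) \<Longrightarrow> vanishes_off_compact f"
  unfolding vanishes_off_compact_def using compact_cball by blast

lemma finite_M: "finite_measure M"
  by (rule finite_measure_restrict_lborel) simp

lemma integral_M: "(\<And>x. x \<notin> B \<Longrightarrow> f x = 0) \<Longrightarrow> (LINT x|M. f x) = (LINT x|lborel. (f x :: real))"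
  by (rule integral_restrict_lborel) auto

lemma space_M: "space M = B" by (simp add: space_restrict_space)

lemma L1_const: "continuous_on UNIV f \<Longrightarrow> L1_differentiable M I t (\<lambda>_. f)"
proof (rule L1_differentiable_const)
  assume c: "continuous_on UNIV f"
  show "f \<in> borel_measurable M"
    using borel_measurable_continuous_onI[OF c] by (intro measurable_restrict_space1) simp
  show "bounded (f ` space M)"
    using compact_imp_bounded[OF compact_continuous_image[OF continuous_on_subset[OF c], of B]]
    by (simp add: space_M)
qed

lemma divergence_off_B:
  assumes "\<And>x. x \<notin> B \<Longrightarrow> F x = 0" "x \<notin> B" shows "divergence F x = 0"
  unfolding divergence_def
  by (intro sum.neutral ballI pd_eq_0_open[of "- B" x _ 0]) (use assms in auto)

lemma flux_off_B: "0 \<le> t \<Longrightarrow> x \<notin> B \<Longrightarrow> \<rho> t x *\<^sub>R u t x = 0"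
  using density_off_B by simp

lemma has_derivative_weighted_mass:
  assumes t: "0 \<le> t" and w: "C_diff 1 w"
  shows "((\<lambda>s. LINT x|M. \<rho> s x * w x) has_real_derivative
      (LINT x|lborel. \<rho> t x * (\<Sum>i\<in>UNIV. pd i w x * u t x $ i))) (at t within {0..})"
proof -
  let ?F = "\<lambda>y. \<rho> t y *\<^sub>R u t y"
  have "((\<lambda>s. LINT x|M. \<rho> s x * w x) has_real_derivative (LINT x|M. - divergence ?F x * w x)) (at t within {0..})"
  proof (rule has_real_derivative_integral[OF _ islimpt_atLeast_0 finite_M])
    show "L1_differentiable M {0..} t (\<lambda>s x. \<rho> s x * w x)"
      using t C_diff_continuous[OF w] by (intro L1_differentiable_mult L1_rho L1_const) auto
    show "((\<lambda>s. \<rho> s x * w x) has_real_derivative - divergence ?F x * w x) (at t within {0..})" for x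
      by (rule DERIV_cmult_right[OF continuity[OF t]])
  qed (use t in auto)
  moreover have "(LINT x|M. - divergence ?F x * w x) = (LINT x|lborel. - divergence ?F x * w x)"
    by (rule integral_M) (use divergence_off_B[of ?F] flux_off_B[OF t] in simp)
  moreover have "\<dots> = - (LINT x|lborel. w x * divergence ?F x)"
    by (simp add: mult.commute)
  moreover have "\<dots> = (LINT x|lborel. (\<Sum>i\<in>UNIV. pd i w x * ?F x $ i))"
    using integral_mult_divergence[OF C1_rho_u[OF t] w disjI2[OF vanishes_if_0_off_B]] flux_off_B[OF t] by simp
  moreover have "(\<Sum>i\<in>UNIV. pd i w x * ?F x $ i) = \<rho> t x * (\<Sum>i\<in>UNIV. pd i w x * u t x $ i)" for x
    by (simp add: sum_distrib_left mult_ac)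
  ultimately show ?thesis by simp
qed

lemma mass_conserved: 
  assumes "0 \<le> t" shows "(LINT x|M. \<rho> t x) = (LINT x|M. \<rho> 0 x)"
proof -
  have D: "((\<lambda>s. LINT x|M. \<rho> s x) has_real_derivative 0) (at s within {0..})" if "0 \<le> s" for s
    using has_derivative_weighted_mass[OF that C_diff_const[of 1 1]] by simp
  have D': "((\<lambda>s. - (LINT x|M. \<rho> s x)) has_real_derivative 0) (at s within {0..})" if "0 \<le> s" for s
    using DERIV_minus[OF D[OF that]] by simp
  show ?thesis
    using nonincreasing_if_derivative_within_nonpos[OF _ assms D]
      nonincreasing_if_derivative_within_nonpos[OF _ assms D'] by force
qed

lemma C1_rho_powr: "0 \<le> t \<Longrightarrow> 1 < p \<Longrightarrow> C_diff 1 (\<lambda>x. pos_powr p (\<rho> t x))"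
  by (rule C_diff_1_compose_real[OF C1_rho DERIV_pos_powr])
     (auto intro!: continuous_intros continuous_on_pos_powr)

text \<open>The continuity equation turns into \<open>\<partial>(\<rho>^p)/\<partial>t + div (\<rho>^p u) = - (p - 1) \<rho>^p div u\<close>, and the
  divergence integrates to 0.\<close>

lemma has_derivative_integral_rho_powr:
  assumes t: "0 \<le> t" and p: "1 < p"
  shows "((\<lambda>s. LINT x|M. pos_powr p (\<rho> s x)) has_real_derivative
      - (p - 1) * (LINT x|lborel. pos_powr p (\<rho> t x) * divergence (u t) x)) (at t within {0..})"
proof -
  let ?F = "\<lambda>y. \<rho> t y *\<^sub>R u t y" and ?g = "\<lambda>x. pos_powr p (\<rho> t x)"
  let ?G = "\<lambda>y. ?g y *\<^sub>R u t y"
  let ?D = "\<lambda>x. p * pos_powr (p - 1) (\<rho> t x) * - divergence ?F x"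
  have "((\<lambda>s. LINT x|M. pos_powr p (\<rho> s x)) has_real_derivative (LINT x|M. ?D x)) (at t within {0..})"
  proof (rule has_real_derivative_integral[OF _ islimpt_atLeast_0 finite_M])
    show "L1_differentiable M {0..} t (\<lambda>s x. pos_powr p (\<rho> s x))"
      by (rule L1_differentiable_compose[OF _ L1_rho DERIV_pos_powr])
         (use t p in \<open>auto intro!: continuous_intros continuous_on_pos_powr\<close>)
    show "((\<lambda>s. pos_powr p (\<rho> s x)) has_real_derivative ?D x) (at t within {0..})" for x
      by (rule DERIV_chain2[OF DERIV_pos_powr[OF p] continuity[OF t]])
  qed (use t in auto)
  moreover have "(LINT x|M. ?D x) = (LINT x|lborel. ?D x)"
    by (rule integral_M) (use divergence_off_B[of ?F] flux_off_B[OF t] in simp)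
  moreover have "(LINT x|lborel. ?D x) = - (p - 1) * (LINT x|lborel. ?g x * divergence (u t) x)"
  proof -
    have g1: "C_diff 1 ?g" by (rule C1_rho_powr[OF t p])
    have G1: "C_diff 1 ?G" by (rule C_diff_scaleR[OF g1 C1_u[OF t]])
    have Goff: "?G x = 0" if "x \<notin> B" for x using velocity_off_B[OF t that] by simp
    have pd_scale: "pd i (\<lambda>y. h y *\<^sub>R u t y) x $ i = pd i h x * u t x $ i + h x * pd i (u t) x $ i"
      if "C_diff 1 h" for h i x
      using that C1_u[OF t] by (subst pd_scaleR) simp_all
    have pdg: "pd i ?g x = p * pos_powr (p - 1) (\<rho> t x) * pd i (\<rho> t) x" for i x
      using C1_rho[OF t] by (intro pd_compose_real(1) DERIV_pos_powr p) simp
    have base: "p * pos_powr (p - 1) (\<rho> t x) * \<rho> t x = p * ?g x" for x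
      using powr_mult_base[of "\<rho> t x" "p - 1"] rho_nonneg[OF t, of x]
      by (simp add: pos_powr_eq mult.commute mult.left_commute)
    have pt: "?D x = - divergence ?G x - (p - 1) * (?g x * divergence (u t) x)" for x
    proof -
      have "p * pos_powr (p - 1) (\<rho> t x) * divergence ?F x
          = (\<Sum>i\<in>UNIV. p * pos_powr (p - 1) (\<rho> t x) * pd i (\<rho> t) x * u t x $ i) + p * pos_powr (p - 1) (\<rho> t x) * \<rho> t x * divergence (u t) x"
        unfolding divergence_eq[OF C1_rho_u[OF t]] divergence_eq[OF C1_u[OF t]] pd_scale[OF C1_rho[OF t]]
        by (simp add: sum.distrib sum_distrib_left distrib_left mult_ac)
      also have "(\<Sum>i\<in>UNIV. p * pos_powr (p - 1) (\<rho> t x) * pd i (\<rho> t) x * u t x $ i)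
          = divergence ?G x - ?g x * divergence (u t) x"
        unfolding divergence_eq[OF G1] divergence_eq[OF C1_u[OF t]] pd_scale[OF g1] pdg
        by (simp add: sum.distrib sum_distrib_left)
      finally show ?thesis unfolding base by (simp add: algebra_simps)
    qed
    have cG: "continuous_on UNIV (divergence ?G)"
      unfolding divergence_eq[OF G1] using G1 by (auto intro!: continuous_intros)
    have cu: "continuous_on UNIV (divergence (u t))"
      unfolding divergence_eq[OF C1_u[OF t]] using C1_u[OF t] by (auto intro!: continuous_intros)
    have iG: "integrable lborel (divergence ?G)"
      by (rule integrable_if_vanishes_off_compact[OF cG vanishes_if_0_off_B[OF divergence_off_B[OF Goff]]])
    have ig: "integrable lborel (\<lambda>x. ?g x * divergence (u t) x)"
      using C_diff_continuous[OF g1] cu divergence_off_B[OF velocity_off_B[OF t]]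
      by (intro integrable_if_vanishes_off_compact vanishes_if_0_off_B continuous_intros) auto
    have "(LINT x|lborel. divergence ?G x) = 0"
      using integral_mult_divergence[OF G1 C_diff_const[of 1 1] disjI2[OF vanishes_if_0_off_B[OF Goff]]] by simp
    then show ?thesis unfolding pt using iG ig by (simp add: left_diff_distrib)
  qed
  ultimately show ?thesis by simp
qed

end

context global_radial_flow
begin

lemma rho_powr: "0 \<le> t \<Longrightarrow> \<rho> t x powr p = pos_powr p (\<rho> t x)"
  by (simp add: pos_powr_eq rho_nonneg)

text \<open>Integrating by parts once leaves minus the integral of the divergence of \<open>w\<close>, which is 0.\<close>

lemma integral_x_laplacian:
  assumes w: "C_diff 2 w" and off: "\<And>x. x \<notin> B \<Longrightarrow> w x = 0"
  shows "integrable lborel (\<lambda>x. \<Sum>j\<in>UNIV. x $ j * laplacian w x $ j)"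
    and "(LINT x|lborel. (\<Sum>j\<in>UNIV. x $ j * laplacian w x $ j)) = 0"
proof -
  let ?f = "\<lambda>i j x. pd i w x $ j"
  have f1: "C_diff 1 (?f i j)" for i j by (rule C_diff_component[OF C_diff_2_D(2)[OF w]])
  have Kw: "vanishes_off_compact w" by (rule vanishes_if_0_off_B[OF off])
  have Kf: "vanishes_off_compact (?f i j)" for i j
    by (intro vanishes_off_compact_component vanishes_off_compact_pd Kw)
  have Kc: "vanishes_off_compact (\<lambda>x. w x $ j)" for j
    by (rule vanishes_off_compact_component[OF Kw])
  have eq: "x $ j * laplacian w x $ j = (\<Sum>i\<in>UNIV. x $ j * pd i (?f i j) x)" for x j
    using C_diff_2_D(2)[OF w] by (simp add: laplacian_def pd_component sum_distrib_left)
  have zero: "(LINT x|lborel. ?f j j x) = 0" for j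
  proof -
    have "pd j (\<lambda>x. w x $ j) = ?f j j" using C_diff_2_D(1)[OF w] by (auto simp: pd_component)
    then show ?thesis
      using integral_pd_eq_0[OF C_diff_component[OF C_diff_2_D(1)[OF w]] Kc, of j j] by simp
  qed
  show "integrable lborel (\<lambda>x. \<Sum>j\<in>UNIV. x $ j * laplacian w x $ j)"
    unfolding eq by (intro Bochner_Integration.integrable_sum integral_nth_mult_pd(1) f1 Kf)
  show "(LINT x|lborel. (\<Sum>j\<in>UNIV. x $ j * laplacian w x $ j)) = 0"
    unfolding eq
    by (simp add: Bochner_Integration.integral_sum Bochner_Integration.integrable_sum
        integral_nth_mult_pd[OF f1 Kf] zero sum_negf)
qed

lemma integral_x_grad:
  fixes f :: "real^2 \<Rightarrow> real"
  assumes f: "C_diff 1 f" and K: "vanishes_off_compact f"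
  shows "integrable lborel (\<lambda>x. \<Sum>j\<in>UNIV. x $ j * grad f x $ j)"
    and "(LINT x|lborel. (\<Sum>j\<in>UNIV. x $ j * grad f x $ j)) = - 2 * (LINT x|lborel. f x)"
  unfolding grad_def vec_lambda_beta
   apply (intro Bochner_Integration.integrable_sum integral_nth_mult_pd(1) f K)
  by (simp add: Bochner_Integration.integral_sum integral_nth_mult_pd[OF f K])

lemma integral_x_div_matrix:
  fixes m :: "real^2 \<Rightarrow> real^2^2"
  assumes m: "\<And>i j. C_diff 1 (\<lambda>x. m x $ i $ j)" and K: "\<And>i j. vanishes_off_compact (\<lambda>x. m x $ i $ j)"
  shows "integrable lborel (\<lambda>x. \<Sum>j\<in>UNIV. x $ j * div_matrix m x $ j)"
    and "(LINT x|lborel. (\<Sum>j\<in>UNIV. x $ j * div_matrix m x $ j)) = - (\<Sum>j\<in>UNIV. LINT x|lborel. m x $ j $ j)"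
proof -
  have eq: "x $ j * div_matrix m x $ j = (\<Sum>i\<in>UNIV. x $ j * pd i (\<lambda>x. m x $ i $ j) x)" for x j
    by (simp add: div_matrix_def sum_distrib_left)
  show "integrable lborel (\<lambda>x. \<Sum>j\<in>UNIV. x $ j * div_matrix m x $ j)"
    unfolding eq by (intro Bochner_Integration.integrable_sum integral_nth_mult_pd(1) m K)
  show "(LINT x|lborel. (\<Sum>j\<in>UNIV. x $ j * div_matrix m x $ j)) = - (\<Sum>j\<in>UNIV. LINT x|lborel. m x $ j $ j)"
    unfolding eq
    by (simp add: Bochner_Integration.integral_sum Bochner_Integration.integrable_sum
        integral_nth_mult_pd[OF m K] sum_negf)
qed

text \<open>Multiply the momentum equation by \<open>x\<close> and integrate by parts.  The constant viscosity \<open>\<mu>\<close> contributes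
  nothing, since the divergence of a compactly supported field has integral 0.\<close>

lemma has_derivative_radial_momentum:
  assumes t: "0 \<le> t"
  shows "((\<lambda>s. LINT x|M. (\<Sum>j\<in>UNIV. x $ j * (\<rho> s x * u s x $ j))) has_real_derivative
      (LINT x|lborel. \<rho> t x * (norm (u t x))\<^sup>2) + 2 * A * (LINT x|lborel. pos_powr \<gamma> (\<rho> t x))
      - 2 * c * (LINT x|lborel. pos_powr \<beta> (\<rho> t x) * divergence (u t) x)) (at t within {0..})"
proof -
  define \<Lambda> where "\<Lambda> y = (\<mu> + c * \<rho> t y powr \<beta>) * divergence (u t) y" for y
  define p where "p y = A * \<rho> t y powr \<gamma>" for y
  define m where "m y = \<rho> t y *\<^sub>R tensor (u t y) (u t y)" for y
  define V where "V x = \<mu> *\<^sub>R laplacian (u t) x + grad \<Lambda> x - div_matrix m x - grad p x" for x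
  let ?D = "\<lambda>x. \<Sum>j\<in>UNIV. x $ j * V x $ j"
  have mom: "((\<lambda>s. \<rho> s x *\<^sub>R u s x) has_vector_derivative V x) (at t within {0..})" for x
    using momentum[OF t, of x] unfolding V_def \<Lambda>_def[abs_def] p_def[abs_def] m_def[abs_def] .
  have V_off: "V x = 0" if "x \<notin> B" for x
  proof (rule vector_derivative_unique_within[OF _ mom])
    show "at t within {0..} \<noteq> bot"
      using islimpt_atLeast_0[OF t] by (simp add: trivial_limit_within)
    have "((\<lambda>s. 0) has_vector_derivative 0) (at t within {0..})" by simp
    then show "((\<lambda>s. \<rho> s x *\<^sub>R u s x) has_vector_derivative 0) (at t within {0..})"
      by (rule has_vector_derivative_transform[rotated 2]) (use t that in \<open>auto simp: density_off_B\<close>)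
  qed
  have D: "((\<lambda>s. LINT x|M. (\<Sum>j\<in>UNIV. x $ j * (\<rho> s x * u s x $ j))) has_real_derivative (LINT x|M. ?D x))
      (at t within {0..})"
  proof (rule has_real_derivative_integral[OF _ islimpt_atLeast_0 finite_M])
    show "L1_differentiable M {0..} t (\<lambda>s x. \<Sum>j\<in>UNIV. x $ j * (\<rho> s x * u s x $ j))"
      using t by (intro L1_differentiable_sum L1_differentiable_mult L1_const L1_rho L1_u) (auto intro!: continuous_intros)
    show "((\<lambda>s. \<Sum>j\<in>UNIV. x $ j * (\<rho> s x * u s x $ j)) has_real_derivative ?D x) (at t within {0..})" for x
    proof -
      have "((\<lambda>s. (\<rho> s x *\<^sub>R u s x) $ j) has_real_derivative V x $ j) (at t within {0..})" for j
        using bounded_linear.has_vector_derivative[OF bounded_linear_vec_nth mom]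
        by (simp add: has_real_derivative_iff_has_vector_derivative)
      then have "((\<lambda>s. \<rho> s x * u s x $ j) has_real_derivative V x $ j) (at t within {0..})" for j by simp
      then show ?thesis by (intro DERIV_sum DERIV_cmult)
    qed
  qed (use t in auto)
  have "(LINT x|M. ?D x) = (LINT x|lborel. ?D x)" by (rule integral_M) (simp add: V_off)
  also have "\<dots> = (LINT x|lborel. \<rho> t x * (norm (u t x))\<^sup>2) + 2 * A * (LINT x|lborel. pos_powr \<gamma> (\<rho> t x))
      - 2 * c * (LINT x|lborel. pos_powr \<beta> (\<rho> t x) * divergence (u t) x)"
  proof -
    note u1 = C1_u[OF t] and r1 = C1_rho[OF t]
    have du1: "C_diff 1 (divergence (u t))" by (rule C_diff_divergence[OF C2_u[OF t]])
    have du_off: "divergence (u t) x = 0" if "x \<notin> B" for x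
      by (rule divergence_off_B[OF velocity_off_B[OF t] that])
    have rb: "C_diff 1 (\<lambda>x. pos_powr \<beta> (\<rho> t x))" "C_diff 1 (\<lambda>x. pos_powr \<gamma> (\<rho> t x))"
      using C1_rho_powr[OF t] constants by auto
    have L1: "C_diff 1 \<Lambda>"
      unfolding \<Lambda>_def[abs_def] rho_powr[OF t] by (intro C_diff_mult C_diff_add C_diff_const rb du1)
    have LK: "vanishes_off_compact \<Lambda>" by (rule vanishes_if_0_off_B) (simp add: \<Lambda>_def du_off)
    have p1: "C_diff 1 p" unfolding p_def[abs_def] rho_powr[OF t] by (intro C_diff_mult C_diff_const rb)
    have pK: "vanishes_off_compact p" by (rule vanishes_if_0_off_B) (simp add: p_def density_off_B[OF t])
    have m_eq: "m x $ i $ j = \<rho> t x * (u t x $ i * u t x $ j)" for x i j by (simp add: m_def tensor_def)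
    have m1: "C_diff 1 (\<lambda>x. m x $ i $ j)" for i j
      unfolding m_eq by (intro C_diff_mult r1 C_diff_component u1)
    have mK: "vanishes_off_compact (\<lambda>x. m x $ i $ j)" for i j
      by (rule vanishes_if_0_off_B) (simp add: m_eq density_off_B[OF t])
    note l = integral_x_laplacian[OF C2_u[OF t] velocity_off_B[OF t]]
    note g = integral_x_grad[OF L1 LK] and h = integral_x_grad[OF p1 pK]
    note d = integral_x_div_matrix[of m, OF m1 mK]
    have "?D x = \<mu> * (\<Sum>j\<in>UNIV. x $ j * laplacian (u t) x $ j) + (\<Sum>j\<in>UNIV. x $ j * grad \<Lambda> x $ j)
        - (\<Sum>j\<in>UNIV. x $ j * div_matrix m x $ j) - (\<Sum>j\<in>UNIV. x $ j * grad p x $ j)" for x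
      by (simp add: V_def UNIV_2 algebra_simps)
    then have "(LINT x|lborel. ?D x) = - 2 * (LINT x|lborel. \<Lambda> x)
        + (\<Sum>j\<in>UNIV. LINT x|lborel. m x $ j $ j) + 2 * (LINT x|lborel. p x)"
      using l g h d by simp
    moreover have "(LINT x|lborel. \<Lambda> x) = c * (LINT x|lborel. pos_powr \<beta> (\<rho> t x) * divergence (u t) x)"
    proof -
      have i1: "integrable lborel (divergence (u t))"
        by (rule integrable_if_vanishes_off_compact[OF C_diff_continuous[OF du1] vanishes_if_0_off_B[OF du_off]])
      have i2: "integrable lborel (\<lambda>x. pos_powr \<beta> (\<rho> t x) * divergence (u t) x)"
        by (rule integrable_if_vanishes_off_compact[OF C_diff_continuous[OF C_diff_mult[OF rb(1) du1]]
            vanishes_if_0_off_B]) (simp add: du_off)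
      have z: "(LINT x|lborel. divergence (u t) x) = 0"
        using integral_mult_divergence[OF u1 C_diff_const[of 1 1] disjI2[OF vanishes_if_0_off_B[OF velocity_off_B[OF t]]]] by simp
      have "\<Lambda> x = \<mu> * divergence (u t) x + c * (pos_powr \<beta> (\<rho> t x) * divergence (u t) x)" for x
        by (simp add: \<Lambda>_def rho_powr[OF t] algebra_simps)
      then show ?thesis using i1 i2 z by simp
    qed
    moreover have "(LINT x|lborel. p x) = A * (LINT x|lborel. pos_powr \<gamma> (\<rho> t x))"
      by (simp add: p_def rho_powr[OF t])
    moreover have "(\<Sum>j\<in>UNIV. LINT x|lborel. m x $ j $ j) = (LINT x|lborel. \<rho> t x * (norm (u t x))\<^sup>2)"
    proof -
      have "(\<Sum>j\<in>UNIV. LINT x|lborel. m x $ j $ j) = (LINT x|lborel. (\<Sum>j\<in>UNIV. m x $ j $ j))"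
        by (rule Bochner_Integration.integral_sum[symmetric])
           (rule integrable_if_vanishes_off_compact[OF C_diff_continuous[OF m1] mK])
      then show ?thesis
        by (simp add: m_eq sum_distrib_left[symmetric] power2_norm_eq_inner inner_vec_def)
    qed
    ultimately show ?thesis by simp
  qed
  finally have "(LINT x|M. ?D x) = (LINT x|lborel. \<rho> t x * (norm (u t x))\<^sup>2)
      + 2 * A * (LINT x|lborel. pos_powr \<gamma> (\<rho> t x))
      - 2 * c * (LINT x|lborel. pos_powr \<beta> (\<rho> t x) * divergence (u t) x)" .
  then show ?thesis using D by simp
qed

lemma continuous_density_integrable:
  fixes f :: "real^2 \<Rightarrow> real"
  assumes "0 \<le> t" and "continuous_on UNIV f" and "\<And>x. \<rho> t x = 0 \<Longrightarrow> f x = 0"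
  shows "integrable lborel f"
  using assms density_off_B by (intro integrable_if_vanishes_off_compact vanishes_if_0_off_B) auto

text \<open>For \<open>y \<ge> 0\<close> one has \<open>y^\<gamma> \<ge> \<kappa>^(\<gamma>-1) (y - \<kappa>)\<close>, which is integrated over the ball; it serves as a
  substitute for Jensen's inequality.\<close>

lemma pressure_integral_lower_bound:
  assumes t: "0 \<le> t" and \<kappa>: "0 < \<kappa>"
  shows "\<kappa> powr (\<gamma> - 1) * ((LINT x|M. \<rho> t x) - \<kappa> * measure lborel B) \<le> (LINT x|lborel. pos_powr \<gamma> (\<rho> t x))"
proof -
  have r: "integrable lborel (\<rho> t)"
    using C_diff_continuous[OF C1_rho[OF t]] by (rule continuous_density_integrable[OF t])
  have g: "integrable lborel (\<lambda>x. pos_powr \<gamma> (\<rho> t x))"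
    using constants by (intro continuous_density_integrable[OF t] C_diff_continuous[OF C1_rho_powr[OF t]]) auto
  have i: "integrable lborel (\<lambda>x. indicator B x :: real)"
    by (rule integrable_real_indicator) (use emeasure_compact_finite[OF compact_cball[of 0 R0]] in auto)
  have pt: "\<kappa> powr (\<gamma> - 1) * (\<rho> t x - \<kappa> * indicator B x) \<le> pos_powr \<gamma> (\<rho> t x)" for x
  proof (cases "x \<in> B")
    case True
    show ?thesis
    proof (cases "\<kappa> \<le> \<rho> t x")
      case big: True
      then have pos: "0 < \<rho> t x" using \<kappa> by simp
      have "\<kappa> powr (\<gamma> - 1) * (\<rho> t x - \<kappa>) \<le> \<rho> t x powr (\<gamma> - 1) * \<rho> t x"
        using big \<kappa> constants by (intro mult_mono powr_mono2) auto
      also have "\<dots> = \<rho> t x powr \<gamma>" using powr_mult_base[of "\<rho> t x" "\<gamma> - 1"] pos by (simp add: mult.commute)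
      finally show ?thesis using True pos by (simp add: pos_powr_eq)
    next
      case False
      then have "\<kappa> powr (\<gamma> - 1) * (\<rho> t x - \<kappa>) \<le> 0" by (intro mult_nonneg_nonpos) auto
      then show ?thesis using True pos_powr_nonneg[of \<gamma> "\<rho> t x"] by (simp del: pos_powr_nonneg)
    qed
  next
    case False
    then show ?thesis by (simp add: density_off_B[OF t])
  qed
  have "(LINT x|M. \<rho> t x) = (LINT x|lborel. \<rho> t x)" by (rule integral_M[OF density_off_B[OF t]])
  then have "\<kappa> powr (\<gamma> - 1) * ((LINT x|M. \<rho> t x) - \<kappa> * measure lborel B)
      = (LINT x|lborel. \<kappa> powr (\<gamma> - 1) * (\<rho> t x - \<kappa> * indicator B x))"
    using r i by simp
  also have "\<dots> \<le> (LINT x|lborel. pos_powr \<gamma> (\<rho> t x))"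
    using r g i by (intro integral_mono pt) auto
  finally show ?thesis .
qed

text \<open>Mass is conserved.  Taking \<open>\<kappa>\<close> slightly below half of the mean density over the ball leaves at least
  half of the mass in the lower bound.\<close>

lemma pressure_bounded_below:
  assumes "\<rho> 0 x \<noteq> 0"
  obtains g0 where "0 < g0" "\<And>t. 0 \<le> t \<Longrightarrow> g0 \<le> (LINT x|lborel. pos_powr \<gamma> (\<rho> t x))"
proof -
  define m where "m = (LINT x|M. \<rho> 0 x)"
  have c: "continuous_on UNIV (\<rho> 0)" by (rule C_diff_continuous[OF C1_rho]) simp
  have m_eq: "m = (LINT x|lborel. \<rho> 0 x)" unfolding m_def by (rule integral_M[OF density_off_B]) simp
  have m: "0 < m"
  proof (rule ccontr)
    assume "\<not> 0 < m"
    then have le: "(LINT x|lborel. \<rho> 0 x) \<le> 0" by (simp add: m_eq)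
    have i: "integrable lborel (\<rho> 0)" by (rule continuous_density_integrable[OF _ c]) auto
    have "\<rho> 0 x = 0" by (rule eq_0_if_integral_le_0[OF c i rho_nonneg le]) simp
    then show False using assms by simp
  qed
  define \<kappa> where "\<kappa> = (m / 2) / (measure lborel B + 1)"
  have b: "0 < measure lborel B + 1" by (simp add: add_nonneg_pos)
  then have \<kappa>: "0 < \<kappa>" using m by (simp add: \<kappa>_def)
  have "\<kappa> * measure lborel B \<le> \<kappa> * (measure lborel B + 1)" using \<kappa> by (intro mult_left_mono) auto
  also have "\<dots> = m / 2"
    using nonzero_divide_eq_eq[of "measure lborel B + 1" "m / 2" \<kappa>] b \<kappa>_def by linarith
  finally have half: "m / 2 \<le> m - \<kappa> * measure lborel B" by simp
  show ?thesis
  proof (rule that)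
    show "0 < \<kappa> powr (\<gamma> - 1) * (m / 2)" using \<kappa> m by simp
    fix t :: real assume t: "0 \<le> t"
    have "\<kappa> powr (\<gamma> - 1) * (m / 2) \<le> \<kappa> powr (\<gamma> - 1) * (m - \<kappa> * measure lborel B)"
      by (intro mult_left_mono half) auto
    also have "\<dots> \<le> (LINT x|lborel. pos_powr \<gamma> (\<rho> t x))"
      using pressure_integral_lower_bound[OF t \<kappa>] mass_conserved[OF t] by (simp add: m_def)
    finally show "\<kappa> powr (\<gamma> - 1) * (m / 2) \<le> (LINT x|lborel. pos_powr \<gamma> (\<rho> t x))" .
  qed
qed

text \<open>The radial momentum \<open>J\<close>, corrected by the multiple \<open>K F\<close> that cancels the density dependent
  viscosity, grows at least linearly, so the moment of inertia \<open>I\<close> grows at least quadratically.  But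
  \<open>I\<close> stays below \<open>C\<close> because the fluid stays in the ball.\<close>

theorem initial_density_eq_0: "\<rho> 0 x = 0"
proof (rule ccontr)
  assume "\<rho> 0 x \<noteq> 0"
  then obtain g0 where g0: "0 < g0" "\<And>t. 0 \<le> t \<Longrightarrow> g0 \<le> (LINT x|lborel. pos_powr \<gamma> (\<rho> t x))"
    using pressure_bounded_below by blast
  define I where "I t = (LINT x|M. \<rho> t x * ((norm (x - 0))\<^sup>2))" for t
  define J where "J t = (LINT x|M. (\<Sum>j\<in>UNIV. x $ j * (\<rho> t x * u t x $ j)))" for t
  define F where "F t = (LINT x|M. pos_powr \<beta> (\<rho> t x))" for t
  \<comment> \<open>With this factor the integrals of \<open>\<rho>^\<beta> div u\<close> in the derivatives of \<open>J\<close> and \<open>K F\<close> cancel.\<close>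
  define K where "K = 2 * c / (\<beta> - 1)"
  have K: "0 < K" "K * (\<beta> - 1) = 2 * c" using constants by (auto simp: K_def)
  define h where "h = 2 * A * g0"
  have h: "0 < h" using g0 constants by (simp add: h_def)
  have dI: "(I has_real_derivative 2 * J t) (at t within {0..})" if t: "0 \<le> t" for t
  proof -
    have "J t = (LINT x|lborel. (\<Sum>j\<in>UNIV. x $ j * (\<rho> t x * u t x $ j)))"
      unfolding J_def by (rule integral_M) (simp add: density_off_B[OF t])
    moreover have "\<rho> t x * (\<Sum>i\<in>UNIV. pd i (\<lambda>x. (norm (x - 0))\<^sup>2) x * u t x $ i) = 2 * (\<Sum>j\<in>UNIV. x $ j * (\<rho> t x * u t x $ j))" for x
      unfolding pd_sq_dist by (simp add: sum_distrib_left mult_ac)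
    ultimately show ?thesis
      using has_derivative_weighted_mass[OF t C_diff_sq_dist[of 1 0]] unfolding I_def[abs_def] by simp
  qed
  have J_ge: "J 0 - K * F 0 + h * t \<le> J t" if t: "0 \<le> t" for t
  proof -
    define S where "S s = (LINT x|lborel. pos_powr \<beta> (\<rho> s x) * divergence (u s) x)" for s
    define E where "E s = h * s - (J s - K * F s)" for s
    let ?E' = "\<lambda>s. h - ((LINT x|lborel. \<rho> s x * (norm (u s x))\<^sup>2) + 2 * A * (LINT x|lborel. pos_powr \<gamma> (\<rho> s x)))"
    have "(E has_real_derivative ?E' s) (at s within {0..})" if s: "0 \<le> s" for s
    proof -
      have dF: "(F has_real_derivative - (\<beta> - 1) * S s) (at s within {0..})"
        unfolding F_def[abs_def] S_def by (rule has_derivative_integral_rho_powr[OF s]) (use constants in simp)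
      have dJ: "(J has_real_derivative (LINT x|lborel. \<rho> s x * (norm (u s x))\<^sup>2)
          + 2 * A * (LINT x|lborel. pos_powr \<gamma> (\<rho> s x)) - 2 * c * S s) (at s within {0..})"
        unfolding J_def[abs_def] S_def by (rule has_derivative_radial_momentum[OF s])
      have "K * (- (\<beta> - 1) * S s) = - (K * (\<beta> - 1)) * S s" by (simp add: algebra_simps)
      then have "K * (- (\<beta> - 1) * S s) = - 2 * c * S s" unfolding K(2) by simp
      then show ?thesis
        unfolding E_def[abs_def]
        using DERIV_diff[OF DERIV_cmult_Id[of h] DERIV_diff[OF dJ DERIV_cmult[OF dF, of K]]] by simp
    qed
    moreover have "?E' s \<le> 0" if s: "0 \<le> s" for s
    proof -
      have "h \<le> 2 * A * (LINT x|lborel. pos_powr \<gamma> (\<rho> s x))"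
        unfolding h_def using g0(2)[OF s] constants by (intro mult_left_mono) auto
      moreover have "0 \<le> (LINT x|lborel. \<rho> s x * (norm (u s x))\<^sup>2)"
        by (rule Bochner_Integration.integral_nonneg) (simp add: rho_nonneg[OF s])
      ultimately show ?thesis by simp
    qed
    ultimately have "E t \<le> E 0"
      by (intro nonincreasing_if_derivative_within_nonpos[of 0 t E ?E']) (use t in auto)
    moreover have "0 \<le> F t" unfolding F_def by (rule Bochner_Integration.integral_nonneg) simp
    then have "0 \<le> K * F t" using K by simp
    ultimately show ?thesis by (simp add: E_def)
  qed
  define a where "a = J 0 - K * F 0"
  have I_ge: "2 * a * t + h * t\<^sup>2 \<le> I t" if t: "0 \<le> t" for t
  proof -
    define E where "E s = 2 * a * s + h * s\<^sup>2 - I s" for s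
    have "E t \<le> E 0"
    proof (rule nonincreasing_if_derivative_within_nonpos[OF _ t])
      show "(E has_real_derivative 2 * a + h * (2 * s) - 2 * J s) (at s within {0..})" if "0 \<le> s" for s
        unfolding E_def[abs_def] by (auto intro!: derivative_eq_intros dI that)
      show "2 * a + h * (2 * s) - 2 * J s \<le> 0" if "0 \<le> s" for s
        using J_ge[OF that] by (simp add: a_def)
    qed simp
    moreover have "0 \<le> I 0" unfolding I_def
      by (rule Bochner_Integration.integral_nonneg) (simp add: rho_nonneg)
    ultimately show ?thesis by (simp add: E_def)
  qed
  define C where "C = R0\<^sup>2 * (LINT x|M. \<rho> 0 x)"
  have C0: "0 \<le> C" unfolding C_def
    by (intro mult_nonneg_nonneg Bochner_Integration.integral_nonneg) (simp_all add: rho_nonneg)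
  have I_le: "I t \<le> C" if t: "0 \<le> t" for t
  proof -
    have r: "continuous_on UNIV (\<rho> t)" by (rule C_diff_continuous[OF C1_rho[OF t]])
    have "I t = (LINT x|lborel. \<rho> t x * (norm (x - 0))\<^sup>2)"
      unfolding I_def by (rule integral_M) (simp add: density_off_B[OF t])
    also have "\<dots> \<le> (LINT x|lborel. R0\<^sup>2 * \<rho> t x)"
    proof (rule integral_mono)
      show "integrable lborel (\<lambda>x. \<rho> t x * (norm (x - 0))\<^sup>2)"
        using r by (intro continuous_density_integrable[OF t] continuous_intros) auto
      show "integrable lborel (\<lambda>x. R0\<^sup>2 * \<rho> t x)"
        using r by (intro continuous_density_integrable[OF t] continuous_intros) auto
      show "\<rho> t x * (norm (x - 0))\<^sup>2 \<le> R0\<^sup>2 * \<rho> t x" for x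
      proof (cases "x \<in> B")
        case True
        then have "(norm x)\<^sup>2 \<le> R0\<^sup>2" by (intro power_mono) auto
        from mult_left_mono[OF this rho_nonneg[OF t, of x]] show ?thesis by (simp add: mult.commute)
      qed (simp add: density_off_B[OF t])
    qed
    also have "\<dots> = R0\<^sup>2 * (LINT x|M. \<rho> t x)"
      using integral_M[of "\<rho> t", OF density_off_B[OF t]] by simp
    finally show ?thesis by (simp add: C_def mass_conserved[OF t])
  qed
  \<comment> \<open>A time at which the quadratic lower bound for \<open>I\<close> exceeds the upper bound \<open>C\<close>.\<close>
  define T where "T = 1 + (2 * \<bar>a\<bar> + C + 1) / h"
  have "0 \<le> (2 * \<bar>a\<bar> + C + 1) / h" using h C0 by (intro divide_nonneg_pos) auto
  then have T: "1 \<le> T" by (simp add: T_def)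
  have "h * (1 + y / h) = h + y" for y using h by (simp add: distrib_left)
  then have "h * T = h + (2 * \<bar>a\<bar> + C + 1)" unfolding T_def .
  then have "C + 1 \<le> 2 * a + h * T" using abs_ge_minus_self[of a] h by linarith
  with T have "1 * (C + 1) \<le> T * (2 * a + h * T)" by (rule mult_mono) (use T C0 in simp_all)
  also have "\<dots> = 2 * a * T + h * T\<^sup>2" by (simp add: algebra_simps power2_eq_square)
  also have "\<dots> \<le> C" by (rule order_trans[OF I_ge I_le]) (use T in simp_all)
  finally show False by simp
qed

end

text \<open>For infinite \<open>T\<close> the solution is a global radial flow, and such a flow has no mass initially.\<close>

theorem theorem1p8:
  fixes \<mu> A c \<beta> \<gamma> :: real
    and P lam :: "real \<Rightarrow> real"
    and k :: nat
    and T :: ereal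
    and \<rho>0 :: "real^2 \<Rightarrow> real"
    and u0 :: "real^2 \<Rightarrow> real^2"
    and \<rho> :: "real \<Rightarrow> real^2 \<Rightarrow> real"
    and u :: "real \<Rightarrow> real^2 \<Rightarrow> real^2"
  assumes "\<mu> > 0" and "A > 0" and "c > 0"
    and "1 < \<beta>" and "\<beta> \<le> \<gamma>"
    and "P = (\<lambda>s. A * s powr \<gamma>)"
    and "lam = (\<lambda>s. c * s powr \<beta>)"
    and "k > 3"
    and "T > 0"
    and "C1_sobolev (time_interval T) k \<rho>"
    and "C1_sobolev (time_interval T) k u"
    and "spherically_symmetric (time_interval T) \<rho> u"
    and "navier_stokes_solution \<mu> P lam (time_interval T) \<rho>0 u0 \<rho> u"
    and "compact (closure {x. \<rho>0 x \<noteq> 0})"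
    and "\<exists>x. \<rho>0 x \<noteq> 0"
  shows "T < \<infinity>"
proof (rule ccontr)
  assume "\<not> T < \<infinity>"
  then have I: "time_interval T = {0..}" by (auto simp: time_interval_def)
  note ns = assms(13)[unfolded I navier_stokes_solution_def assms(6,7)]
  have C2: "C_diff 2 (\<rho> t)" "C_diff 2 (u t)" if "t \<in> {0..}" for t using ns that by auto
  have init: "\<rho> 0 x = \<rho>0 x" for x using ns by auto
  have k2: "2 \<le> k" using assms(8) by simp
  obtain \<rho>' where \<rho>': "\<And>t. t \<in> {0..} \<Longrightarrow> L2 (\<rho> t)" "\<And>t. t \<in> {0..} \<Longrightarrow> L2 (\<rho>' t)"
    "\<And>t. t \<in> {0..} \<Longrightarrow>
      ((\<lambda>s. LINT x|lborel. (norm ((\<rho> s x - \<rho> t x) /\<^sub>R (s - t) - \<rho>' t x))\<^sup>2) \<longlongrightarrow> 0) (at t within {0..})"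
    "\<And>t. t \<in> {0..} \<Longrightarrow> uniform_limit UNIV \<rho> (\<rho> t) (at t within {0..})"
    using C1_sobolev_time_regularity[OF assms(10)[unfolded I] k2 C2(1)] by auto
  obtain u' where u': "\<And>t. t \<in> {0..} \<Longrightarrow> L2 (u t)" "\<And>t. t \<in> {0..} \<Longrightarrow> L2 (u' t)"
    "\<And>t. t \<in> {0..} \<Longrightarrow>
      ((\<lambda>s. LINT x|lborel. (norm ((u s x - u t x) /\<^sub>R (s - t) - u' t x))\<^sup>2) \<longlongrightarrow> 0) (at t within {0..})"
    "\<And>t. t \<in> {0..} \<Longrightarrow> uniform_limit UNIV u (u t) (at t within {0..})"
    using C1_sobolev_time_regularity[OF assms(11)[unfolded I] k2 C2(2)] by auto
  have "bounded {x. \<rho>0 x \<noteq> 0}" using assms(14) by simp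
  then obtain r where r: "\<And>x. \<rho>0 x \<noteq> 0 \<Longrightarrow> norm x \<le> r" unfolding bounded_iff by auto
  interpret global_radial_flow \<mu> A c \<beta> \<gamma> \<rho> u "max r 1"
  proof
    show "0 < \<mu>" "0 < A" "0 < c" "1 < \<beta>" "1 < \<gamma>" using assms by auto
    show "0 < max r 1" by simp
    show "\<rho> 0 x = 0" if "max r 1 < norm x" for x using r[of x] that init[of x] by (cases "\<rho>0 x = 0") auto
    fix t :: real assume t: "0 \<le> t"
    then have tI: "t \<in> {0..}" by simp
    show "C_diff 2 (\<rho> t)" "C_diff 2 (u t)" using C2[OF tI] by auto
    show "0 \<le> \<rho> t x" for x using ns t by auto
    show "L2 (u t)" using u'(1) t by simp
    show "uniform_limit UNIV u (u t) (at t within {0..})" using u'(4) t by simp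
    show "\<exists>v. \<forall>x. u t x = v (norm x) *\<^sub>R (x /\<^sub>R norm x)"
    proof -
      obtain \<rho>r v where "\<forall>t\<in>{0..}. \<forall>x. \<rho> t x = \<rho>r (norm x) t \<and> u t x = v (norm x) t *\<^sub>R (x /\<^sub>R norm x)"
        using assms(12) unfolding I spherically_symmetric_def by blast
      then show ?thesis using tI by (intro exI[of _ "\<lambda>r. v r t"]) auto
    qed
    show "((\<lambda>s. \<rho> s x) has_real_derivative - divergence (\<lambda>y. \<rho> t y *\<^sub>R u t y) x) (at t within {0..})" for x
    proof -
      have "(\<lambda>s. \<rho> s x) differentiable (at t within {0..})"
        and e: "vector_derivative (\<lambda>s. \<rho> s x) (at t within {0..}) + divergence (\<lambda>y. \<rho> t y *\<^sub>R u t y) x = 0"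
        using ns t by auto
      from vector_derivative_works[THEN iffD1, OF this(1)] eq_neg_iff_add_eq_0[THEN iffD2, OF e]
      show ?thesis by (simp add: has_real_derivative_iff_has_vector_derivative)
    qed
    show "((\<lambda>s. \<rho> s x *\<^sub>R u s x) has_vector_derivative
        (\<mu> *\<^sub>R laplacian (u t) x + grad (\<lambda>y. (\<mu> + c * \<rho> t y powr \<beta>) * divergence (u t) y) x
          - div_matrix (\<lambda>y. \<rho> t y *\<^sub>R tensor (u t y) (u t y)) x - grad (\<lambda>y. A * \<rho> t y powr \<gamma>) x))
        (at t within {0..})" for x
    proof -
      let ?V = "vector_derivative (\<lambda>s. \<rho> s x *\<^sub>R u s x) (at t within {0..})"
      have d: "(\<lambda>s. \<rho> s x *\<^sub>R u s x) differentiable (at t within {0..})"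
        and e: "?V + div_matrix (\<lambda>y. \<rho> t y *\<^sub>R tensor (u t y) (u t y)) x + grad (\<lambda>y. A * \<rho> t y powr \<gamma>) x
          = \<mu> *\<^sub>R laplacian (u t) x + grad (\<lambda>y. (\<mu> + c * \<rho> t y powr \<beta>) * divergence (u t) y) x"
        using ns t by auto
      have "?V = \<mu> *\<^sub>R laplacian (u t) x + grad (\<lambda>y. (\<mu> + c * \<rho> t y powr \<beta>) * divergence (u t) y) x
          - div_matrix (\<lambda>y. \<rho> t y *\<^sub>R tensor (u t y) (u t y)) x - grad (\<lambda>y. A * \<rho> t y powr \<gamma>) x"
        unfolding e[symmetric] by simp
      then show ?thesis using vector_derivative_works[THEN iffD1, OF d] by simp
    qed
    fix B :: "(real^2) set" assume B: "compact B"
    have cont: "continuous_on UNIV (\<rho> s)" "continuous_on UNIV (u s)" if "s \<in> {0..}" for s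
      using C_diff_continuous C2[OF that] by auto
    show "L1_differentiable (restrict_space lborel B) {0..} t \<rho>"
      using L1_differentiable_if_L2[OF tI B _ cont(1) \<rho>'(1) \<rho>'(2)[OF tI] \<rho>'(3)[OF tI] \<rho>'(4)[OF tI], of 1] by simp
    show "L1_differentiable (restrict_space lborel B) {0..} t (\<lambda>s x. u s x $ i)" for i
      using L1_differentiable_if_L2[OF tI B _ cont(2) u'(1) u'(2)[OF tI] u'(3)[OF tI] u'(4)[OF tI], of "axis i 1"]
      by (simp add: inner_axis)
  qed
  show False using initial_density_eq_0 init assms(15) by simp
qed

end
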